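(* Let $S\subseteq\mathbb{R}^d$ be closed. Let $\{\epsilon_3^i\}$ and $\{\epsilon_4^i\}$ be strictly decreasing positive sequences approaching $0$ in the limit, and assume $\kappa>\beta+\epsilon_3^1$. Let $\rho>1$, $C_1=\frac{2(1+3\rho)}{\rho-1}+3\rho$, $C_2=\frac{2(1+3\rho)}{\rho-1}+3$, let $\upsilon=d$ if the Stochastic Projected Algorithm (SPA) uses update (1) and $\upsilon=1$ if it uses update (2), and for $i=1,2,\dots$ set $$\alpha^i=\frac{2\epsilon_3^i}{\sqrt d},\qquad K^i=\Big\lceil C_1\frac{2dL_0\Delta}{\epsilon_3^i(\epsilon_4^i)^2}\Big\rceil,\qquad M^i=\Big\lceil C_2\frac{2\upsilon Q}{(\epsilon_4^i)^2}\Big\rceil,$$ where $\Delta>0$ satisfies $\Delta\ge f_{\alpha^i}(w_{\mathrm{init}})-\min_{w\in S\cap\overline{B}_\beta}f_{\alpha^i}(w)$ for the starting point $w_{\mathrm{init}}\in S\cap\overline{B}_\beta$ of the run. Assume that, for $i=1,2,\dots$, SPA is run with $\alpha=\alpha^i$, $K=K^i$, $M=M^i$ and $\eta=\frac{\alpha^i}{3\rho\sqrt dL_0}$, giving solutions $\{w^i\}$. If $\beta$ is finite, there exists an accumulation point $\overline w$ of $\{w^i\}$ and it is a C-M stationary point almost surely. Otherwise, any accumulation point $\overline w$ of $\{w^i\}$ is a C-M stationary point almost surely.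
   Context: Notation: $\overline{B}_r:=\{z\in\mathbb{R}^d:|z_i|\le r,\ i=1,\dots,d\}$. Setting: $\beta>0$ and $\kappa>\beta$; for each smoothing parameter $\alpha>0$ used, $\kappa>\beta+\frac{\alpha}{2}$. $\xi$ is a random vector in $\mathbb{R}^p$ with law $P_\xi$. $F:\overline{B}_\kappa\times\mathbb{R}^p\to\mathbb{R}$ is Borel measurable, $F(w,\xi)$ is integrable for each $w$, and $F(\cdot,\xi)$ is continuous on $\overline{B}_\kappa$ for each $\xi\in\mathbb{R}^p$. There is a measurable function $L_0(\cdot)$ on $\mathbb{R}^p$ with $|F(w,\xi)-F(w',\xi)|\le L_0(\xi)\|w-w'\|_2$ for all $w,w'\in\overline{B}_\kappa$ and all $\xi$ outside a $P_\xi$-null Borel set. Set $Q:=\mathbb{E}[L_0(\xi)^2]<\infty$, $L_0:=\mathbb{E}[L_0(\xi)]$ with $L_0>0$, and $f(w):=\mathbb{E}[F(w,\xi)]$. The random vector $u$ is uniform on $\overline{B}_{\alpha/2}$ with law $P_u$, independent of $\xi$, and $f_\alpha(w):=\mathbb{E}[f(w+u)]$. (If the Lipschitz condition holds for all $w,w'\in\mathbb{R}^d$, the case $\beta=\infty$, i.e. $\overline{B}_\beta=\overline{B}_\kappa=\mathbb{R}^d$, is allowed.) C-M (Clarke-Mordukhovich) stationary point: a point $\overline w$ with $0\in\overline{\partial}f(\overline w)+N(\overline w,S\cap\overline{B}_\beta)$, where $\overline{\partial}f$ is the Clarke subdifferential and $N$ the Mordukhovich normal cone: for $w\in A$, $\widehat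 N(w,A):=\{y:\limsup_{x\to w,\,x\in A}\frac{\langle y,x-w\rangle}{\|x-w\|_2}\le0\}$, and $N(w,A)$ is the set of limits $y$ of sequences $y_k\in\widehat N(x_k,A)$ with $x_k\in A$, $x_k\to w$. Gradient estimators: $\widetilde{\nabla}F:\overline{B}_{\beta+\alpha/2}\times\mathbb{R}^p\to\mathbb{R}^d$ is a Borel measurable function such that for every $w\in\overline{B}_\beta$, $\widetilde{\nabla}F(w+u,\xi)=\nabla F(w+u,\xi)$ (gradient in the first argument) for $P_u\times P_\xi$-almost every $(u,\xi)$. The finite difference $dF(w,u,\xi)\in\mathbb{R}^d$ has $i$-th component $dF_i:=F(w_1+u_1,\dots,w_{i-1}+u_{i-1},w_i+\frac\alpha2,w_{i+1}+u_{i+1},\dots,w_d+u_d,\xi)-F(w_1+u_1,\dots,w_{i-1}+u_{i-1},w_i-\frac\alpha2,w_{i+1}+u_{i+1},\dots,w_d+u_d,\xi)$. Algorithm SPA (with smoothing parameter $\alpha$): inputs a starting point $w^1\in S\cap\overline{B}_\beta$, $\eta>0$, $K,M\in\mathbb{Z}_{>0}$. Draw $R$ uniformly from $\{2,\dots,K+1\}$ (independently of everything else). For $k=1,\dots,R-1$: draw independent samples $u^{k,i}\sim P_u$, $\xi^{k,i}\sim P_\xi$, $i=1,\dots,M$, and set either (1) $w^{k+1}\in\Pi_{S\cap\overline{B}_\beta}\big(w^k-\frac{\eta}{M\alpha}\sum_{i=1}^M dF(w^k,u^{k,i},\xi^{k,i})\big)$, or (2) $w^{k+1}\in\Pi_{S\cap\overline{B}_\beta}\big(w^k-\frac{\eta}{M}\sum_{i=1}^M\widetilde{\nabla}F(w^k+u^{k,i},\xi^{k,i})\big)$,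 the same option being used throughout. Output $w^R$. Here $\Pi_A(x)$ is the (set-valued) Euclidean projection onto a closed set $A$; a Borel measurable selection of it is used.
   Formalization: For β=∞ "any accumulation point" means an a.s. limit along a subsequence not depending on the random outcome (and each subsequence has a further one whose pathwise accumulation points are all a.s. C-M stationary); the fully pathwise claim is false, e.g. F=|w|, w_init=1, ε_3=ε_4=i^(-1/4). *)

theory Defs
  imports "HOL-Probability.Probability"
begin

text \<open>The radius is extended real so that \<open>cube \<infinity>\<close> is the whole space.\<close>

definition cube :: "ereal \<Rightarrow> (real ^ 'd::finite) set" where
  "cube r = {z. \<forall>i. ereal \<bar>z $ i\<bar> \<le> r}"

definition frechet_normals :: "'v::real_inner \<Rightarrow> 'v set \<Rightarrow> 'v set" where
  "frechet_normals w A =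
     {y. Limsup (at w within A) (\<lambda>x. ereal ((y \<bullet> (x - w)) / norm (x - w))) \<le> 0}"

definition mordukhovich_normal_cone :: "'v::real_inner \<Rightarrow> 'v set \<Rightarrow> 'v set" where
  "mordukhovich_normal_cone w A =
     {y. \<exists>xs ys. (\<forall>k. xs k \<in> A \<and> ys k \<in> frechet_normals (xs k) A) \<and>
                 xs \<longlonglongrightarrow> w \<and> ys \<longlonglongrightarrow> y}"

definition clarke_derivative :: "('v::real_inner \<Rightarrow> real) \<Rightarrow> 'v \<Rightarrow> 'v \<Rightarrow> ereal" where
  "clarke_derivative f w v =
     Limsup (nhds w \<times>\<^sub>F at_right 0) (\<lambda>(y, t). ereal ((f (y + t *\<^sub>R v) - f y) / t))"

definition clarke_subdifferential :: "('v::real_inner \<Rightarrow> real) \<Rightarrow> 'v \<Rightarrow> 'v set" where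
  "clarke_subdifferential f w = {g. \<forall>v. ereal (g \<bullet> v) \<le> clarke_derivative f w v}"

definition cm_stationary :: "('v::real_inner \<Rightarrow> real) \<Rightarrow> 'v set \<Rightarrow> 'v \<Rightarrow> bool" where
  "cm_stationary f A w \<longleftrightarrow>
     w \<in> A \<and> (\<exists>g\<in>clarke_subdifferential f w. \<exists>y\<in>mordukhovich_normal_cone w A. g + y = 0)"

definition accumulation_point :: "(nat \<Rightarrow> 'v::topological_space) \<Rightarrow> 'v \<Rightarrow> bool" where
  "accumulation_point X l \<longleftrightarrow> (\<exists>r. strict_mono r \<and> (X \<circ> r) \<longlonglongrightarrow> l)"

definition proj_set :: "'v::metric_space set \<Rightarrow> 'v \<Rightarrow> 'v set" where
  "proj_set A x = {a \<in> A. \<forall>b\<in>A. dist x a \<le> dist x b}"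

definition smoothing_law :: "real \<Rightarrow> (real ^ 'd::finite) measure" where
  "smoothing_law \<alpha> = uniform_measure lborel (cube (ereal (\<alpha> / 2)))"

definition expected_loss ::
    "'x measure \<Rightarrow> ('v \<Rightarrow> 'x \<Rightarrow> real) \<Rightarrow> 'v \<Rightarrow> real" where
  "expected_loss P F w = (\<integral>x. F w x \<partial>P)"

definition smoothed :: "real \<Rightarrow> (real ^ 'd::finite \<Rightarrow> real) \<Rightarrow> real ^ 'd \<Rightarrow> real" where
  "smoothed \<alpha> f w = (\<integral>u. f (w + u) \<partial>smoothing_law \<alpha>)"

definition finite_diff ::
    "real \<Rightarrow> (real ^ 'd::finite \<Rightarrow> 'x \<Rightarrow> real) \<Rightarrow> real ^ 'd \<Rightarrow> real ^ 'd \<Rightarrow> 'x \<Rightarrow> real ^ 'd" where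
  "finite_diff \<alpha> F w u x =
     (\<chi> i. F (\<chi> j. if j = i then w $ i + \<alpha> / 2 else w $ j + u $ j) x -
           F (\<chi> j. if j = i then w $ i - \<alpha> / 2 else w $ j + u $ j) x)"

definition gradient_estimator ::
    "ereal \<Rightarrow> real \<Rightarrow> (real ^ 'p::finite) measure \<Rightarrow> (real ^ 'd::finite \<Rightarrow> real ^ 'p \<Rightarrow> real) \<Rightarrow>
     (real ^ 'd \<Rightarrow> real ^ 'p \<Rightarrow> real ^ 'd) \<Rightarrow> bool" where
  "gradient_estimator \<beta> \<alpha> P F G \<longleftrightarrow>
     (\<lambda>(w, x). G w x) \<in>
       borel_measurable (restrict_space borel (cube (\<beta> + ereal (\<alpha> / 2)) \<times> UNIV)) \<and>
     (\<forall>w\<in>cube \<beta>. AE (u, x) in smoothing_law \<alpha> \<Otimes>\<^sub>M P.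
        GDERIV (\<lambda>v. F v x) (w + u) :> G (w + u) x)"

datatype spa_update = Finite_Difference | Gradient_Estimate

fun spa_direction ::
    "spa_update \<Rightarrow> real \<Rightarrow> (real ^ 'd::finite \<Rightarrow> 'x \<Rightarrow> real) \<Rightarrow> (real ^ 'd \<Rightarrow> 'x \<Rightarrow> real ^ 'd) \<Rightarrow>
     real ^ 'd \<Rightarrow> real ^ 'd \<Rightarrow> 'x \<Rightarrow> real ^ 'd" where
  "spa_direction Finite_Difference \<alpha> F G w u x = (1 / \<alpha>) *\<^sub>R finite_diff \<alpha> F w u x"
| "spa_direction Gradient_Estimate \<alpha> F G w u x = G (w + u) x"

text \<open>
  Iterate \<open>k \<ge> 1\<close> of the projected algorithm with starting point \<open>w1\<close> as iterate \<open>1\<close>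
  (index \<open>0\<close> is a dummy), direction \<open>g\<close>, step size \<open>\<eta>\<close>, batch size \<open>B\<close>, projection
  selection \<open>\<pi> k\<close> and samples \<open>z k m\<close> (pairs of perturbation and data) in iteration \<open>k\<close>.
\<close>

primrec spa_iterate ::
    "('v::real_vector \<Rightarrow> 'v \<Rightarrow> 'x \<Rightarrow> 'v) \<Rightarrow> real \<Rightarrow> nat \<Rightarrow> (nat \<Rightarrow> 'v \<Rightarrow> 'v) \<Rightarrow> 'v \<Rightarrow>
     (nat \<Rightarrow> nat \<Rightarrow> 'v \<times> 'x) \<Rightarrow> nat \<Rightarrow> 'v" where
  "spa_iterate g \<eta> B \<pi> w1 z 0 = w1"
| "spa_iterate g \<eta> B \<pi> w1 z (Suc k) =
     (if k = 0 then w1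
      else (let w = spa_iterate g \<eta> B \<pi> w1 z k
            in \<pi> k (w - (\<eta> / real B) *\<^sub>R (\<Sum>m=1..B. g w (fst (z k m)) (snd (z k m))))))"

text \<open>
  The joint law of the output index and of all samples is the product law: the index is
  uniform on \<open>{2..K+1}\<close>, each sample has law \<open>Pu \<Otimes>\<^sub>M P\<close>, and everything is independent.
  Drawing the samples for all \<open>k \<le> K\<close> instead of \<open>k < R\<close> does not affect iterate \<open>R\<close>.
\<close>

definition spa_sampling ::
    "'o measure \<Rightarrow> 'v measure \<Rightarrow> 'x measure \<Rightarrow> nat \<Rightarrow> nat \<Rightarrow> ('o \<Rightarrow> nat) \<Rightarrow>
     ('o \<Rightarrow> nat \<Rightarrow> nat \<Rightarrow> 'v \<times> 'x) \<Rightarrow> bool" where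
  "spa_sampling \<Omega> Pu P K B R Z \<longleftrightarrow>
     (let N = measure_pmf (pmf_of_set {2..K+1}) \<Otimes>\<^sub>M
              PiM ({1..K} \<times> {1..B}) (\<lambda>_. Pu \<Otimes>\<^sub>M P);
          T = (\<lambda>\<omega>. (R \<omega>, \<lambda>(k, m)\<in>{1..K} \<times> {1..B}. Z \<omega> k m))
      in T \<in> measurable \<Omega> N \<and> distr \<Omega> N T = N)"

end

theory Submission
  imports Defs
begin

text \<open>
  The objective smoothed over the cube is differentiable: shifting along one coordinate only moves two
  opposite faces of the cube, so the partial derivatives are averaged central differences, and these are
  Lipschitz with constant proportional to \<open>1 / \<alpha>\<close>. Both updates are unbiased estimators of this gradient with second
  moment at most \<open>\<upsilon> Q\<close>. A projected step yields a proximal normal at the new iterate, so the gradient there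
  plus a Frechet normal equals a residual controlled by the step length and the sampling error;
  the descent inequality for smooth functions bounds the mean squared residual of the output by a constant
  times \<open>\<epsilon>4\<^sup>2\<close>. Along a subsequence the residuals vanish almost surely, and limits of smoothed gradients for \<open>\<alpha>\<close>
  tending to 0 are Clarke subgradients because difference quotients of the smoothed function are averages of
  difference quotients of \<open>f\<close>. The loss may be taken to be
  defined on the whole space, since composing it with the nearest-point map onto the cube keeps its Lipschitz constant.
\<close>

text \<open>The gradient of the smoothed function has Lipschitz constant L = 2 sqrt d L0 / \<alpha>,
  and the step size of the theorem is the one with 1 / \<eta> = (3 \<rho> / 2) L. A projection onto
  a nonconvex set yields only half of the descent that a convex set would give, and \<rho> > 1 is
  what lets this half still beat curvature and noise. L grows like 1 / \<alpha>, which the factor 1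
  / \<open>\<epsilon>3 i\<close> in \<open>K i\<close> absorbs, while the second moment of the
  directions does not depend on \<alpha>. What remains is of order
  \<open>(\<epsilon>4 i)\<^sup>2\<close>. The sequence \<epsilon>4 may tend to 0 so slowly that
  these bounds are not summable. Borel-Cantelli is then out of reach, and almost sure convergence of
  the residuals is obtained only along subsequences chosen before the outcome. For finite \<beta>
  compactness supplies an accumulation point inside such a subsequence; for infinite \<beta> this
  decides in which order subsequence and outcome are quantified in the conclusion. The normal lives
  at the new iterate, so the gradient must be taken there too, and its change over one step is part
  of the residual.\<close>

section \<open>Projected gradient steps\<close>

text \<open>Proximal normals satisfy such a linear bound on the quotient that defines Frechet
  normals. If \<open>w\<close> is isolated in \<open>A\<close>, the filter is trivial and so is the
  claim.\<close>

lemma Limsup_within_le_0I: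
  fixes g :: "'v::real_normed_vector \<Rightarrow> real"
  assumes "\<And>x. x \<in> A \<Longrightarrow> g x \<le> c * norm (x - w)"
  shows "Limsup (at w within A) (\<lambda>x. ereal (g x)) \<le> 0"
  unfolding Limsup_le_iff
proof (intro allI impI)
  fix y :: ereal assume "0 < y"
  then obtain e where e: "0 < e" "ereal e < y"
    using ereal_dense2[of 0 y] by auto
  have "((\<lambda>x. c * norm (x - w)) \<longlongrightarrow> c * norm (w - w)) (at w within A)"
    by (intro tendsto_intros)
  then have "eventually (\<lambda>x. c * norm (x - w) < e) (at w within A)"
    using e by (auto dest!: order_tendstoD(2)[of _ _ _ e])
  moreover have eventually_in_A: "eventually (\<lambda>x. x \<in> A) (at w within A)"
    by (simp add: eventually_at_topological) blast
  ultimately show "eventually (\<lambda>x. ereal (g x) < y) (at w within A)"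
  proof (eventually_elim)
    case (elim x)
    then have "ereal (g x) < ereal e" using assms[of x] by simp
    from less_trans[OF this e(2)] show ?case .
  qed
qed

text \<open>Squaring \<open>norm (p - w) \<le> norm (p - x)\<close> gives the proximal inequality
  \<open>(p - w) \<bullet> (x - w) \<le> norm (x - w) ^ 2 / 2\<close>, whose right side is of second
  order. The argument covers nonconvex \<open>A\<close>.\<close>

lemma proj_set_frechet_normal:
  assumes w: "w \<in> proj_set A p" and c: "0 \<le> c"
  shows "c *\<^sub>R (p - w) \<in> frechet_normals w A"
proof -
  have "((c *\<^sub>R (p - w)) \<bullet> (x - w)) / norm (x - w) \<le> c / 2 * norm (x - w)" if "x \<in> A" for x
  proof (cases "x = w")
    case False
    have "norm (p - w) \<le> norm (p - x)"
      using w that by (auto simp: proj_set_def dist_norm)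
    then have "(p - w) \<bullet> (p - w) \<le> (p - x) \<bullet> (p - x)"
      by (simp add: norm_le)
    then have "(p - w) \<bullet> (x - w) \<le> norm (x - w) ^ 2 / 2"
      by (simp add: power2_norm_eq_inner algebra_simps inner_commute)
    from this c have "c * ((p - w) \<bullet> (x - w)) \<le> c * (norm (x - w) ^ 2 / 2)"
      by (rule mult_left_mono)
    with False show ?thesis
      unfolding inner_scaleR_left by (simp add: divide_simps power2_eq_square del: scaleR_diff_right)
  qed simp
  then show ?thesis
    unfolding frechet_normals_def mem_Collect_eq by (rule Limsup_within_le_0I)
qed

text \<open>The descent lemma. Along the segment from \<open>x\<close> to \<open>y\<close> the
  function minus its quadratic model has nonpositive derivative, so no integral of the gradient is
  needed.\<close>

lemma Lipschitz_gradient_upper_bound: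
  fixes \<phi> :: "'v::real_inner \<Rightarrow> real"
  assumes D: "\<And>w. GDERIV \<phi> w :> \<Phi> w"
    and L: "\<And>w w'. norm (\<Phi> w - \<Phi> w') \<le> L * norm (w - w')"
  shows "\<phi> y \<le> \<phi> x + \<Phi> x \<bullet> (y - x) + L / 2 * (norm (y - x))\<^sup>2"
proof -
  define d where "d = y - x"
  define \<psi> where "\<psi> t = \<phi> (x + t *\<^sub>R d) - t * (\<Phi> x \<bullet> d) - L / 2 * t\<^sup>2 * (norm d)\<^sup>2" for t
  have der: "(\<psi> has_real_derivative (\<Phi> (x + t *\<^sub>R d) - \<Phi> x) \<bullet> d - L * t * (norm d)\<^sup>2) (at t)" for t
  proof -
    have "((\<lambda>t. \<phi> (x + t *\<^sub>R d)) has_derivative (\<lambda>h. (h *\<^sub>R d) \<bullet> \<Phi> (x + t *\<^sub>R d))) (at t)"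
      by (rule has_derivative_compose[where f = "\<lambda>t. x + t *\<^sub>R d" and g = \<phi>, simplified])
         (auto intro!: derivative_eq_intros D[unfolded gderiv_def])
    then have "((\<lambda>t. \<phi> (x + t *\<^sub>R d)) has_real_derivative d \<bullet> \<Phi> (x + t *\<^sub>R d)) (at t)"
      by (simp add: has_field_derivative_def mult_commute_abs)
    then show ?thesis
      unfolding \<psi>_def by (auto intro!: derivative_eq_intros simp: inner_diff_left inner_diff_right inner_commute)
  qed
  have "\<psi> 1 \<le> \<psi> 0"
  proof (rule DERIV_nonpos_imp_nonincreasing[where f = \<psi>])
    fix t :: real assume t: "0 \<le> t" "t \<le> 1"
    have "(\<Phi> (x + t *\<^sub>R d) - \<Phi> x) \<bullet> d \<le> norm (\<Phi> (x + t *\<^sub>R d) - \<Phi> x) * norm d"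
      by (rule norm_cauchy_schwarz)
    also have "\<dots> \<le> (L * norm ((x + t *\<^sub>R d) - x)) * norm d"
      by (intro mult_right_mono L) auto
    also have "\<dots> = L * t * (norm d)\<^sup>2"
      using t by (simp add: power2_eq_square)
    finally show "\<exists>y. (\<psi> has_real_derivative y) (at t) \<and> y \<le> 0"
      using der[of t] by fastforce
  qed simp
  then show ?thesis by (simp add: \<psi>_def d_def)
qed

text \<open>The product of \<open>2 (1 + 3 \<rho> / 2)\<^sup>2\<close> (residual against step length) and \<open>4 / (3 (\<rho> - 1))\<close> (step length against descent).\<close>

definition descent_const :: "real \<Rightarrow> real" where
  "descent_const \<rho> = 2 * (2 + 3 * \<rho>)\<^sup>2 / (3 * (\<rho> - 1))"

lemma descent_const_nonneg: "1 < \<rho> \<Longrightarrow> 0 \<le> descent_const \<rho>"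
  by (simp add: descent_const_def)

text \<open>The point \<open>w\<close> itself competes in the projection, so
  \<open>g \<bullet> (w' - w)\<close> is at most
  \<open>- (norm (w' - w))\<^sup>2 / (2 * \<eta>)\<close>. The resulting coefficient 3 \<rho> L / 4
  has to pay L / 2 for curvature and L / 4 for noise. The remainder 3 (\<rho> - 1) L / 4 controls
  the step length, and the residual is linear in step length and noise.\<close>

lemma projected_step_residual_bound:
  fixes \<phi> :: "'v::real_inner \<Rightarrow> real"
  assumes D: "\<And>w. GDERIV \<phi> w :> \<Phi> w"
    and L: "\<And>w w'. norm (\<Phi> w - \<Phi> w') \<le> L * norm (w - w')" "0 < L"
    and \<rho>: "1 < \<rho>" and \<eta>: "1 / \<eta> = 3 * \<rho> / 2 * L"
    and A: "w \<in> A" and w': "w' \<in> proj_set A (w - \<eta> *\<^sub>R g)"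
  shows "(norm (\<Phi> w' - g - (1 / \<eta>) *\<^sub>R (w' - w)))\<^sup>2 \<le>
    descent_const \<rho> * (L * (\<phi> w - \<phi> w') + (norm (g - \<Phi> w))\<^sup>2) + 2 * (norm (g - \<Phi> w))\<^sup>2"
proof -
  define a where "a = norm (w' - w)"
  define e where "e = norm (g - \<Phi> w)"
  have \<eta>0: "0 < \<eta>" using \<eta> \<rho> L by (metis mult_pos_pos divide_pos_pos zero_less_divide_1_iff less_trans zero_less_one zero_less_numeral)
  have "norm (w - \<eta> *\<^sub>R g - w') \<le> norm (w - \<eta> *\<^sub>R g - w)"
    using A w' by (auto simp: proj_set_def dist_norm)
  then have "(w - \<eta> *\<^sub>R g - w') \<bullet> (w - \<eta> *\<^sub>R g - w') \<le> (w - \<eta> *\<^sub>R g - w) \<bullet> (w - \<eta> *\<^sub>R g - w)"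
    by (simp only: norm_le)
  then have "2 * \<eta> * (g \<bullet> (w' - w)) + a\<^sup>2 \<le> 0"
    by (simp add: a_def power2_norm_eq_inner algebra_simps inner_commute)
  then have "g \<bullet> (w' - w) \<le> - (1 / \<eta>) * a\<^sup>2 / 2"
    using \<eta>0 by (simp add: field_simps)
  then have 1: "g \<bullet> (w' - w) \<le> - (3 * \<rho> / 4) * L * a\<^sup>2"
    unfolding \<eta> by simp
  have 2: "\<phi> w' \<le> \<phi> w + \<Phi> w \<bullet> (w' - w) + L / 2 * a\<^sup>2"
    unfolding a_def by (rule Lipschitz_gradient_upper_bound[OF D L(1)])
  have "(\<Phi> w - g) \<bullet> (w' - w) \<le> e * a"
    unfolding e_def a_def by (metis norm_cauchy_schwarz norm_minus_commute)
  \<comment> \<open>Young's inequality, weighted so that the squared step length is charged only L /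
    4.\<close>
  also have "\<dots> \<le> e\<^sup>2 / L + L * a\<^sup>2 / 4"
  proof -
    have "0 \<le> (e - L * a / 2)\<^sup>2 / L" using L(2) by simp
    then show ?thesis using L(2) by (simp add: field_simps power2_eq_square)
  qed
  finally have 3: "\<Phi> w \<bullet> (w' - w) \<le> g \<bullet> (w' - w) + e\<^sup>2 / L + L * a\<^sup>2 / 4"
    by (simp add: inner_diff_left)
  have "3 / 4 * (\<rho> - 1) * L * a\<^sup>2 \<le> \<phi> w - \<phi> w' + e\<^sup>2 / L"
  proof -
    have "3 / 4 * (\<rho> - 1) * L * a\<^sup>2 = 3 * \<rho> / 4 * L * a\<^sup>2 - L / 2 * a\<^sup>2 - L * a\<^sup>2 / 4"
      by algebra
    then show ?thesis using 1 2 3 by linarith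
  qed
  then have "L * (3 / 4 * (\<rho> - 1) * L * a\<^sup>2) \<le> L * (\<phi> w - \<phi> w' + e\<^sup>2 / L)"
    using L(2) by (intro mult_left_mono) auto
  then have "3 / 4 * (\<rho> - 1) * (L * a)\<^sup>2 \<le> L * (\<phi> w - \<phi> w') + e\<^sup>2"
    using L(2) by (simp add: power2_eq_square algebra_simps)
  then have 4: "(L * a)\<^sup>2 \<le> 4 / (3 * (\<rho> - 1)) * (L * (\<phi> w - \<phi> w') + e\<^sup>2)"
    using \<rho> by (simp add: field_simps)
  \<comment> \<open>Three sources: the change of the gradient over the step, the noise, and the step
    divided by \<eta>. The first and the last add up to the factor 1 + 3 \<rho> / 2.\<close>
  have "norm (\<Phi> w' - g - (1 / \<eta>) *\<^sub>R (w' - w)) =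
      norm ((\<Phi> w' - \<Phi> w) - (g - \<Phi> w) - (1 / \<eta>) *\<^sub>R (w' - w))" by simp
  also have "\<dots> \<le> norm (\<Phi> w' - \<Phi> w) + norm (g - \<Phi> w) + norm ((1 / \<eta>) *\<^sub>R (w' - w))"
    by (meson norm_triangle_ineq4 order_trans add_mono order_refl)
  also have "\<dots> \<le> L * a + e + (3 * \<rho> / 2 * L) * a"
  proof -
    have "norm ((1 / \<eta>) *\<^sub>R (w' - w)) = (3 * \<rho> / 2 * L) * a"
      unfolding norm_scaleR a_def \<eta> using \<rho> L(2) by simp
    then show ?thesis using L(1)[of w' w] unfolding a_def e_def by linarith
  qed
  also have "\<dots> = (1 + 3 * \<rho> / 2) * (L * a) + e"
    by (simp add: algebra_simps)
  finally have "(norm (\<Phi> w' - g - (1 / \<eta>) *\<^sub>R (w' - w)))\<^sup>2 \<le> ((1 + 3 * \<rho> / 2) * (L * a) + e)\<^sup>2"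
    by (intro power_mono) auto
  also have "\<dots> \<le> 2 * ((1 + 3 * \<rho> / 2) * (L * a))\<^sup>2 + 2 * e\<^sup>2"
    using sum_squares_bound[of "(1 + 3 * \<rho> / 2) * (L * a)" e] by (simp only: power2_sum)
  also have "2 * ((1 + 3 * \<rho> / 2) * (L * a))\<^sup>2 = 2 * (1 + 3 * \<rho> / 2)\<^sup>2 * (L * a)\<^sup>2"
    by (simp add: power_mult_distrib)
  also have "\<dots> \<le> 2 * (1 + 3 * \<rho> / 2)\<^sup>2 * (4 / (3 * (\<rho> - 1)) * (L * (\<phi> w - \<phi> w') + e\<^sup>2))"
    using 4 by (intro mult_left_mono) auto
  also have "2 * (1 + 3 * \<rho> / 2)\<^sup>2 * (4 / (3 * (\<rho> - 1)) * (L * (\<phi> w - \<phi> w') + e\<^sup>2)) =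
      descent_const \<rho> * (L * (\<phi> w - \<phi> w') + e\<^sup>2)"
  proof -
    have "2 * (1 + 3 * \<rho> / 2)\<^sup>2 * (4 / (3 * (\<rho> - 1))) = descent_const \<rho>"
      using \<rho> unfolding descent_const_def by (simp add: field_simps power2_eq_square)
    then show ?thesis by (metis mult.assoc)
  qed
  finally show ?thesis by (simp add: e_def)
qed

lemma projected_steps_residual_sum:
  fixes \<phi> :: "'v::real_inner \<Rightarrow> real" and w g :: "nat \<Rightarrow> 'v"
  assumes D: "\<And>w. GDERIV \<phi> w :> \<Phi> w"
    and L: "\<And>w w'. norm (\<Phi> w - \<Phi> w') \<le> L * norm (w - w')" "0 < L"
    and \<rho>: "1 < \<rho>" and \<eta>: "1 / \<eta> = 3 * \<rho> / 2 * L"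
    and A: "\<And>k. w k \<in> A"
    and proj: "\<And>k. k \<in> {1..K} \<Longrightarrow> w (Suc k) \<in> proj_set A (w k - \<eta> *\<^sub>R g k)"
    and \<Delta>: "\<phi> (w 1) - \<phi> (w (Suc K)) \<le> \<Delta>"
  shows "(\<Sum>k=1..K. (norm (\<Phi> (w (Suc k)) - g k - (1 / \<eta>) *\<^sub>R (w (Suc k) - w k)))\<^sup>2) \<le>
    descent_const \<rho> * L * \<Delta> + (descent_const \<rho> + 2) * (\<Sum>k=1..K. (norm (g k - \<Phi> (w k)))\<^sup>2)"
proof -
  have "(\<Sum>k=1..K. (norm (\<Phi> (w (Suc k)) - g k - (1 / \<eta>) *\<^sub>R (w (Suc k) - w k)))\<^sup>2) \<le>
    (\<Sum>k=1..K. descent_const \<rho> * (L * (\<phi> (w k) - \<phi> (w (Suc k))) + (norm (g k - \<Phi> (w k)))\<^sup>2)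
       + 2 * (norm (g k - \<Phi> (w k)))\<^sup>2)"
    by (intro sum_mono projected_step_residual_bound[OF D L \<rho> \<eta> A] proj)
  also have "\<dots> = descent_const \<rho> * L * (\<Sum>k=1..K. \<phi> (w k) - \<phi> (w (Suc k))) +
      (descent_const \<rho> + 2) * (\<Sum>k=1..K. (norm (g k - \<Phi> (w k)))\<^sup>2)"
    by (simp add: sum.distrib sum_subtractf sum_distrib_left algebra_simps)
  also have "(\<Sum>k=1..K. \<phi> (w k) - \<phi> (w (Suc k))) = \<phi> (w 1) - \<phi> (w (Suc K))"
    by (induction K) auto
  also have "descent_const \<rho> * L * (\<phi> (w 1) - \<phi> (w (Suc K))) \<le> descent_const \<rho> * L * \<Delta>"
    using \<Delta> L(2) descent_const_nonneg[OF \<rho>] by (intro mult_left_mono) auto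
  finally show ?thesis by simp
qed

section \<open>The smoothing law\<close>

lemma borel_measurable_vecI:
  fixes f :: "'a \<Rightarrow> real ^ 'd::finite"
  assumes "\<And>i. (\<lambda>x. f x $ i) \<in> borel_measurable M"
  shows "f \<in> borel_measurable M"
  using assms by (subst borel_measurable_euclidean_space) (auto simp: Basis_vec_def inner_axis)

text \<open>Makes Fubini available one coordinate at a time, which is how the smoothing integral is
  split below. Lebesgue measure is recognised by its values on boxes.\<close>

lemma lborel_cart_eq_PiM:
  "(lborel :: (real ^ 'd::finite) measure) = distr (\<Pi>\<^sub>M i\<in>UNIV. lborel) borel (\<lambda>x. \<chi> i. x i)"
proof (rule lborel_eqI)
  interpret product_sigma_finite "\<lambda>_::'d. lborel :: real measure"
    by standard
  have [measurable]: "(\<lambda>x. \<chi> i. x i) \<in> measurable (\<Pi>\<^sub>M i\<in>(UNIV::'d set). lborel) (borel :: (real ^ 'd) measure)"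
    by (rule borel_measurable_vecI) simp
  fix l u :: "real ^ 'd" assume lu: "\<And>b. b \<in> Basis \<Longrightarrow> l \<bullet> b \<le> u \<bullet> b"
  have lu': "l $ i \<le> u $ i" for i
    using lu[of "axis i 1"] by (simp add: inner_axis axis_in_Basis_iff)
  have "(\<lambda>x. \<chi> i. x i) -` box l u \<inter> space (\<Pi>\<^sub>M i\<in>(UNIV::'d set). lborel) =
      Pi\<^sub>E UNIV (\<lambda>i. {l $ i <..< u $ i})"
    by (auto simp: mem_box_cart space_PiM PiE_iff)
  then have "emeasure (distr (\<Pi>\<^sub>M i\<in>UNIV. lborel) borel (\<lambda>x. \<chi> i. x i)) (box l u) =
      (\<Prod>i\<in>UNIV. ennreal (u $ i - l $ i))"
    by (simp add: emeasure_distr emeasure_PiM lu')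
  also have "\<dots> = ennreal (\<Prod>i\<in>UNIV. u $ i - l $ i)"
    by (simp add: prod_ennreal lu')
  also have "(\<Prod>i\<in>UNIV. u $ i - l $ i) = (\<Prod>b\<in>Basis. (u - l) \<bullet> b)"
    by (simp add: Basis_vec_def UNION_singleton_eq_range prod.reindex inj_on_def axis_eq_axis inner_axis)
  finally show "emeasure (distr (\<Pi>\<^sub>M i\<in>UNIV. lborel) borel (\<lambda>x. \<chi> i. x i)) (box l u) =
      ennreal (\<Prod>b\<in>Basis. (u - l) \<bullet> b)" .
qed simp

lemma cube_eq_cbox: "cube (ereal r) = cbox (\<chi> i. - r) (\<chi> i. r)"
  by (auto simp: cube_def mem_box_cart abs_le_iff minus_le_iff)

lemma emeasure_cube:
  assumes "0 \<le> r"
  shows "emeasure lborel (cube (ereal r) :: (real ^ 'd::finite) set) = ennreal ((2 * r) ^ CARD('d))"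
proof -
  have "emeasure lborel (cube (ereal r) :: (real ^ 'd) set) =
      (\<Prod>b\<in>Basis. ((\<chi> i. r) - (\<chi> i. - r) :: real ^ 'd) \<bullet> b)"
    unfolding cube_eq_cbox using assms
    by (subst emeasure_lborel_cbox) (auto simp: Basis_vec_def inner_axis)
  also have "\<dots> = (\<Prod>b\<in>(Basis :: (real ^ 'd) set). 2 * r)"
    by (intro prod.cong arg_cong[where f = ennreal]) (auto simp: Basis_vec_def inner_axis)
  finally show ?thesis by simp
qed

lemma cube_sets[measurable]: "cube (ereal r) \<in> sets borel"
  by (simp add: cube_eq_cbox)

lemma prob_space_smoothing_law:
  assumes "0 < \<alpha>"
  shows "prob_space (smoothing_law \<alpha> :: (real ^ 'd::finite) measure)"
  unfolding smoothing_law_def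
  using assms by (intro prob_space_uniform_measure) (auto simp: emeasure_cube)

lemma sets_smoothing_law[simp, measurable_cong]: "sets (smoothing_law \<alpha>) = sets borel"
  by (simp add: smoothing_law_def)

lemma space_smoothing_law[simp]: "space (smoothing_law \<alpha>) = UNIV"
  by (simp add: smoothing_law_def)

lemma AE_smoothing_law_cube: "AE u in smoothing_law \<alpha>. u \<in> cube (ereal (\<alpha> / 2))"
  unfolding smoothing_law_def by (intro AE_uniform_measureI) (auto)

lemma integrable_smoothing_law_continuous:
  fixes \<phi> :: "real ^ 'd::finite \<Rightarrow> 'b::{banach, second_countable_topology}"
  assumes "0 < \<alpha>" "continuous_on UNIV \<phi>"
  shows "integrable (smoothing_law \<alpha>) \<phi>"
proof -
  interpret prob_space "smoothing_law \<alpha> :: (real ^ 'd) measure"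
    by (rule prob_space_smoothing_law[OF assms(1)])
  have "compact (\<phi> ` cube (ereal (\<alpha> / 2)))"
    unfolding cube_eq_cbox using assms(2)
    by (intro compact_continuous_image) (auto intro: continuous_on_subset)
  then obtain C where C: "\<And>u. u \<in> cube (ereal (\<alpha> / 2)) \<Longrightarrow> norm (\<phi> u) \<le> C"
    by (meson bounded_iff compact_imp_bounded imageI)
  show ?thesis
  proof (rule integrable_const_bound)
    show "AE u in smoothing_law \<alpha>. norm (\<phi> u) \<le> C"
      using AE_smoothing_law_cube[of \<alpha>] by eventually_elim (rule C)
    show "\<phi> \<in> borel_measurable (smoothing_law \<alpha>)"
      using borel_measurable_continuous_onI[OF assms(2)] by simp
  qed
qed

text \<open>Fubini with coordinate \<open>i\<close> integrated first. It serves integrands that are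
  small only after averaging along one coordinate direction; \<alpha> is the length of a
  slice.\<close>

lemma integral_smoothing_law_slices_bound:
  fixes \<phi> :: "real ^ 'd::finite \<Rightarrow> real" and i :: 'd
  assumes \<alpha>: "0 < \<alpha>" and cont: "continuous_on UNIV \<phi>"
    and slice: "\<And>u. \<bar>\<integral>s. indicator {-\<alpha>/2..\<alpha>/2} s * \<phi> (\<chi> j. if j = i then s else u $ j) \<partial>lborel\<bar> \<le> \<alpha> * C"
  shows "\<bar>\<integral>u. \<phi> u \<partial>smoothing_law \<alpha>\<bar> \<le> C"
proof -
  define I where "I = {-\<alpha>/2..\<alpha>/2}"
  define g where "g u = indicator (cube (ereal (\<alpha> / 2))) u / \<alpha> ^ CARD('d) * \<phi> u" for u :: "real ^ 'd"
  define J where "J = - {i}"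
  have J: "finite J" "i \<notin> J" "insert i J = UNIV" by (auto simp: J_def)
  have cardJ: "CARD('d) = Suc (card J)" using J by (metis card_insert_disjoint)
  interpret lb: product_sigma_finite "\<lambda>_::'d. lborel :: real measure"
    by standard
  have m: "(\<lambda>x. \<chi> i. x i) \<in> measurable (\<Pi>\<^sub>M i\<in>(UNIV::'d set). lborel) (borel :: (real ^ 'd) measure)"
    by (rule borel_measurable_vecI) simp
  have "\<bar>\<integral>s. indicator {-\<alpha>/2..\<alpha>/2} s * \<phi> (\<chi> j. if j = i then s else 0 $ j) \<partial>lborel\<bar> \<le> \<alpha> * C"
    by (rule slice)
  then have C: "0 \<le> C" using \<alpha> by (smt (verit) mult_neg_pos mult.commute)
  have [measurable]: "\<phi> \<in> borel_measurable borel"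
    by (rule borel_measurable_continuous_onI[OF cont])
  have int_\<phi>: "integrable (smoothing_law \<alpha>) \<phi>"
    by (rule integrable_smoothing_law_continuous[OF \<alpha> cont])
  have eq: "smoothing_law \<alpha> = density lborel (\<lambda>u :: real ^ 'd. ennreal (indicator (cube (ereal (\<alpha> / 2))) u / \<alpha> ^ CARD('d)))"
    unfolding smoothing_law_def uniform_measure_def using \<alpha>
    by (intro arg_cong[where f = "density lborel"] ext)
       (auto simp: emeasure_cube indicator_def divide_ennreal[of 1, simplified])
  have g_int: "integrable lborel g"
    using int_\<phi> \<alpha> unfolding eq g_def by (subst (asm) integrable_density) auto
  have "(\<integral>u. \<phi> u \<partial>smoothing_law \<alpha>) = (\<integral>u. g u \<partial>lborel)"
    using \<alpha> unfolding eq g_def by (subst integral_density) auto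
  also have "\<dots> = (\<integral>x. g (\<chi> j. x j) \<partial>(\<Pi>\<^sub>M i\<in>UNIV. lborel))"
    by (subst lborel_cart_eq_PiM, subst integral_distr[OF m]) (use g_int in auto)
  also have "\<dots> = (\<integral>x. (\<integral>s. g (\<chi> j. (x(i := s)) j) \<partial>lborel) \<partial>(\<Pi>\<^sub>M i\<in>J. lborel))"
    unfolding J(3)[symmetric]
  proof (rule lb.product_integral_insert[OF J(1,2)])
    have "integrable (distr (\<Pi>\<^sub>M i\<in>UNIV. lborel) borel (\<lambda>x. \<chi> i. x i)) g"
      using g_int by (subst (asm) lborel_cart_eq_PiM)
    then show "integrable (\<Pi>\<^sub>M i\<in>insert i J. lborel) (\<lambda>x. g (\<chi> j. x j))"
      unfolding J(3) by (rule integrable_distr[OF m])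
  qed
  finally have *: "(\<integral>u. \<phi> u \<partial>smoothing_law \<alpha>) = \<dots>" .
  \<comment> \<open>On the cube of the remaining coordinates a slice contributes at most \<alpha> C
    times the density 1 / \<open>\<alpha> ^ CARD('d)\<close>. That cube has volume
    \<open>\<alpha> ^ card J\<close>, so \<open>b\<close> integrates to \<open>C\<close>.\<close>
  define b where "b x = C / \<alpha> ^ card J * indicator (Pi\<^sub>E J (\<lambda>_. I)) x" for x :: "'d \<Rightarrow> real"
  have b_nonneg: "0 \<le> b x" for x using C \<alpha> by (simp add: b_def)
  have PiE_sets: "Pi\<^sub>E J (\<lambda>_. I) \<in> sets (\<Pi>\<^sub>M i\<in>J. lborel)"
    by (intro sets_PiM_I_finite) (auto simp: J I_def)
  have PiE_emeasure: "emeasure (\<Pi>\<^sub>M i\<in>J. lborel) (Pi\<^sub>E J (\<lambda>_. I)) = ennreal (\<alpha> ^ card J)"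
    using \<alpha> by (subst lb.emeasure_PiM) (auto simp: J I_def ennreal_power)
  have b_int: "integrable (\<Pi>\<^sub>M i\<in>J. lborel) b"
    unfolding b_def using PiE_sets PiE_emeasure by (intro integrable_mult_right integrable_real_indicator) auto
  have b_val: "(\<integral>x. b x \<partial>(\<Pi>\<^sub>M i\<in>J. lborel)) = C"
    unfolding b_def using PiE_sets PiE_emeasure \<alpha> by (simp add: measure_def)
  have bound: "\<bar>\<integral>s. g (\<chi> j. (x(i := s)) j) \<partial>lborel\<bar> \<le> b x" if x: "x \<in> space (\<Pi>\<^sub>M i\<in>J. lborel)" for x
  proof -
    have xE: "x \<in> extensional J" using x by (simp add: space_PiM PiE_def)
    have "indicator (cube (ereal (\<alpha> / 2))) (\<chi> j. (x(i := s)) j) =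
        (indicator (Pi\<^sub>E J (\<lambda>_. I)) x * indicator I s :: real)" for s
    proof -
      have "(\<chi> j. (x(i := s)) j) \<in> cube (ereal (\<alpha> / 2)) \<longleftrightarrow> \<bar>s\<bar> \<le> \<alpha> / 2 \<and> (\<forall>j\<in>J. \<bar>x j\<bar> \<le> \<alpha> / 2)"
        by (auto simp: cube_def J_def)
      also have "\<dots> \<longleftrightarrow> s \<in> I \<and> x \<in> Pi\<^sub>E J (\<lambda>_. I)"
        using xE by (auto simp: I_def PiE_iff abs_le_iff minus_le_iff)
      finally show ?thesis by (auto simp: indicator_def)
    qed
    then have "(\<integral>s. g (\<chi> j. (x(i := s)) j) \<partial>lborel) =
      (\<integral>s. (indicator (Pi\<^sub>E J (\<lambda>_. I)) x / \<alpha> ^ CARD('d)) *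
         (indicator {-\<alpha>/2..\<alpha>/2} s * \<phi> (\<chi> j. if j = i then s else (\<chi> j. x j) $ j)) \<partial>lborel)"
      by (intro Bochner_Integration.integral_cong) (auto simp: g_def I_def fun_upd_def cong: if_cong)
    also have "\<dots> = (indicator (Pi\<^sub>E J (\<lambda>_. I)) x / \<alpha> ^ CARD('d)) *
       (\<integral>s. indicator {-\<alpha>/2..\<alpha>/2} s * \<phi> (\<chi> j. if j = i then s else (\<chi> j. x j) $ j) \<partial>lborel)"
      by simp
    also have "\<bar>\<dots>\<bar> \<le> (indicator (Pi\<^sub>E J (\<lambda>_. I)) x / \<alpha> ^ CARD('d)) * (\<alpha> * C)"
      unfolding abs_mult using \<alpha> by (intro mult_mono slice) auto
    also have "\<dots> = b x" using \<alpha> by (simp add: b_def cardJ field_simps)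
    finally show ?thesis .
  qed
  have "\<bar>\<integral>u. \<phi> u \<partial>smoothing_law \<alpha>\<bar> \<le> (\<integral>x. \<bar>\<integral>s. g (\<chi> j. (x(i := s)) j) \<partial>lborel\<bar> \<partial>(\<Pi>\<^sub>M i\<in>J. lborel))"
    unfolding * by (rule integral_abs_bound)
  also have "\<dots> \<le> (\<integral>x. b x \<partial>(\<Pi>\<^sub>M i\<in>J. lborel))"
    by (rule integral_mono'[OF b_int bound b_nonneg])
  finally show ?thesis by (simp add: b_val)
qed

section \<open>Smoothing of Lipschitz functions\<close>

lemma norm_axis_real: "norm (axis i t :: real ^ 'd::finite) = \<bar>t\<bar>"
proof -
  have "axis i t = t *\<^sub>R (axis i 1 :: real ^ 'd)"
    by (simp add: vec_eq_iff axis_def)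
  then show ?thesis by simp
qed

lemma norm_vec_le_componentwise:
  fixes x :: "real ^ 'd::finite"
  assumes "\<And>i. \<bar>x $ i\<bar> \<le> c"
  shows "norm x \<le> sqrt (real CARD('d)) * c"
proof -
  have c: "0 \<le> c" using assms[of undefined] by linarith
  have "norm x = sqrt (\<Sum>i\<in>UNIV. (x $ i)\<^sup>2)"
    by (simp add: norm_vec_def L2_set_def)
  also have "\<dots> \<le> sqrt (\<Sum>i\<in>(UNIV::'d set). c\<^sup>2)"
    using assms by (intro real_sqrt_le_mono sum_mono) (metis abs_ge_zero power2_abs power_mono)
  also have "\<dots> = sqrt (real CARD('d)) * c"
    using c by (simp add: real_sqrt_mult)
  finally show ?thesis .
qed

text \<open>The dummy data type \<open>unit\<close> lets the deterministic \<open>f\<close> share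
  the formula of update (1), whose mean is then this vector by Fubini alone. Coordinate
  \<open>i\<close> of \<open>u\<close> does not enter component \<open>i\<close>.\<close>

definition smoothed_gradient :: "real \<Rightarrow> (real ^ 'd::finite \<Rightarrow> real) \<Rightarrow> real ^ 'd \<Rightarrow> real ^ 'd" where
  "smoothed_gradient \<alpha> f w =
     (\<chi> i. (\<integral>u. finite_diff \<alpha> (\<lambda>v (_ :: unit). f v) w u () $ i \<partial>smoothing_law \<alpha>) / \<alpha>)"

text \<open>Mean value inequality for \<Psi> minus the linear function of slope
  \<open>\<psi> x\<close>, whose derivative between \<open>x\<close> and \<open>x + t\<close> is at
  most \<open>l * \<bar>t\<bar>\<close>.\<close>

lemma Lipschitz_antiderivative_bound:
  fixes \<psi> \<Psi> :: "real \<Rightarrow> real"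
  assumes lip: "\<And>s t. \<bar>\<psi> s - \<psi> t\<bar> \<le> l * \<bar>s - t\<bar>" and l: "0 \<le> l"
    and der: "\<And>s. (\<Psi> has_real_derivative \<psi> s) (at s)"
  shows "\<bar>\<Psi> (x + t) - \<Psi> x - t * \<psi> x\<bar> \<le> l * t\<^sup>2"
proof -
  define \<Theta> where "\<Theta> y = \<Psi> y - y * \<psi> x" for y
  have "norm (\<Theta> (x + t) - \<Theta> x) \<le> (l * \<bar>t\<bar>) * norm ((x + t) - x)"
  proof (rule field_differentiable_bound[where S = "closed_segment x (x + t)" and f' = "\<lambda>y. \<psi> y - \<psi> x"])
    fix z assume z: "z \<in> closed_segment x (x + t)"
    show "(\<Theta> has_real_derivative \<psi> z - \<psi> x) (at z within closed_segment x (x + t))"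
      unfolding \<Theta>_def by (auto intro!: derivative_eq_intros has_field_derivative_at_within[OF der])
    have "\<bar>z - x\<bar> \<le> \<bar>t\<bar>"
      using z by (auto simp: closed_segment_eq_real_ivl split: if_splits)
    then show "norm (\<psi> z - \<psi> x) \<le> l * \<bar>t\<bar>"
      using lip[of z x] l by (auto intro: order_trans mult_left_mono)
  qed auto
  then show ?thesis
    by (simp add: \<Theta>_def algebra_simps power2_eq_square abs_mult_self_eq mult.assoc)
qed

text \<open>Pointwise the integrand is only of first order in \<open>t\<close>. Integrating it with
  an antiderivative of \<psi> leaves two boundary terms, the first-order Taylor remainders of that
  antiderivative at \<open>c + \<alpha> / 2\<close> and \<open>c - \<alpha> / 2\<close>, and these
  are quadratic in \<open>t\<close>.\<close>

lemma Lipschitz_moving_average_bound: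
  fixes \<psi> :: "real \<Rightarrow> real"
  assumes lip: "\<And>s t. \<bar>\<psi> s - \<psi> t\<bar> \<le> l * \<bar>s - t\<bar>" and \<alpha>: "0 < \<alpha>"
  shows "\<bar>\<integral>s. indicator {-\<alpha>/2..\<alpha>/2} s *
      (\<psi> (c + t + s) - \<psi> (c + s) - t * ((\<psi> (c + \<alpha> / 2) - \<psi> (c - \<alpha> / 2)) / \<alpha>)) \<partial>lborel\<bar> \<le> 2 * l * t\<^sup>2"
proof -
  have l: "0 \<le> l" using lip[of 1 0] by simp
  have cont: "continuous_on UNIV \<psi>"
    by (intro lipschitz_on_continuous_on[where L = l] lipschitz_onI) (use lip l in \<open>auto simp: dist_real_def\<close>)
  then have isC: "isCont \<psi> x" for x by (simp add: continuous_on_eq_continuous_at)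
  obtain \<Psi> where \<Psi>: "\<And>x. (\<Psi> has_real_derivative \<psi> x) (at x)"
    using einterval_antiderivative[of "-\<infinity>" "\<infinity>" \<psi>] isC by (auto simp: has_real_derivative_iff_has_vector_derivative)
  define k where "k = (\<psi> (c + \<alpha> / 2) - \<psi> (c - \<alpha> / 2)) / \<alpha>"
  define \<Theta> where "\<Theta> s = \<Psi> (c + t + s) - \<Psi> (c + s) - t * k * s" for s
  have "(\<integral>s. (\<psi> (c + t + s) - \<psi> (c + s) - t * k) * indicator {-\<alpha>/2..\<alpha>/2} s \<partial>lborel) = \<Theta> (\<alpha>/2) - \<Theta> (-\<alpha>/2)"
  proof (rule integral_FTC_Icc_real)
    fix s
    show "(\<Theta> has_real_derivative \<psi> (c + t + s) - \<psi> (c + s) - t * k) (at s)"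
      unfolding \<Theta>_def
      by (auto intro!: derivative_eq_intros DERIV_chain2[OF \<Psi>])
    show "isCont (\<lambda>s. \<psi> (c + t + s) - \<psi> (c + s) - t * k) s"
      by (intro continuous_intros isCont_o2[OF _ isC])
  qed (use \<alpha> in simp)
  also have "\<dots> = (\<Psi> ((c + \<alpha>/2) + t) - \<Psi> (c + \<alpha>/2) - t * \<psi> (c + \<alpha>/2))
      - (\<Psi> ((c - \<alpha>/2) + t) - \<Psi> (c - \<alpha>/2) - t * \<psi> (c - \<alpha>/2))"
  proof -
    have "t * k * (\<alpha>/2) - t * k * (- \<alpha>/2) = t * \<psi> (c + \<alpha>/2) - t * \<psi> (c - \<alpha>/2)"
      using \<alpha> by (simp add: k_def field_simps)
    then show ?thesis by (simp add: \<Theta>_def algebra_simps)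
  qed
  also have "\<bar>\<dots>\<bar> \<le> l * t\<^sup>2 + l * t\<^sup>2"
    by (rule order_trans[OF abs_triangle_ineq4 add_mono])
       (rule Lipschitz_antiderivative_bound[OF lip l \<Psi>])+
  finally show ?thesis by (simp add: k_def mult.commute)
qed

lemma continuous_on_coord_update:
  fixes w :: "real ^ 'd::finite"
  shows "continuous_on A (\<lambda>u. \<chi> j. if j = i then c else w $ j + u $ j)"
  by (intro continuous_on_vec_lambda, case_tac "j = i") (auto intro!: continuous_intros)

context
  fixes f :: "real ^ 'd::finite \<Rightarrow> real" and \<alpha> l :: real
  assumes \<alpha>: "0 < \<alpha>" and lip: "\<And>w w'. \<bar>f w - f w'\<bar> \<le> l * norm (w - w')"
begin

lemma Lipschitz_const_nonneg: "0 \<le> l"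
  using lip[of "axis undefined 1" 0] by simp

lemma Lipschitz_continuous: "continuous_on UNIV f"
  by (intro lipschitz_on_continuous_on[where L = l] lipschitz_onI)
     (use lip Lipschitz_const_nonneg in \<open>auto simp: dist_real_def dist_norm\<close>)

lemma Lipschitz_continuous_compose: "continuous_on A g \<Longrightarrow> continuous_on A (\<lambda>u. f (g u))"
  using continuous_on_compose2[OF Lipschitz_continuous] by auto

lemma integrable_smoothing_finite_diff:
  "integrable (smoothing_law \<alpha>) (\<lambda>u. finite_diff \<alpha> (\<lambda>v (_ :: unit). f v) w u () $ i)"
  unfolding finite_diff_def
  by (intro integrable_smoothing_law_continuous \<alpha>) (auto intro!: Lipschitz_continuous_compose continuous_on_coord_update continuous_intros)

lemma integrable_smoothing_shift: "integrable (smoothing_law \<alpha>) (\<lambda>u. f (w + u))"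
  by (intro integrable_smoothing_law_continuous \<alpha>) (auto intro!: Lipschitz_continuous_compose continuous_intros)

lemma finite_diff_Lipschitz:
  "\<bar>finite_diff \<alpha> (\<lambda>v (_ :: unit). f v) w u () $ i\<bar> \<le> l * \<alpha>"
proof -
  define a where "a s = (\<chi> j. if j = i then w $ i + s else w $ j + u $ j)" for s
  have "a (\<alpha> / 2) - a (- (\<alpha> / 2)) = axis i \<alpha>"
    by (auto simp: a_def vec_eq_iff axis_def)
  then have "\<bar>f (a (\<alpha> / 2)) - f (a (- (\<alpha> / 2)))\<bar> \<le> l * \<alpha>"
    using lip[of "a (\<alpha> / 2)" "a (- (\<alpha> / 2))"] \<alpha> by (simp add: norm_axis_real)
  then show ?thesis by (simp add: finite_diff_def a_def cong: if_cong)
qed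

lemma smoothed_gradient_bound: "norm (smoothed_gradient \<alpha> f w) \<le> sqrt (real CARD('d)) * l"
proof (rule norm_vec_le_componentwise)
  fix i
  interpret prob_space "smoothing_law \<alpha> :: (real ^ 'd) measure" by (rule prob_space_smoothing_law[OF \<alpha>])
  have "\<bar>\<integral>u. finite_diff \<alpha> (\<lambda>v (_ :: unit). f v) w u () $ i \<partial>smoothing_law \<alpha>\<bar> \<le>
      (\<integral>u. \<bar>finite_diff \<alpha> (\<lambda>v (_ :: unit). f v) w u () $ i\<bar> \<partial>smoothing_law \<alpha>)"
    by (rule integral_abs_bound)
  also have "\<dots> \<le> (\<integral>u. l * \<alpha> \<partial>(smoothing_law \<alpha> :: (real ^ 'd) measure))"
    by (intro integral_mono integrable_abs integrable_smoothing_finite_diff finite_diff_Lipschitz) auto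
  finally show "\<bar>smoothed_gradient \<alpha> f w $ i\<bar> \<le> l"
    using \<alpha> by (simp add: smoothed_gradient_def field_simps prob_space[simplified])
qed

text \<open>Both evaluation points move rigidly with \<open>w\<close>, so each changes
  \<open>f\<close> by at most \<open>l * norm (w - w')\<close>. The division by \<alpha> is what
  makes the gradient steeper as the smoothing vanishes.\<close>

lemma smoothed_gradient_component_Lipschitz:
  "\<bar>smoothed_gradient \<alpha> f w $ i - smoothed_gradient \<alpha> f w' $ i\<bar> \<le> 2 * l / \<alpha> * norm (w - w')"
proof -
  interpret prob_space "smoothing_law \<alpha> :: (real ^ 'd) measure" by (rule prob_space_smoothing_law[OF \<alpha>])
  let ?D = "\<lambda>w u. finite_diff \<alpha> (\<lambda>v (_ :: unit). f v) w u () $ i"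
  have 1: "\<bar>?D w u - ?D w' u\<bar> \<le> 2 * l * norm (w - w')" for u
  proof -
    define a where "a s w = (\<chi> j. if j = i then w $ i + s else w $ j + u $ j)" for s and w :: "real ^ 'd"
    have "a s w - a s w' = w - w'" for s
      by (auto simp: a_def vec_eq_iff)
    then have "\<bar>f (a s w) - f (a s w')\<bar> \<le> l * norm (w - w')" for s
      using lip[of "a s w" "a s w'"] by simp
    from this[of "\<alpha>/2"] this[of "-(\<alpha>/2)"]
    have "\<bar>(f (a (\<alpha>/2) w) - f (a (-(\<alpha>/2)) w)) - (f (a (\<alpha>/2) w') - f (a (-(\<alpha>/2)) w'))\<bar> \<le> 2 * l * norm (w - w')"
      by linarith
    then show ?thesis by (simp add: finite_diff_def a_def cong: if_cong)
  qed
  have "\<bar>(\<integral>u. ?D w u \<partial>smoothing_law \<alpha>) - (\<integral>u. ?D w' u \<partial>smoothing_law \<alpha>)\<bar> =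
      \<bar>\<integral>u. ?D w u - ?D w' u \<partial>smoothing_law \<alpha>\<bar>"
    by (simp add: integrable_smoothing_finite_diff)
  also have "\<dots> \<le> (\<integral>u. \<bar>?D w u - ?D w' u\<bar> \<partial>smoothing_law \<alpha>)"
    by (rule integral_abs_bound)
  also have "\<dots> \<le> (\<integral>u. 2 * l * norm (w - w') \<partial>(smoothing_law \<alpha> :: (real ^ 'd) measure))"
    by (intro integral_mono integrable_abs Bochner_Integration.integrable_diff integrable_smoothing_finite_diff 1) auto
  finally have "\<bar>(\<integral>u. ?D w u \<partial>smoothing_law \<alpha>) - (\<integral>u. ?D w' u \<partial>smoothing_law \<alpha>)\<bar> / \<alpha> \<le> 2 * l * norm (w - w') / \<alpha>"
    using \<alpha> by (intro divide_right_mono) (auto simp: prob_space[simplified])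
  then show ?thesis
    using \<alpha> by (simp add: smoothed_gradient_def diff_divide_distrib[symmetric])
qed

lemma smoothed_gradient_Lipschitz:
  "norm (smoothed_gradient \<alpha> f w - smoothed_gradient \<alpha> f w') \<le>
     2 * sqrt (real CARD('d)) * l / \<alpha> * norm (w - w')"
proof -
  have "norm (smoothed_gradient \<alpha> f w - smoothed_gradient \<alpha> f w') \<le>
      sqrt (real CARD('d)) * (2 * l / \<alpha> * norm (w - w'))"
    by (rule norm_vec_le_componentwise)
       (use smoothed_gradient_component_Lipschitz[of w _ w'] in simp)
  also have "\<dots> = 2 * sqrt (real CARD('d)) * l / \<alpha> * norm (w - w')" by simp
  finally show ?thesis .
qed

text \<open>On every line in direction \<open>i\<close> the remainder is that of a moving average,
  which is quadratic in \<open>t\<close> although \<open>f\<close> need not be differentiable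
  anywhere on that line's endpoints.\<close>

lemma smoothed_coordinate_step:
  "\<bar>smoothed \<alpha> f (w + axis i t) - smoothed \<alpha> f w - t * smoothed_gradient \<alpha> f w $ i\<bar> \<le> 2 * l * t\<^sup>2 / \<alpha>"
proof -
  let ?D = "\<lambda>u. finite_diff \<alpha> (\<lambda>v (_ :: unit). f v) w u () $ i"
  have eq: "smoothed \<alpha> f (w + axis i t) - smoothed \<alpha> f w - t * smoothed_gradient \<alpha> f w $ i =
    (\<integral>u. f (w + axis i t + u) - f (w + u) - t * (?D u / \<alpha>) \<partial>smoothing_law \<alpha>)"
    unfolding smoothed_def smoothed_gradient_def
    by (simp add: integrable_smoothing_finite_diff integrable_smoothing_shift)
  show ?thesis
    unfolding eq
  proof (rule integral_smoothing_law_slices_bound[OF \<alpha>, where i = i])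
    show "continuous_on UNIV (\<lambda>u. f (w + axis i t + u) - f (w + u) - t * (?D u / \<alpha>))"
      unfolding finite_diff_def using \<alpha> by (auto intro!: Lipschitz_continuous_compose continuous_on_coord_update continuous_intros)
    fix u :: "real ^ 'd"
    define \<psi> where "\<psi> s = f (\<chi> j. if j = i then s else w $ j + u $ j)" for s
    have \<psi>: "\<bar>\<psi> s - \<psi> s'\<bar> \<le> l * \<bar>s - s'\<bar>" for s s'
    proof -
      have "(\<chi> j. if j = i then s else w $ j + u $ j) - (\<chi> j. if j = i then s' else w $ j + u $ j) = axis i (s - s')"
        by (auto simp: vec_eq_iff axis_def)
      then show ?thesis
        using lip[of "\<chi> j. if j = i then s else w $ j + u $ j" "\<chi> j. if j = i then s' else w $ j + u $ j"]
        unfolding \<psi>_def by (simp only: norm_axis_real)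
    qed
    \<comment> \<open>On a slice the finite difference is constant, because it overwrites coordinate
      \<open>i\<close>; the rest is \<psi> evaluated along the line.\<close>
    have *: "f (w + axis i t + (\<chi> j. if j = i then s else u $ j)) - f (w + (\<chi> j. if j = i then s else u $ j))
      - t * (?D (\<chi> j. if j = i then s else u $ j) / \<alpha>) =
      \<psi> (w $ i + t + s) - \<psi> (w $ i + s) - t * ((\<psi> (w $ i + \<alpha> / 2) - \<psi> (w $ i - \<alpha> / 2)) / \<alpha>)" for s
    proof -
      have "w + axis i t + (\<chi> j. if j = i then s else u $ j) = (\<chi> j. if j = i then w $ i + t + s else w $ j + u $ j)"
        "w + (\<chi> j. if j = i then s else u $ j) = (\<chi> j. if j = i then w $ i + s else w $ j + u $ j)"
        by (auto simp: vec_eq_iff axis_def)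
      moreover have "(\<chi> j. if j = i then c else w $ j + (\<chi> j. if j = i then s else u $ j) $ j) =
        (\<chi> j. if j = i then c else w $ j + u $ j)" for c
        by (auto simp: vec_eq_iff)
      ultimately show ?thesis by (simp add: \<psi>_def finite_diff_def)
    qed
    have "\<bar>\<integral>s. indicator {-\<alpha>/2..\<alpha>/2} s *
      (\<psi> (w $ i + t + s) - \<psi> (w $ i + s) - t * ((\<psi> (w $ i + \<alpha> / 2) - \<psi> (w $ i - \<alpha> / 2)) / \<alpha>)) \<partial>lborel\<bar> \<le> 2 * l * t\<^sup>2"
      by (rule Lipschitz_moving_average_bound[OF \<psi> \<alpha>])
    then show "\<bar>\<integral>s. indicator {-\<alpha>/2..\<alpha>/2} s *
      (f (w + axis i t + (\<chi> j. if j = i then s else u $ j)) - f (w + (\<chi> j. if j = i then s else u $ j))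
      - t * (?D (\<chi> j. if j = i then s else u $ j) / \<alpha>)) \<partial>lborel\<bar> \<le> \<alpha> * (2 * l * t\<^sup>2 / \<alpha>)"
      unfolding * using \<alpha> by simp
  qed
qed

text \<open>Coordinates of \<open>h\<close> are switched on one at a time. Each costs
  \<open>2 * l / \<alpha> * (norm h)\<^sup>2\<close> twice: once for the step along the coordinate,
  and once for replacing the partial derivative at the intermediate point by the one at
  \<open>w\<close>.\<close>

lemma smoothed_quadratic_bound:
  "\<bar>smoothed \<alpha> f (w + h) - smoothed \<alpha> f w - h \<bullet> smoothed_gradient \<alpha> f w\<bar> \<le>
     real CARD('d) * (4 * l / \<alpha>) * (norm h)\<^sup>2"
proof -
  define p where "p I = w + (\<chi> j. if j \<in> I then h $ j else 0)" for I
  have "finite I \<Longrightarrow> \<bar>smoothed \<alpha> f (p I) - smoothed \<alpha> f w - (\<Sum>i\<in>I. h $ i * smoothed_gradient \<alpha> f w $ i)\<bar> \<le>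
     real (card I) * (4 * l / \<alpha>) * (norm h)\<^sup>2" for I
  proof (induction I rule: finite_induct)
    case empty
    have "(\<chi> j. 0) = (0 :: real ^ 'd)" by (simp add: vec_eq_iff)
    then show ?case by (simp add: p_def)
  next
    case (insert i I)
    have p: "p (insert i I) = p I + axis i (h $ i)"
      using insert by (auto simp: p_def vec_eq_iff axis_def)
    have hi: "\<bar>h $ i\<bar> \<le> norm h" by (rule component_le_norm_cart)
    have "norm (p I - w) \<le> norm h"
      by (auto simp: p_def intro!: norm_le_componentwise_cart)
    then have "\<bar>smoothed_gradient \<alpha> f (p I) $ i - smoothed_gradient \<alpha> f w $ i\<bar> \<le> 2 * l / \<alpha> * norm h"
      using Lipschitz_const_nonneg \<alpha> by (intro order_trans[OF smoothed_gradient_component_Lipschitz] mult_left_mono) auto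
    with hi have "\<bar>h $ i\<bar> * \<bar>smoothed_gradient \<alpha> f (p I) $ i - smoothed_gradient \<alpha> f w $ i\<bar> \<le> norm h * (2 * l / \<alpha> * norm h)"
      by (intro mult_mono) auto
    then have 1: "\<bar>h $ i * smoothed_gradient \<alpha> f (p I) $ i - h $ i * smoothed_gradient \<alpha> f w $ i\<bar> \<le> 2 * l / \<alpha> * (norm h)\<^sup>2"
      by (simp add: right_diff_distrib[symmetric] abs_mult power2_eq_square mult_ac)
    have "\<bar>h $ i\<bar>\<^sup>2 \<le> (norm h)\<^sup>2" using hi by (intro power_mono) auto
    then have "2 * l * (h $ i)\<^sup>2 / \<alpha> \<le> 2 * l * (norm h)\<^sup>2 / \<alpha>"
      using Lipschitz_const_nonneg \<alpha> by (intro divide_right_mono mult_left_mono) auto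
    then have 2: "\<bar>smoothed \<alpha> f (p (insert i I)) - smoothed \<alpha> f (p I) - h $ i * smoothed_gradient \<alpha> f (p I) $ i\<bar> \<le> 2 * l / \<alpha> * (norm h)\<^sup>2"
      using smoothed_coordinate_step[of "p I" i "h $ i"] unfolding p by simp
    have card_insert: "real (card (insert i I)) * (4 * l / \<alpha>) * (norm h)\<^sup>2 =
      real (card I) * (4 * l / \<alpha>) * (norm h)\<^sup>2 + 2 * l / \<alpha> * (norm h)\<^sup>2 + 2 * l / \<alpha> * (norm h)\<^sup>2"
      using insert.hyps \<alpha> by (simp add: field_simps)
    have "\<bar>a - b - (z + s)\<bar> \<le> e + c + c" if "\<bar>y - z\<bar> \<le> c" "\<bar>a - b' - y\<bar> \<le> c" "\<bar>b' - b - s\<bar> \<le> e"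
      for a b b' s y z c e :: real
      using that by linarith
    from this[OF 1 2 insert.IH] show ?case
      unfolding sum.insert[OF insert.hyps] card_insert .
  qed
  from this[of UNIV] show ?thesis by (simp add: p_def inner_vec_def)
qed

lemma smoothed_GDERIV: "GDERIV (smoothed \<alpha> f) w :> smoothed_gradient \<alpha> f w"
  unfolding gderiv_def has_derivative_at
proof
  show "bounded_linear (\<lambda>h. h \<bullet> smoothed_gradient \<alpha> f w)" by (rule bounded_linear_inner_left)
  define C where "C = real CARD('d) * (4 * l / \<alpha>)"
  show "(\<lambda>h. norm (smoothed \<alpha> f (w + h) - smoothed \<alpha> f w - h \<bullet> smoothed_gradient \<alpha> f w) / norm h) \<midarrow>0\<rightarrow> 0"
  proof (rule tendsto_sandwich[where f = "\<lambda>_. 0" and h = "\<lambda>h. C * norm h"])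
    have "norm (smoothed \<alpha> f (w + h) - smoothed \<alpha> f w - h \<bullet> smoothed_gradient \<alpha> f w) / norm h \<le> C * norm h" for h
      using smoothed_quadratic_bound[of w h] by (cases "h = 0") (simp_all add: C_def field_simps power2_eq_square)
    then show "\<forall>\<^sub>F h in at 0. norm (smoothed \<alpha> f (w + h) - smoothed \<alpha> f w - h \<bullet> smoothed_gradient \<alpha> f w) / norm h \<le> C * norm h"
      by simp
    show "(\<lambda>h. C * norm h) \<midarrow>(0 :: real ^ 'd)\<rightarrow> 0"
      by (rule tendsto_eq_intros tendsto_norm_zero tendsto_ident_at refl | simp)+
  qed auto
qed

end

section \<open>Minibatch projected stochastic gradient descent\<close>

text \<open>Induction over the batch: the new sample is integrated first, and its cross term with
  the partial sum vanishes because the mean is 0.\<close>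

lemma minibatch_variance:
  fixes X :: "'z \<Rightarrow> 'v::euclidean_space"
  assumes \<mu>: "prob_space \<mu>" and X: "integrable \<mu> X" and X2: "integrable \<mu> (\<lambda>z. (norm (X z))\<^sup>2)"
    and mean: "(\<integral>z. X z \<partial>\<mu>) = 0" and J: "finite J"
  shows "(\<integral>\<^sup>+y. ennreal ((norm (\<Sum>j\<in>J. X (y j)))\<^sup>2) \<partial>(\<Pi>\<^sub>M j\<in>J. \<mu>)) =
    ennreal (real (card J) * (\<integral>z. (norm (X z))\<^sup>2 \<partial>\<mu>))"
  using J
proof (induction J rule: finite_induct)
  case empty
  then show ?case by (simp add: nn_integral_empty)
next
  case (insert i J)
  interpret \<mu>: prob_space \<mu> by fact
  interpret product_prob_space "\<lambda>_. \<mu>" J by standard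
  define c where "c = (\<integral>z. (norm (X z))\<^sup>2 \<partial>\<mu>)"
  have c: "0 \<le> c" by (simp add: c_def)
  have [measurable]: "X \<in> borel_measurable \<mu>" using X by auto
  have shift: "(\<integral>\<^sup>+z. ennreal ((norm (s + X z))\<^sup>2) \<partial>\<mu>) = ennreal ((norm s)\<^sup>2) + ennreal c" for s
  proof -
    have eq: "(norm (s + X z))\<^sup>2 = (norm s)\<^sup>2 + 2 * (s \<bullet> X z) + (norm (X z))\<^sup>2" for z
      by (simp add: power2_norm_eq_inner inner_add inner_commute)
    have i: "integrable \<mu> (\<lambda>z. (norm s)\<^sup>2 + 2 * (s \<bullet> X z) + (norm (X z))\<^sup>2)"
      using X X2 by simp
    have "(\<integral>\<^sup>+z. ennreal ((norm (s + X z))\<^sup>2) \<partial>\<mu>) = ennreal (\<integral>z. (norm (s + X z))\<^sup>2 \<partial>\<mu>)"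
      unfolding eq by (rule nn_integral_eq_integral[OF i]) (simp add: eq[symmetric])
    also have "(\<integral>z. (norm (s + X z))\<^sup>2 \<partial>\<mu>) = (norm s)\<^sup>2 + c"
      unfolding eq using X X2 mean by (simp add: c_def \<mu>.prob_space)
    finally show ?thesis using c by (simp add: ennreal_plus)
  qed
  have "(\<integral>\<^sup>+y. ennreal ((norm (\<Sum>j\<in>insert i J. X (y j)))\<^sup>2) \<partial>(\<Pi>\<^sub>M j\<in>insert i J. \<mu>)) =
      (\<integral>\<^sup>+y. (\<integral>\<^sup>+z. ennreal ((norm (\<Sum>j\<in>insert i J. X ((y(i := z)) j)))\<^sup>2) \<partial>\<mu>) \<partial>(\<Pi>\<^sub>M j\<in>J. \<mu>))"
    using insert.hyps by (intro product_nn_integral_insert) auto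
  also have "\<dots> = (\<integral>\<^sup>+y. (\<integral>\<^sup>+z. ennreal ((norm ((\<Sum>j\<in>J. X (y j)) + X z))\<^sup>2) \<partial>\<mu>) \<partial>(\<Pi>\<^sub>M j\<in>J. \<mu>))"
  proof -
    have "(\<Sum>j\<in>insert i J. X ((y(i := z)) j)) = (\<Sum>j\<in>J. X (y j)) + X z" for y z
    proof -
      have "(\<Sum>j\<in>J. X ((y(i := z)) j)) = (\<Sum>j\<in>J. X (y j))"
        using insert.hyps by (intro sum.cong) auto
      then show ?thesis using insert.hyps by simp
    qed
    then show ?thesis by simp
  qed
  also have "\<dots> = (\<integral>\<^sup>+y. ennreal ((norm (\<Sum>j\<in>J. X (y j)))\<^sup>2) \<partial>(\<Pi>\<^sub>M j\<in>J. \<mu>)) + ennreal c"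
    unfolding shift by (subst nn_integral_add) (auto simp: emeasure_space_1)
  also have "\<dots> = ennreal (real (card (insert i J)) * c)"
    using insert c by (simp add: c_def[symmetric] ennreal_plus[symmetric] algebra_simps del: ennreal_plus)
  finally show ?case by (simp add: c_def)
qed

text \<open>The variance is at most the second moment, and averaging over the batch divides it by
  the batch size. Integrability of \<open>g\<close> follows from its second moment via x \<le> 1 +
  x^2.\<close>

lemma minibatch_mean_error:
  fixes g :: "'z \<Rightarrow> 'v::euclidean_space"
  assumes \<mu>: "prob_space \<mu>" and [measurable]: "g \<in> borel_measurable \<mu>"
    and V: "(\<integral>\<^sup>+z. ennreal ((norm (g z))\<^sup>2) \<partial>\<mu>) \<le> ennreal V" "0 \<le> V"
    and J: "finite J" "J \<noteq> {}"
  shows "(\<integral>\<^sup>+y. ennreal ((norm ((1 / real (card J)) *\<^sub>R (\<Sum>j\<in>J. g (y j)) - (\<integral>z. g z \<partial>\<mu>)))\<^sup>2) \<partial>(\<Pi>\<^sub>M j\<in>J. \<mu>)) \<le>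
    ennreal (V / real (card J))"
proof -
  interpret \<mu>: prob_space \<mu> by fact
  define m where "m = (\<integral>z. g z \<partial>\<mu>)"
  define X where "X z = g z - m" for z
  have cJ: "0 < real (card J)" using J by (simp add: card_gt_0_iff)
  have [measurable]: "X \<in> borel_measurable \<mu>" unfolding X_def by simp
  have g2: "integrable \<mu> (\<lambda>z. (norm (g z))\<^sup>2)"
    using V by (intro integrableI_bounded) (auto intro: le_less_trans)
  have g: "integrable \<mu> g"
  proof (rule Bochner_Integration.integrable_bound)
    show "integrable \<mu> (\<lambda>z. 1 + (norm (g z))\<^sup>2)" using g2 by simp
    show "AE z in \<mu>. norm (g z) \<le> norm (1 + (norm (g z))\<^sup>2)"
    proof (rule AE_I2)
      fix z
      have "0 \<le> (norm (g z) - 1)\<^sup>2 + (norm (g z))\<^sup>2 + 1" by simp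
      then show "norm (g z) \<le> norm (1 + (norm (g z))\<^sup>2)"
        by (simp add: power2_eq_square algebra_simps)
    qed
  qed simp
  have eq: "(norm (X z))\<^sup>2 = (norm (g z))\<^sup>2 - 2 * (m \<bullet> g z) + (norm m)\<^sup>2" for z
    by (simp add: X_def power2_norm_eq_inner inner_diff inner_commute)
  have X: "integrable \<mu> X" "integrable \<mu> (\<lambda>z. (norm (X z))\<^sup>2)"
    using g g2 by (simp_all add: X_def[abs_def] eq[unfolded X_def])
  have mean: "(\<integral>z. X z \<partial>\<mu>) = 0"
    using g by (simp add: X_def m_def \<mu>.prob_space)
  have "(\<integral>z. (norm (X z))\<^sup>2 \<partial>\<mu>) = (\<integral>z. (norm (g z))\<^sup>2 \<partial>\<mu>) - (norm m)\<^sup>2"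
    unfolding eq using g g2
    by (simp add: \<mu>.prob_space m_def[symmetric] power2_norm_eq_inner)
  also have "(\<integral>z. (norm (g z))\<^sup>2 \<partial>\<mu>) \<le> V"
    using V nn_integral_eq_integral[OF g2] by simp
  finally have var: "(\<integral>z. (norm (X z))\<^sup>2 \<partial>\<mu>) \<le> V"
    by (smt (verit) zero_le_power2)
  have "(1 / real (card J)) *\<^sub>R (\<Sum>j\<in>J. g (y j)) - m = (1 / real (card J)) *\<^sub>R (\<Sum>j\<in>J. X (y j))" for y
    using cJ by (simp add: X_def sum_subtractf scaleR_diff_right sum_constant_scaleR)
  then have "(\<integral>\<^sup>+y. ennreal ((norm ((1 / real (card J)) *\<^sub>R (\<Sum>j\<in>J. g (y j)) - m))\<^sup>2) \<partial>(\<Pi>\<^sub>M j\<in>J. \<mu>)) =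
      (\<integral>\<^sup>+y. ennreal (1 / (real (card J))\<^sup>2) * ennreal ((norm (\<Sum>j\<in>J. X (y j)))\<^sup>2) \<partial>(\<Pi>\<^sub>M j\<in>J. \<mu>))"
    by (simp add: ennreal_mult'[symmetric] power_divide)
  also have "\<dots> = ennreal (1 / (real (card J))\<^sup>2) * ennreal (real (card J) * (\<integral>z. (norm (X z))\<^sup>2 \<partial>\<mu>))"
    by (subst nn_integral_cmult) (auto simp: minibatch_variance[OF \<mu> X mean J(1)])
  also have "\<dots> = ennreal ((\<integral>z. (norm (X z))\<^sup>2 \<partial>\<mu>) / real (card J))"
    using cJ by (simp add: ennreal_mult'[symmetric] power2_eq_square)
  also have "\<dots> \<le> ennreal (V / real (card J))"
    using var by (intro ennreal_leI divide_right_mono) auto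
  finally show ?thesis by (simp add: m_def)
qed

section \<open>Dependence of the iterates on samples and directions\<close>

lemma spa_iterate_in:
  assumes "w1 \<in> A" "\<And>k x. \<pi> k x \<in> proj_set A x"
  shows "spa_iterate g \<eta> B \<pi> w1 z k \<in> A"
  using assms by (cases k) (auto simp: Let_def proj_set_def)

text \<open>Iterate \<open>k\<close> reads only samples of earlier iterations, the source of its
  independence from batch \<open>k\<close>. The directions need to agree only on \<open>A\<close>
  and at the samples drawn, so the loss can be replaced by its extension and unread samples can be
  altered.\<close>

lemma spa_iterate_cong:
  assumes w: "w1 \<in> A" and \<pi>: "\<And>k x. \<pi> k x \<in> proj_set A x"
    and eq: "\<And>w j m. w \<in> A \<Longrightarrow> 1 \<le> j \<Longrightarrow> j < k \<Longrightarrow> m \<in> {1..B} \<Longrightarrow>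
        g w (fst (z j m)) (snd (z j m)) = g' w (fst (z' j m)) (snd (z' j m))"
  shows "spa_iterate g \<eta> B \<pi> w1 z k = spa_iterate g' \<eta> B \<pi> w1 z' k"
  using eq
proof (induction k)
  case (Suc k)
  have IH: "spa_iterate g \<eta> B \<pi> w1 z k = spa_iterate g' \<eta> B \<pi> w1 z' k"
    using Suc.prems by (intro Suc.IH) auto
  have "spa_iterate g' \<eta> B \<pi> w1 z' k \<in> A" by (rule spa_iterate_in[OF w \<pi>])
  then show ?case
    unfolding spa_iterate.simps IH using Suc.prems by (auto simp: Let_def)
qed simp

text \<open>What both updates have in common. Mean and second moment are prescribed on
  \<open>A\<close> only, where the gradient estimator is known to be correct. The bound \<Delta>
  ranges over all of \<open>A\<close> because the last iterate is random.\<close>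

locale projected_sgd =
  fixes \<mu> :: "('v::euclidean_space \<times> 'x) measure" and g :: "'v \<Rightarrow> 'v \<Rightarrow> 'x \<Rightarrow> 'v"
    and \<phi> :: "'v \<Rightarrow> real" and \<Phi> :: "'v \<Rightarrow> 'v" and A :: "'v set" and \<pi> :: "nat \<Rightarrow> 'v \<Rightarrow> 'v"
    and w1 :: 'v and L \<rho> \<eta> V \<Delta> :: real and K B :: nat
  assumes \<mu>: "prob_space \<mu>"
    and g_meas: "(\<lambda>(w, z). g w (fst z) (snd z)) \<in> borel_measurable (borel \<Otimes>\<^sub>M \<mu>)"
    and g_mean: "\<And>w. w \<in> A \<Longrightarrow> (\<integral>z. g w (fst z) (snd z) \<partial>\<mu>) = \<Phi> w"
    and g_second: "\<And>w. w \<in> A \<Longrightarrow> (\<integral>\<^sup>+z. ennreal ((norm (g w (fst z) (snd z)))\<^sup>2) \<partial>\<mu>) \<le> ennreal V"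
    and V: "0 \<le> V"
    and gderiv: "\<And>w. GDERIV \<phi> w :> \<Phi> w"
    and \<Phi>_Lipschitz: "\<And>w w'. norm (\<Phi> w - \<Phi> w') \<le> L * norm (w - w')" and L: "0 < L"
    and \<rho>: "1 < \<rho>" and \<eta>: "1 / \<eta> = 3 * \<rho> / 2 * L"
    and \<pi>_meas: "\<And>k. \<pi> k \<in> borel_measurable borel"
    and \<pi>: "\<And>k x. \<pi> k x \<in> proj_set A x"
    and w1: "w1 \<in> A"
    and \<Delta>: "\<And>w. w \<in> A \<Longrightarrow> \<phi> w1 - \<phi> w \<le> \<Delta>"
    and B: "0 < B" and K: "0 < K"
begin

abbreviation "idx \<equiv> {1..K} \<times> {1..B}"
abbreviation "samples \<equiv> PiM idx (\<lambda>_. \<mu>)"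

definition iter :: "nat \<Rightarrow> (nat \<times> nat \<Rightarrow> 'v \<times> 'x) \<Rightarrow> 'v" where
  "iter k \<zeta> = spa_iterate g \<eta> B \<pi> w1 (\<lambda>k m. \<zeta> (k, m)) k"

definition batch :: "nat \<Rightarrow> (nat \<times> nat \<Rightarrow> 'v \<times> 'x) \<Rightarrow> 'v" where
  "batch k \<zeta> = (1 / real B) *\<^sub>R (\<Sum>m=1..B. g (iter k \<zeta>) (fst (\<zeta> (k, m))) (snd (\<zeta> (k, m))))"

text \<open>Chosen so that subtracting the gradient at the new iterate leaves the displacement of
  the projection divided by \<eta>, which is a Frechet normal there.\<close>

definition residual :: "nat \<Rightarrow> (nat \<times> nat \<Rightarrow> 'v \<times> 'x) \<Rightarrow> 'v" where
  "residual k \<zeta> = \<Phi> (iter (Suc k) \<zeta>) - batch k \<zeta> - (1 / \<eta>) *\<^sub>R (iter (Suc k) \<zeta> - iter k \<zeta>)"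

lemma iter_in: "iter k \<zeta> \<in> A"
  unfolding iter_def by (rule spa_iterate_in[OF w1 \<pi>])

lemma iter_1: "iter 1 \<zeta> = w1"
  by (simp add: iter_def)

lemma iter_Suc: "0 < k \<Longrightarrow> iter (Suc k) \<zeta> = \<pi> k (iter k \<zeta> - \<eta> *\<^sub>R batch k \<zeta>)"
  by (simp add: iter_def batch_def Let_def)

lemma \<eta>_pos: "0 < \<eta>"
proof -
  have "0 < 1 / \<eta>" unfolding \<eta> using \<rho> L by simp
  then show ?thesis by simp
qed

lemma residual_normal:
  assumes "0 < k"
  shows "residual k \<zeta> - \<Phi> (iter (Suc k) \<zeta>) \<in> frechet_normals (iter (Suc k) \<zeta>) A"
proof -
  have "(1 / \<eta>) *\<^sub>R ((iter k \<zeta> - \<eta> *\<^sub>R batch k \<zeta>) - iter (Suc k) \<zeta>) \<in> frechet_normals (iter (Suc k) \<zeta>) A"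
    using \<eta>_pos by (intro proj_set_frechet_normal) (auto simp: iter_Suc[OF assms] \<pi>)
  also have "(1 / \<eta>) *\<^sub>R ((iter k \<zeta> - \<eta> *\<^sub>R batch k \<zeta>) - iter (Suc k) \<zeta>) = residual k \<zeta> - \<Phi> (iter (Suc k) \<zeta>)"
    using \<eta>_pos by (simp add: residual_def scaleR_diff_right)
  finally show ?thesis .
qed

lemma g_measurable[measurable (raw)]:
  assumes "h \<in> borel_measurable M" "z \<in> measurable M \<mu>"
  shows "(\<lambda>x. g (h x) (fst (z x)) (snd (z x))) \<in> borel_measurable M"
  using measurable_compose[OF measurable_Pair[OF assms] g_meas] by simp

lemma iter_measurable: "k \<le> Suc K \<Longrightarrow> iter k \<in> borel_measurable samples"
proof (induction k)
  case (Suc k)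
  show ?case
  proof (cases "k = 0")
    case False
    have it[measurable]: "iter k \<in> borel_measurable samples" and [measurable]: "\<pi> k \<in> borel_measurable borel"
      using Suc \<pi>_meas by auto
    have sample: "(\<lambda>\<zeta>. \<zeta> (k, m)) \<in> measurable samples \<mu>" if "m \<in> {1..B}" for m
      using that Suc.prems False by (intro measurable_component_singleton) auto
    then have [measurable]: "batch k \<in> borel_measurable samples"
      unfolding batch_def by (intro borel_measurable_scaleR borel_measurable_sum borel_measurable_const g_measurable it sample)
    have "(\<lambda>\<zeta>. \<pi> k (iter k \<zeta> - \<eta> *\<^sub>R batch k \<zeta>)) \<in> borel_measurable samples"
      by measurable
    moreover have "iter (Suc k) = (\<lambda>\<zeta>. \<pi> k (iter k \<zeta> - \<eta> *\<^sub>R batch k \<zeta>))"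
      using False by (intro ext iter_Suc) simp
    ultimately show ?thesis by simp
  qed (simp add: iter_def[abs_def])
qed (simp add: iter_def[abs_def])

lemma batch_measurable: "k \<in> {1..K} \<Longrightarrow> batch k \<in> borel_measurable samples"
proof -
  assume k: "k \<in> {1..K}"
  have it: "iter k \<in> borel_measurable samples" using k by (intro iter_measurable) auto
  have sample: "(\<lambda>\<zeta>. \<zeta> (k, m)) \<in> measurable samples \<mu>" if "m \<in> {1..B}" for m
    using that k by (intro measurable_component_singleton) auto
  then show ?thesis
    unfolding batch_def by (intro borel_measurable_scaleR borel_measurable_sum borel_measurable_const g_measurable it sample)
qed

lemma \<Phi>_measurable[measurable]: "\<Phi> \<in> borel_measurable borel"
proof (rule borel_measurable_continuous_onI)
  show "continuous_on UNIV \<Phi>"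
    by (rule lipschitz_on_continuous_on[where L = L], rule lipschitz_onI)
       (use \<Phi>_Lipschitz L in \<open>auto simp: dist_norm\<close>)
qed

lemma residual_measurable: "k \<in> {1..K} \<Longrightarrow> residual k \<in> borel_measurable samples"
proof -
  assume k: "k \<in> {1..K}"
  have [measurable]: "iter k \<in> borel_measurable samples" "iter (Suc k) \<in> borel_measurable samples"
    "batch k \<in> borel_measurable samples"
    using iter_measurable[of k] iter_measurable[of "Suc k"] batch_measurable[OF k] k by auto
  show ?thesis unfolding residual_def by measurable
qed

text \<open>The product space is split into the samples \<open>J\<close> of iteration
  \<open>k\<close> and all others. With the others fixed, iterate \<open>k\<close> is a fixed point
  of \<open>A\<close> and the inner integral is the error of one minibatch.\<close>

lemma batch_error:
  assumes k: "k \<in> {1..K}"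
  shows "(\<integral>\<^sup>+\<zeta>. ennreal ((norm (batch k \<zeta> - \<Phi> (iter k \<zeta>)))\<^sup>2) \<partial>samples) \<le> ennreal (V / real B)"
proof -
  interpret \<mu>: prob_space \<mu> by (rule \<mu>)
  interpret product_prob_space "\<lambda>_::nat \<times> nat. \<mu>" UNIV by standard
  define J where "J = {k} \<times> {1..B}"
  define I where "I = idx - J"
  interpret PI: prob_space "PiM I (\<lambda>_. \<mu>)" by (intro prob_space_PiM) (rule \<mu>)
  have IJ: "I \<inter> J = {}" "finite I" "finite J" "idx = I \<union> J"
    using k by (auto simp: I_def J_def)
  have J: "J \<noteq> {}" "card J = B" using B by (auto simp: J_def card_cartesian_product)
  have [measurable]: "batch k \<in> borel_measurable samples" "iter k \<in> borel_measurable samples"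
    using iter_measurable[of k] iter_measurable[of "Suc k"] batch_measurable[OF k] k by auto
  have "(\<integral>\<^sup>+\<zeta>. ennreal ((norm (batch k \<zeta> - \<Phi> (iter k \<zeta>)))\<^sup>2) \<partial>samples) =
      (\<integral>\<^sup>+x. (\<integral>\<^sup>+y. ennreal ((norm (batch k (merge I J (x, y)) - \<Phi> (iter k (merge I J (x, y)))))\<^sup>2)
        \<partial>PiM J (\<lambda>_. \<mu>)) \<partial>PiM I (\<lambda>_. \<mu>))"
    by (subst IJ(4), rule product_nn_integral_fold[OF IJ(1-3)]) (subst IJ(4)[symmetric], measurable)
  also have "\<dots> \<le> (\<integral>\<^sup>+x. ennreal (V / real B) \<partial>PiM I (\<lambda>_. \<mu>))"
  proof (rule nn_integral_mono)
    fix x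
    \<comment> \<open>\<open>undefined\<close> stands for the samples of iteration \<open>k\<close>,
      which iterate \<open>k\<close> does not read.\<close>
    define w where "w = iter k (merge I J (x, \<lambda>_. undefined))"
    have w: "iter k (merge I J (x, y)) = w" for y
      unfolding w_def iter_def
      by (rule spa_iterate_cong[OF w1 \<pi>]) (use k in \<open>auto simp: merge_def I_def J_def\<close>)
    have b: "batch k (merge I J (x, y)) = (1 / real (card J)) *\<^sub>R (\<Sum>j\<in>J. g w (fst (y j)) (snd (y j)))" for y
    proof -
      have "(\<Sum>j\<in>J. g w (fst (y j)) (snd (y j))) = (\<Sum>m=1..B. g w (fst (y (k, m))) (snd (y (k, m))))"
        unfolding J_def by (rule sum.reindex_bij_witness[where i = "\<lambda>m. (k, m)" and j = snd]) auto
      also have "\<dots> = (\<Sum>m=1..B. g w (fst (merge I J (x, y) (k, m))) (snd (merge I J (x, y) (k, m))))"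
        by (intro sum.cong) (auto simp: merge_def I_def J_def)
      finally show ?thesis by (simp add: batch_def w J)
    qed
    have wA: "w \<in> A" unfolding w_def by (rule iter_in)
    have "(\<integral>\<^sup>+y. ennreal ((norm ((1 / real (card J)) *\<^sub>R (\<Sum>j\<in>J. g w (fst (y j)) (snd (y j))) -
        (\<integral>z. g w (fst z) (snd z) \<partial>\<mu>)))\<^sup>2) \<partial>(\<Pi>\<^sub>M j\<in>J. \<mu>)) \<le> ennreal (V / real (card J))"
      by (rule minibatch_mean_error[OF \<mu> _ g_second[OF wA] V IJ(3) J(1)]) measurable
    then show "(\<integral>\<^sup>+y. ennreal ((norm (batch k (merge I J (x, y)) - \<Phi> (iter k (merge I J (x, y)))))\<^sup>2) \<partial>PiM J (\<lambda>_. \<mu>))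
      \<le> ennreal (V / real B)"
      unfolding w b g_mean[OF wA] J(2) .
  qed
  also have "\<dots> = ennreal (V / real B)"
    by (simp add: PI.emeasure_space_1)
  finally show ?thesis .
qed

text \<open>The descent part telescopes on every path, so the expectation is taken only of the batch
  errors.\<close>

lemma residual_sum_expectation:
  "(\<integral>\<^sup>+\<zeta>. (\<Sum>k=1..K. ennreal ((norm (residual k \<zeta>))\<^sup>2)) \<partial>samples) \<le>
     ennreal (descent_const \<rho> * L * \<Delta> + (descent_const \<rho> + 2) * (real K * (V / real B)))"
proof -
  interpret \<mu>: prob_space \<mu> by (rule \<mu>)
  interpret PS: prob_space samples by (intro prob_space_PiM) (rule \<mu>)
  have c: "0 \<le> descent_const \<rho>" by (rule descent_const_nonneg[OF \<rho>])
  have \<Delta>0: "0 \<le> \<Delta>" using \<Delta>[OF w1] by simp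
  have err_meas: "k \<in> {1..K} \<Longrightarrow> (\<lambda>\<zeta>. ennreal ((norm (batch k \<zeta> - \<Phi> (iter k \<zeta>)))\<^sup>2)) \<in> borel_measurable samples" for k
  proof -
    assume k: "k \<in> {1..K}"
    have [measurable]: "batch k \<in> borel_measurable samples" "iter k \<in> borel_measurable samples"
      using iter_measurable[of k] iter_measurable[of "Suc k"] batch_measurable[OF k] k by auto
    show ?thesis by measurable
  qed
  have pt: "(\<Sum>k=1..K. ennreal ((norm (residual k \<zeta>))\<^sup>2)) \<le> ennreal (descent_const \<rho> * L * \<Delta>) +
      ennreal (descent_const \<rho> + 2) * (\<Sum>k=1..K. ennreal ((norm (batch k \<zeta> - \<Phi> (iter k \<zeta>)))\<^sup>2))" for \<zeta>
  proof -
    have "(\<Sum>k=1..K. (norm (residual k \<zeta>))\<^sup>2) \<le> descent_const \<rho> * L * \<Delta> +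
        (descent_const \<rho> + 2) * (\<Sum>k=1..K. (norm (batch k \<zeta> - \<Phi> (iter k \<zeta>)))\<^sup>2)"
      unfolding residual_def
    proof (rule projected_steps_residual_sum[OF gderiv \<Phi>_Lipschitz L \<rho> \<eta>])
      show "iter k \<zeta> \<in> A" for k by (rule iter_in)
      show "iter (Suc k) \<zeta> \<in> proj_set A (iter k \<zeta> - \<eta> *\<^sub>R batch k \<zeta>)" if "k \<in> {1..K}" for k
        using that by (simp add: iter_Suc \<pi>)
      show "\<phi> (iter 1 \<zeta>) - \<phi> (iter (Suc K) \<zeta>) \<le> \<Delta>"
        unfolding iter_1 by (rule \<Delta>[OF iter_in])
    qed
    then have "ennreal (\<Sum>k=1..K. (norm (residual k \<zeta>))\<^sup>2) \<le> ennreal (descent_const \<rho> * L * \<Delta> +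
        (descent_const \<rho> + 2) * (\<Sum>k=1..K. (norm (batch k \<zeta> - \<Phi> (iter k \<zeta>)))\<^sup>2))"
      by (rule ennreal_leI)
    also have "\<dots> = ennreal (descent_const \<rho> * L * \<Delta>) +
        ennreal (descent_const \<rho> + 2) * ennreal (\<Sum>k=1..K. (norm (batch k \<zeta> - \<Phi> (iter k \<zeta>)))\<^sup>2)"
      using c L \<Delta>0 by (simp add: ennreal_plus ennreal_mult sum_nonneg del: ennreal_eq_0_iff)
    finally show ?thesis by (simp add: sum_ennreal)
  qed
  have "(\<integral>\<^sup>+\<zeta>. (\<Sum>k=1..K. ennreal ((norm (residual k \<zeta>))\<^sup>2)) \<partial>samples) \<le>
    (\<integral>\<^sup>+\<zeta>. ennreal (descent_const \<rho> * L * \<Delta>) +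
      ennreal (descent_const \<rho> + 2) * (\<Sum>k=1..K. ennreal ((norm (batch k \<zeta> - \<Phi> (iter k \<zeta>)))\<^sup>2)) \<partial>samples)"
    by (rule nn_integral_mono) (rule pt)
  also have "\<dots> = ennreal (descent_const \<rho> * L * \<Delta>) + ennreal (descent_const \<rho> + 2) *
      (\<Sum>k=1..K. \<integral>\<^sup>+\<zeta>. ennreal ((norm (batch k \<zeta> - \<Phi> (iter k \<zeta>)))\<^sup>2) \<partial>samples)"
  proof -
    have "(\<lambda>\<zeta>. \<Sum>k=1..K. ennreal ((norm (batch k \<zeta> - \<Phi> (iter k \<zeta>)))\<^sup>2)) \<in> borel_measurable samples"
      by (rule borel_measurable_sum) (rule err_meas)
    moreover have "(\<integral>\<^sup>+\<zeta>. (\<Sum>k=1..K. ennreal ((norm (batch k \<zeta> - \<Phi> (iter k \<zeta>)))\<^sup>2)) \<partial>samples) =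
        (\<Sum>k=1..K. \<integral>\<^sup>+\<zeta>. ennreal ((norm (batch k \<zeta> - \<Phi> (iter k \<zeta>)))\<^sup>2) \<partial>samples)"
      by (rule nn_integral_sum) (rule err_meas)
    ultimately show ?thesis
      by (simp only: nn_integral_add nn_integral_cmult borel_measurable_const
          borel_measurable_times_ennreal nn_integral_const PS.emeasure_space_1 mult_1_right)
  qed
  also have "\<dots> \<le> ennreal (descent_const \<rho> * L * \<Delta>) + ennreal (descent_const \<rho> + 2) * (\<Sum>k=1..K. ennreal (V / real B))"
    by (intro add_mono mult_left_mono sum_mono batch_error) auto
  also have "\<dots> = ennreal (descent_const \<rho> * L * \<Delta> + (descent_const \<rho> + 2) * (real K * (V / real B)))"
  proof -
    have "(\<Sum>k=1..K. ennreal (V / real B)) = ennreal (real K * (V / real B))"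
      using V by (subst sum_ennreal) auto
    moreover have "0 \<le> descent_const \<rho> * L * \<Delta>" "0 \<le> real K * (V / real B)"
      using c L \<Delta>0 V by auto
    ultimately show ?thesis
      using c by (simp only: ennreal_mult[symmetric] ennreal_plus[symmetric] add_nonneg_nonneg mult_nonneg_nonneg
          zero_le_numeral)
  qed
  finally show ?thesis .
qed

text \<open>The normal at iterate \<open>r\<close> comes from step \<open>r - 1\<close>. The value 0
  for other indices makes this a measurable function on the whole sampling space.\<close>

definition output_residual_sq :: "nat \<times> (nat \<times> nat \<Rightarrow> 'v \<times> 'x) \<Rightarrow> real" where
  "output_residual_sq = (\<lambda>(r, \<zeta>). if r \<in> {2..K+1} then (norm (residual (r - 1) \<zeta>))\<^sup>2 else 0)"

lemma output_residual_sq_measurable: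
  "output_residual_sq \<in> borel_measurable (measure_pmf (pmf_of_set {2..K+1}) \<Otimes>\<^sub>M samples)"
proof -
  have "output_residual_sq \<in> borel_measurable (count_space UNIV \<Otimes>\<^sub>M samples)"
  proof (rule measurable_pair_measure_countable1)
    fix r :: nat
    show "(\<lambda>\<zeta>. output_residual_sq (r, \<zeta>)) \<in> borel_measurable samples"
    proof (cases "r \<in> {2..K+1}")
      case True
      then have "r - 1 \<in> {1..K}" by auto
      then have [measurable]: "residual (r - 1) \<in> borel_measurable samples"
        by (rule residual_measurable)
      have "(\<lambda>\<zeta>. (norm (residual (r - 1) \<zeta>))\<^sup>2) \<in> borel_measurable samples"
        by measurable
      then show ?thesis unfolding output_residual_sq_def using True by (simp only: prod.case if_True)
    next
      case False
      then show ?thesis unfolding output_residual_sq_def by (simp only: prod.case if_False) measurable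
    qed
  qed simp
  then show ?thesis
    by (subst measurable_cong_sets[OF sets_pair_measure_cong[OF sets_measure_pmf_count_space refl] refl])
qed

text \<open>A uniform output index turns the sum over all steps into its average. This is the reason
  for the randomised output: no single iterate is controlled by the telescoped descent.\<close>

lemma output_residual_expectation:
  "(\<integral>\<^sup>+y. ennreal (output_residual_sq y) \<partial>(measure_pmf (pmf_of_set {2..K+1}) \<Otimes>\<^sub>M samples)) \<le>
     ennreal (descent_const \<rho> * (L * \<Delta> / real K) + (descent_const \<rho> + 2) * (V / real B))"
proof -
  interpret \<mu>: prob_space \<mu> by (rule \<mu>)
  interpret PS: prob_space samples by (intro prob_space_PiM) (rule \<mu>)
  note [measurable] = output_residual_sq_measurable
  define S where "S = descent_const \<rho> * L * \<Delta> + (descent_const \<rho> + 2) * (real K * (V / real B))"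
  have "(\<integral>\<^sup>+y. ennreal (output_residual_sq y) \<partial>(measure_pmf (pmf_of_set {2..K+1}) \<Otimes>\<^sub>M samples)) =
      (\<integral>\<^sup>+r. (\<integral>\<^sup>+\<zeta>. ennreal (output_residual_sq (r, \<zeta>)) \<partial>samples) \<partial>measure_pmf (pmf_of_set {2..K+1}))"
    by (rule PS.nn_integral_fst[symmetric]) measurable
  also have "\<dots> = (\<Sum>r\<in>{2..K+1}. \<integral>\<^sup>+\<zeta>. ennreal (output_residual_sq (r, \<zeta>)) \<partial>samples) / ennreal (real K)"
    using K by (subst nn_integral_pmf_of_set) (auto simp: ennreal_of_nat_eq_real_of_nat)
  also have "(\<Sum>r\<in>{2..K+1}. \<integral>\<^sup>+\<zeta>. ennreal (output_residual_sq (r, \<zeta>)) \<partial>samples) =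
      (\<Sum>k=1..K. \<integral>\<^sup>+\<zeta>. ennreal ((norm (residual k \<zeta>))\<^sup>2) \<partial>samples)"
    by (rule sum.reindex_bij_witness[where i = Suc and j = "\<lambda>r. r - 1"])
       (auto simp: output_residual_sq_def)
  also have "\<dots> = (\<integral>\<^sup>+\<zeta>. (\<Sum>k=1..K. ennreal ((norm (residual k \<zeta>))\<^sup>2)) \<partial>samples)"
  proof (rule nn_integral_sum[symmetric])
    fix k assume "k \<in> {1..K}"
    then have [measurable]: "residual k \<in> borel_measurable samples" by (rule residual_measurable)
    show "(\<lambda>\<zeta>. ennreal ((norm (residual k \<zeta>))\<^sup>2)) \<in> borel_measurable samples" by measurable
  qed
  also have "\<dots> / ennreal (real K) \<le> ennreal S / ennreal (real K)"
    unfolding S_def by (intro divide_right_mono_ennreal residual_sum_expectation)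
  also have "\<dots> = ennreal (S / real K)"
  proof (rule divide_ennreal)
    have "0 \<le> \<Delta>" using \<Delta>[OF w1] by simp
    then show "0 \<le> S" using descent_const_nonneg[OF \<rho>] L V unfolding S_def by simp
  qed (use K in simp)
  also have "S / real K = descent_const \<rho> * (L * \<Delta> / real K) + (descent_const \<rho> + 2) * (V / real B)"
    using K by (simp add: S_def add_divide_distrib)
  finally show ?thesis .
qed

end

section \<open>Gradient estimators of a Lipschitz loss\<close>

lemma borel_measurable_vec_nth[measurable (raw)]:
  fixes f :: "'a \<Rightarrow> real ^ 'd::finite"
  assumes "f \<in> borel_measurable M"
  shows "(\<lambda>x. f x $ i) \<in> borel_measurable M"
  using assms borel_measurable_nth by (rule measurable_compose)

text \<open>Phrased with a sequence of step lengths so that it fits dominated convergence.\<close>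

lemma GDERIV_directional_sequence:
  assumes D: "GDERIV \<phi> y :> D"
  shows "(\<lambda>n. (\<phi> (y + (1 / real (Suc n)) *\<^sub>R v) - \<phi> y) / (1 / real (Suc n))) \<longlonglongrightarrow> D \<bullet> v"
proof -
  have "((\<lambda>t. \<phi> (y + t *\<^sub>R v)) has_derivative (\<lambda>h. (h *\<^sub>R v) \<bullet> D)) (at 0)"
    by (rule has_derivative_compose[where f = "\<lambda>t. y + t *\<^sub>R v" and g = \<phi>, simplified])
       (use D in \<open>auto intro!: derivative_eq_intros simp: gderiv_def\<close>)
  then have "((\<lambda>t. \<phi> (y + t *\<^sub>R v)) has_real_derivative v \<bullet> D) (at 0)"
    by (simp add: has_field_derivative_def mult_commute_abs)
  then have "((\<lambda>t. (\<phi> (y + t *\<^sub>R v) - \<phi> y) / t) \<longlongrightarrow> v \<bullet> D) (at 0)"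
    by (simp add: has_field_derivative_iff)
  moreover have "filterlim (\<lambda>n. 1 / real (Suc n)) (at 0) sequentially"
    unfolding filterlim_at using LIMSEQ_Suc[OF lim_1_over_n] by simp
  ultimately have "(\<lambda>n. (\<phi> (y + (1 / real (Suc n)) *\<^sub>R v) - \<phi> y) / (1 / real (Suc n))) \<longlonglongrightarrow> v \<bullet> D"
    by (rule filterlim_compose)
  then show ?thesis by (simp only: inner_commute)
qed

text \<open>The difference quotients in the direction of the gradient \<open>D\<close> itself bound
  \<open>D \<bullet> D\<close> by \<open>l * norm D\<close>.\<close>

lemma norm_gradient_le_Lipschitz:
  assumes D: "GDERIV \<phi> y :> D" and lip: "\<And>w w'. \<bar>\<phi> w - \<phi> w'\<bar> \<le> l * norm (w - w')" and l: "0 \<le> l"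
  shows "norm D \<le> l"
proof (cases "D = 0")
  case False
  have "D \<bullet> D \<le> l * norm D"
  proof (rule LIMSEQ_le_const2[OF GDERIV_directional_sequence[OF D, of D]], intro exI allI impI)
    fix n :: nat
    define t where "t = 1 / real (Suc n)"
    have t: "0 < t" by (simp add: t_def)
    have "\<phi> (y + t *\<^sub>R D) - \<phi> y \<le> l * norm (t *\<^sub>R D)"
      using lip[of "y + t *\<^sub>R D" y] by simp
    then show "(\<phi> (y + (1 / real (Suc n)) *\<^sub>R D) - \<phi> y) / (1 / real (Suc n)) \<le> l * norm D"
      unfolding t_def[symmetric] using t by (simp add: field_simps)
  qed
  then have "norm D * norm D \<le> l * norm D"
    by (simp add: power2_norm_eq_inner[symmetric] power2_eq_square)
  then show ?thesis using False by simp
qed (use l in simp)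

lemma (in prob_space) distr_snd_pair:
  assumes "sigma_finite_measure N"
  shows "distr (M \<Otimes>\<^sub>M N) N snd = N"
proof (rule measure_eqI)
  interpret N: sigma_finite_measure N by fact
  fix X assume X: "X \<in> sets (distr (M \<Otimes>\<^sub>M N) N snd)"
  then have "snd -` X \<inter> space (M \<Otimes>\<^sub>M N) = space M \<times> X"
    using sets.sets_into_space by (auto simp: space_pair_measure)
  then show "emeasure (distr (M \<Otimes>\<^sub>M N) N snd) X = emeasure N X"
    using X by (simp add: emeasure_distr N.emeasure_pair_measure_Times emeasure_space_1)
qed simp

lemma measurable_coord_update:
  fixes h k :: "'a \<Rightarrow> real ^ 'd::finite"
  assumes [measurable]: "h \<in> borel_measurable M" "k \<in> borel_measurable M"
  shows "(\<lambda>y. \<chi> j. if j = i then h y $ i + c else h y $ j + k y $ j) \<in> borel_measurable M"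
  by (rule borel_measurable_vecI) (simp, measurable)

lemma integral_vec_eqI:
  fixes g :: "'a \<Rightarrow> real ^ 'd::finite"
  assumes "integrable M g" "\<And>i. (\<integral>z. g z $ i \<partial>M) = m $ i"
  shows "(\<integral>z. g z \<partial>M) = m"
  using integral_bounded_linear[OF bounded_linear_vec_nth assms(1)] assms(2) by (simp add: vec_eq_iff)

locale stochastic_loss =
  fixes P :: "(real ^ 'p::finite) measure" and F :: "real ^ 'd::finite \<Rightarrow> real ^ 'p \<Rightarrow> real"
    and Lip :: "real ^ 'p \<Rightarrow> real" and f :: "real ^ 'd \<Rightarrow> real" and L0 Q :: real
  assumes P: "prob_space P" and sets_P: "sets P = sets borel"
    and F_meas: "(\<lambda>(w, x). F w x) \<in> borel_measurable borel"
    and F_int: "\<And>w. integrable P (F w)"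
    and Lip_meas: "Lip \<in> borel_measurable borel"
    and F_Lip: "AE x in P. \<forall>w w'. \<bar>F w x - F w' x\<bar> \<le> Lip x * norm (w - w')"
    and Lip_sq: "integrable P (\<lambda>x. (Lip x)\<^sup>2)" and Q: "Q = (\<integral>x. (Lip x)\<^sup>2 \<partial>P)"
    and L0: "L0 = (\<integral>x. Lip x \<partial>P)" "0 < L0"
    and f: "f = expected_loss P F"
begin

sublocale data: prob_space P by (rule P)

text \<open>The Bochner integral of a nonintegrable function is 0 by convention, while
  \<open>L0\<close> is positive.\<close>

lemma Lip_integrable: "integrable P Lip"
  using L0 not_integrable_integral_eq by fastforce

lemma Lip_nonneg: "AE x in P. 0 \<le> Lip x"
  using F_Lip
proof eventually_elim
  case (elim x)
  then have "\<bar>F (axis undefined 1) x - F 0 x\<bar> \<le> Lip x * norm (axis undefined 1 - 0 :: real ^ 'd)" by blast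
  then show ?case by simp
qed

lemma f_Lipschitz: "\<bar>f w - f w'\<bar> \<le> L0 * norm (w - w')"
proof -
  have "\<bar>f w - f w'\<bar> = \<bar>\<integral>x. F w x - F w' x \<partial>P\<bar>"
    by (simp add: f expected_loss_def F_int)
  also have "\<dots> \<le> (\<integral>x. \<bar>F w x - F w' x\<bar> \<partial>P)" by (rule integral_abs_bound)
  also have "\<dots> \<le> (\<integral>x. Lip x * norm (w - w') \<partial>P)"
    using F_Lip by (intro integral_mono_AE) (auto simp: F_int Lip_integrable elim: eventually_mono)
  finally show ?thesis by (simp add: L0)
qed

text \<open>Guarantees a positive batch size. If \<open>Q\<close> were 0, then \<open>Lip\<close>
  would vanish almost everywhere and \<open>L0\<close> would be 0.\<close>

lemma Q_pos: "0 < Q"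
proof -
  have "0 \<le> Q" unfolding Q by simp
  moreover have "Q \<noteq> 0"
  proof
    assume "Q = 0"
    then have "AE x in P. (Lip x)\<^sup>2 = 0"
      unfolding Q using integral_nonneg_eq_0_iff_AE[OF Lip_sq] by simp
    then have "(\<integral>x. Lip x \<partial>P) = (\<integral>x. 0 \<partial>P)"
      by (intro integral_cong_AE) (use Lip_integrable in auto)
    then show False using L0 by simp
  qed
  ultimately show ?thesis by simp
qed

declare sets_P[measurable_cong] Lip_meas[measurable]

lemma measurable_case_prod_borel:
  fixes H :: "real ^ 'd \<Rightarrow> real ^ 'p \<Rightarrow> 'b::topological_space"
  assumes "(\<lambda>(w, x). H w x) \<in> borel_measurable borel"
    and "h \<in> borel_measurable M" "z \<in> borel_measurable M"
  shows "(\<lambda>y. H (h y) (z y)) \<in> borel_measurable M"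
  using measurable_compose[OF measurable_Pair[OF assms(2,3)], unfolded borel_prod, OF assms(1)] by simp

lemmas F_measurable[measurable (raw)] = measurable_case_prod_borel[OF F_meas]

section \<open>Both estimators under the joint law of perturbation and data\<close>

context
  fixes \<alpha> :: real
  assumes \<alpha>: "0 < \<alpha>"
begin

abbreviation "\<mu> \<equiv> (smoothing_law \<alpha> :: (real ^ 'd) measure) \<Otimes>\<^sub>M P"

lemma prob_space_\<mu>: "prob_space \<mu>"
proof -
  interpret U: prob_space "smoothing_law \<alpha> :: (real ^ 'd) measure" by (rule prob_space_smoothing_law[OF \<alpha>])
  interpret UP: pair_prob_space "smoothing_law \<alpha> :: (real ^ 'd) measure" P ..
  show ?thesis by (rule UP.prob_space_axioms)
qed

lemma distr_\<mu>_snd: "distr \<mu> P snd = P"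
  by (rule prob_space.distr_snd_pair[OF prob_space_smoothing_law[OF \<alpha>]]) (rule data.sigma_finite_measure_axioms)

lemma AE_\<mu>_snd: "AE x in P. R x \<Longrightarrow> AE z in \<mu>. R (snd z)"
  by (rule AE_distrD[OF measurable_snd]) (simp only: distr_\<mu>_snd)

lemma Lip_integrable_\<mu>: "integrable \<mu> (\<lambda>z. Lip (snd z))"
  using integrable_distr[of snd \<mu> P Lip] Lip_integrable by (simp add: distr_\<mu>_snd)

text \<open>The constant sits under a root because it becomes \<upsilon>: componentwise bounds give
  sqrt d \<open>Lip\<close> for finite differences, and gradients are bounded by \<open>Lip\<close>
  itself.\<close>

lemma second_moment_bound:
  fixes g :: "(real ^ 'd) \<times> (real ^ 'p) \<Rightarrow> real ^ 'd"
  assumes g: "AE z in \<mu>. norm (g z) \<le> sqrt c * Lip (snd z)" and c: "0 \<le> c"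
  shows "(\<integral>\<^sup>+z. ennreal ((norm (g z))\<^sup>2) \<partial>\<mu>) \<le> ennreal (c * Q)"
proof -
  have "(\<integral>\<^sup>+z. ennreal ((norm (g z))\<^sup>2) \<partial>\<mu>) \<le> (\<integral>\<^sup>+z. ennreal (c * (Lip (snd z))\<^sup>2) \<partial>\<mu>)"
  proof (rule nn_integral_mono_AE)
    show "AE z in \<mu>. ennreal ((norm (g z))\<^sup>2) \<le> ennreal (c * (Lip (snd z))\<^sup>2)"
      using g
    proof eventually_elim
      case (elim z)
      then have "(norm (g z))\<^sup>2 \<le> (sqrt c * Lip (snd z))\<^sup>2" by (intro power_mono) auto
      with c show ?case by (intro ennreal_leI) (simp add: power_mult_distrib)
    qed
  qed
  also have "\<dots> = (\<integral>\<^sup>+x. ennreal (c * (Lip x)\<^sup>2) \<partial>distr \<mu> P snd)"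
    by (subst nn_integral_distr) auto
  also have "\<dots> = ennreal (c * Q)"
    unfolding distr_\<mu>_snd using nn_integral_eq_integral[of P "\<lambda>x. c * (Lip x)\<^sup>2"] Lip_sq c
    by (simp add: Q)
  finally show ?thesis .
qed

lemma integrable_difference:
  assumes a: "a \<in> borel_measurable borel" and b: "b \<in> borel_measurable borel"
    and ab: "\<And>u. norm (a u - b u) \<le> c"
  shows "integrable \<mu> (\<lambda>z. F (a (fst z)) (snd z) - F (b (fst z)) (snd z))"
proof (rule Bochner_Integration.integrable_bound)
  note [measurable] = a b
  show "integrable \<mu> (\<lambda>z. c * Lip (snd z))" using Lip_integrable_\<mu> by simp
  show "(\<lambda>z. F (a (fst z)) (snd z) - F (b (fst z)) (snd z)) \<in> borel_measurable \<mu>" by measurable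
  show "AE z in \<mu>. norm (F (a (fst z)) (snd z) - F (b (fst z)) (snd z)) \<le> norm (c * Lip (snd z))"
    using AE_\<mu>_snd[OF F_Lip] AE_\<mu>_snd[OF Lip_nonneg]
  proof eventually_elim
    case (elim z)
    have "norm (F (a (fst z)) (snd z) - F (b (fst z)) (snd z)) \<le> Lip (snd z) * norm (a (fst z) - b (fst z))"
      using elim(1) by simp
    also have "\<dots> \<le> Lip (snd z) * c" using elim(2) ab by (intro mult_left_mono) auto
    finally show ?case by (simp add: mult.commute)
  qed
qed

lemma integral_difference:
  assumes a: "a \<in> borel_measurable borel" and b: "b \<in> borel_measurable borel"
    and ab: "\<And>u. norm (a u - b u) \<le> c"
  shows "(\<integral>z. F (a (fst z)) (snd z) - F (b (fst z)) (snd z) \<partial>\<mu>) = (\<integral>u. f (a u) - f (b u) \<partial>smoothing_law \<alpha>)"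
proof -
  interpret U: prob_space "smoothing_law \<alpha> :: (real ^ 'd) measure" by (rule prob_space_smoothing_law[OF \<alpha>])
  interpret UP: pair_prob_space "smoothing_law \<alpha> :: (real ^ 'd) measure" P ..
  have "(\<integral>u. \<integral>x. F (a u) x - F (b u) x \<partial>P \<partial>smoothing_law \<alpha>) =
      (\<integral>z. (\<lambda>(u, x). F (a u) x - F (b u) x) z \<partial>\<mu>)"
    by (rule UP.integral_fst) (use integrable_difference[OF assms] in \<open>simp add: case_prod_beta'\<close>)
  then show ?thesis by (simp add: f expected_loss_def F_int case_prod_beta')
qed

lemma finite_diff_measurable:
  "(\<lambda>(w, z). (1 / \<alpha>) *\<^sub>R finite_diff \<alpha> F w (fst z) (snd z)) \<in> borel_measurable (borel \<Otimes>\<^sub>M \<mu>)"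
proof (rule borel_measurable_vecI)
  fix i
  define a where "a c y = (\<chi> j. if j = i then fst y $ i + c else fst y $ j + fst (snd y) $ j)"
    for c and y :: "(real ^ 'd) \<times> (real ^ 'd) \<times> (real ^ 'p)"
  have [measurable]: "a c \<in> borel_measurable (borel \<Otimes>\<^sub>M \<mu>)" for c
    unfolding a_def by (rule measurable_coord_update) measurable
  have "(\<lambda>y. (F (a (\<alpha> / 2) y) (snd (snd y)) - F (a (- (\<alpha> / 2)) y) (snd (snd y))) / \<alpha>) \<in> borel_measurable (borel \<Otimes>\<^sub>M \<mu>)"
    by measurable
  then show "(\<lambda>y. (case y of (w, z) \<Rightarrow> (1 / \<alpha>) *\<^sub>R finite_diff \<alpha> F w (fst z) (snd z)) $ i) \<in> borel_measurable (borel \<Otimes>\<^sub>M \<mu>)"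
    by (simp add: finite_diff_def a_def case_prod_beta' cong: if_cong)
qed

lemma finite_diff_norm_bound:
  "AE z in \<mu>. norm ((1 / \<alpha>) *\<^sub>R finite_diff \<alpha> F w (fst z) (snd z)) \<le> sqrt (real CARD('d)) * Lip (snd z)"
  using AE_\<mu>_snd[OF F_Lip]
proof eventually_elim
  case (elim z)
  show ?case
  proof (rule norm_vec_le_componentwise)
    fix i
    have "\<bar>finite_diff \<alpha> (\<lambda>v (_ :: unit). F v (snd z)) w (fst z) () $ i\<bar> \<le> Lip (snd z) * \<alpha>"
      using elim by (intro finite_diff_Lipschitz[OF \<alpha>]) auto
    then show "\<bar>((1 / \<alpha>) *\<^sub>R finite_diff \<alpha> F w (fst z) (snd z)) $ i\<bar> \<le> Lip (snd z)"
      using \<alpha> by (simp add: finite_diff_def abs_mult field_simps)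
  qed
qed

lemma integrable_Lip_bound:
  fixes g :: "(real ^ 'd) \<times> (real ^ 'p) \<Rightarrow> 'b::{banach, second_countable_topology}"
  assumes "g \<in> borel_measurable \<mu>" "AE z in \<mu>. norm (g z) \<le> c * Lip (snd z)"
  shows "integrable \<mu> g"
proof (rule Bochner_Integration.integrable_bound[OF _ assms(1)])
  show "integrable \<mu> (\<lambda>z. c * Lip (snd z))" using Lip_integrable_\<mu> by simp
  show "AE z in \<mu>. norm (g z) \<le> norm (c * Lip (snd z))"
    using assms(2) by eventually_elim simp
qed

lemma finite_diff_mean:
  "(\<integral>z. (1 / \<alpha>) *\<^sub>R finite_diff \<alpha> F w (fst z) (snd z) \<partial>\<mu>) = smoothed_gradient \<alpha> f w"
proof (rule integral_vec_eqI)
  have "(\<lambda>z. (w, z)) \<in> measurable \<mu> (borel \<Otimes>\<^sub>M \<mu>)" by simp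
  from measurable_compose[OF this finite_diff_measurable]
  show "integrable \<mu> (\<lambda>z. (1 / \<alpha>) *\<^sub>R finite_diff \<alpha> F w (fst z) (snd z))"
    by (intro integrable_Lip_bound[OF _ finite_diff_norm_bound]) simp
  fix i
  define a where "a s u = (\<chi> j. if j = i then w $ i + s else w $ j + u $ j)" for s u
  have [measurable]: "a s \<in> borel_measurable borel" for s
    unfolding a_def by (rule measurable_coord_update) auto
  have "a (\<alpha> / 2) u - a (- (\<alpha> / 2)) u = axis i \<alpha>" for u
    by (auto simp: a_def vec_eq_iff axis_def)
  then have ab: "norm (a (\<alpha> / 2) u - a (- (\<alpha> / 2)) u) \<le> \<alpha>" for u
    using \<alpha> by (simp add: norm_axis_real)
  have "(\<integral>z. ((1 / \<alpha>) *\<^sub>R finite_diff \<alpha> F w (fst z) (snd z)) $ i \<partial>\<mu>) =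
      (\<integral>z. F (a (\<alpha> / 2) (fst z)) (snd z) - F (a (- (\<alpha> / 2)) (fst z)) (snd z) \<partial>\<mu>) / \<alpha>"
    by (simp add: finite_diff_def a_def cong: if_cong)
  also have "\<dots> = (\<integral>u. f (a (\<alpha> / 2) u) - f (a (- (\<alpha> / 2)) u) \<partial>smoothing_law \<alpha>) / \<alpha>"
    by (subst integral_difference[OF _ _ ab]) auto
  also have "\<dots> = smoothed_gradient \<alpha> f w $ i"
    by (simp add: smoothed_gradient_def finite_diff_def a_def cong: if_cong)
  finally show "(\<integral>z. ((1 / \<alpha>) *\<^sub>R finite_diff \<alpha> F w (fst z) (snd z)) $ i \<partial>\<mu>) = smoothed_gradient \<alpha> f w $ i" .
qed

context
  fixes G :: "real ^ 'd \<Rightarrow> real ^ 'p \<Rightarrow> real ^ 'd"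
  assumes G_meas: "(\<lambda>(w, x). G w x) \<in> borel_measurable borel"
begin

lemmas G_measurable[measurable (raw)] = measurable_case_prod_borel[OF G_meas]

lemma gradient_estimate_measurable:
  "(\<lambda>(w, z). G (w + fst z) (snd z)) \<in> borel_measurable (borel \<Otimes>\<^sub>M \<mu>)"
  by measurable

lemma gradient_estimate_norm_bound:
  assumes "AE z in \<mu>. GDERIV (\<lambda>v. F v (snd z)) (w + fst z) :> G (w + fst z) (snd z)"
  shows "AE z in \<mu>. norm (G (w + fst z) (snd z)) \<le> Lip (snd z)"
  using assms AE_\<mu>_snd[OF F_Lip] AE_\<mu>_snd[OF Lip_nonneg]
  by eventually_elim (rule norm_gradient_le_Lipschitz, auto)

text \<open>The means of the difference quotients of the loss are difference quotients of the
  smoothed \<open>f\<close>. The former converge to the mean of the estimator, dominated by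
  \<open>Lip\<close>, and the latter to the partial derivative of the smoothed
  \<open>f\<close>.\<close>

lemma gradient_estimate_mean:
  assumes D: "AE z in \<mu>. GDERIV (\<lambda>v. F v (snd z)) (w + fst z) :> G (w + fst z) (snd z)"
  shows "(\<integral>z. G (w + fst z) (snd z) \<partial>\<mu>) = smoothed_gradient \<alpha> f w"
proof (rule integral_vec_eqI)
  have [measurable]: "(\<lambda>z. G (w + fst z) (snd z)) \<in> borel_measurable \<mu>" by measurable
  show "integrable \<mu> (\<lambda>z. G (w + fst z) (snd z))"
    using gradient_estimate_norm_bound[OF D] by (intro integrable_Lip_bound[where c = 1]) auto
  fix i
  define t where "t n = 1 / real (Suc n)" for n
  have t: "0 < t n" for n by (simp add: t_def)
  define e where "e = (axis i 1 :: real ^ 'd)"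
  define q where "q n z = (F (w + fst z + t n *\<^sub>R e) (snd z) - F (w + fst z) (snd z)) / t n" for n z
  have "(\<lambda>n. \<integral>z. q n z \<partial>\<mu>) \<longlonglongrightarrow> (\<integral>z. G (w + fst z) (snd z) $ i \<partial>\<mu>)"
  proof (rule integral_dominated_convergence[where w = "\<lambda>z. Lip (snd z)"])
    show "(\<lambda>z. G (w + fst z) (snd z) $ i) \<in> borel_measurable \<mu>" by measurable
    show "q n \<in> borel_measurable \<mu>" for n unfolding q_def by measurable
    show "integrable \<mu> (\<lambda>z. Lip (snd z))" by (rule Lip_integrable_\<mu>)
    show "AE z in \<mu>. (\<lambda>n. q n z) \<longlonglongrightarrow> G (w + fst z) (snd z) $ i"
      using D
    proof eventually_elim
      case (elim z)
      from GDERIV_directional_sequence[OF elim, of e] show ?case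
        by (simp only: q_def t_def e_def inner_axis inner_real_def mult_1_right)
    qed
    show "AE z in \<mu>. norm (q n z) \<le> Lip (snd z)" for n
      using AE_\<mu>_snd[OF F_Lip]
    proof eventually_elim
      case (elim z)
      then have "\<bar>F (w + fst z + t n *\<^sub>R e) (snd z) - F (w + fst z) (snd z)\<bar> \<le>
          Lip (snd z) * norm ((w + fst z + t n *\<^sub>R e) - (w + fst z))" by blast
      then show ?case using t[of n] by (simp add: q_def e_def abs_divide field_simps)
    qed
  qed
  moreover have "(\<integral>z. q n z \<partial>\<mu>) = (smoothed \<alpha> f (w + t n *\<^sub>R e) - smoothed \<alpha> f w) / t n" for n
  proof -
    have "(\<integral>z. q n z \<partial>\<mu>) = (\<integral>z. F (w + fst z + t n *\<^sub>R e) (snd z) - F (w + fst z) (snd z) \<partial>\<mu>) / t n"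
      by (simp add: q_def)
    also have "\<dots> = (\<integral>u. f (w + u + t n *\<^sub>R e) - f (w + u) \<partial>smoothing_law \<alpha>) / t n"
      by (subst integral_difference[where a = "\<lambda>u. w + u + t n *\<^sub>R e" and b = "\<lambda>u. w + u" and c = "norm (t n *\<^sub>R e)"]) auto
    also have "(\<integral>u. f (w + u + t n *\<^sub>R e) - f (w + u) \<partial>smoothing_law \<alpha>) = smoothed \<alpha> f (w + t n *\<^sub>R e) - smoothed \<alpha> f w"
      unfolding smoothed_def
      using integrable_smoothing_shift[OF \<alpha> f_Lipschitz, of "w + t n *\<^sub>R e"] integrable_smoothing_shift[OF \<alpha> f_Lipschitz, of w]
      by (simp add: add.assoc add.commute[of "t n *\<^sub>R e"])
    finally show ?thesis .
  qed
  moreover have "(\<lambda>n. (smoothed \<alpha> f (w + t n *\<^sub>R e) - smoothed \<alpha> f w) / t n) \<longlonglongrightarrow> smoothed_gradient \<alpha> f w $ i"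
    using GDERIV_directional_sequence[OF smoothed_GDERIV[OF \<alpha> f_Lipschitz], of w e]
    by (simp only: t_def e_def inner_axis inner_real_def mult_1_right)
  ultimately show "(\<integral>z. G (w + fst z) (snd z) $ i \<partial>\<mu>) = smoothed_gradient \<alpha> f w $ i"
    using LIMSEQ_unique by simp blast
qed

end

end

end

section \<open>Passage to the limit\<close>

text \<open>The filter pushes both \<open>y\<close> and \<open>y + t *\<^sub>R v\<close> into any
  neighbourhood of \<open>w\<close>. This locality later allows the return from the extended
  objective to the original one.\<close>

lemma clarke_derivative_cong:
  assumes "open U" "w \<in> U" "\<And>x. x \<in> U \<Longrightarrow> f x = f' x"
  shows "clarke_derivative f w v = clarke_derivative f' w v"
  unfolding clarke_derivative_def
proof (rule Limsup_eq)
  let ?F = "nhds w \<times>\<^sub>F at_right (0::real)"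
  have fst: "(fst \<longlongrightarrow> w) ?F"
    by (rule filterlim_fst)
  have snd: "(snd \<longlongrightarrow> 0) ?F"
    by (rule filterlim_mono[OF filterlim_snd _ order_refl]) (auto simp: at_within_def)
  have "((\<lambda>p. fst p + snd p *\<^sub>R v) \<longlongrightarrow> w + 0 *\<^sub>R v) ?F"
    by (intro tendsto_intros fst snd)
  then have "\<forall>\<^sub>F p in ?F. fst p + snd p *\<^sub>R v \<in> U"
    using assms by (intro topological_tendstoD[where S = U]) auto
  moreover have "\<forall>\<^sub>F p in ?F. fst p \<in> U"
    using assms by (intro topological_tendstoD[OF fst]) auto
  ultimately show "\<forall>\<^sub>F p in ?F. (case p of (y, t) \<Rightarrow> ereal ((f (y + t *\<^sub>R v) - f y) / t)) =
      (case p of (y, t) \<Rightarrow> ereal ((f' (y + t *\<^sub>R v) - f' y) / t))"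
    by eventually_elim (auto simp: assms(3))
qed

lemma cm_stationary_cong:
  assumes "open U" "w \<in> U" "\<And>x. x \<in> U \<Longrightarrow> f x = f' x"
  shows "cm_stationary f A w \<longleftrightarrow> cm_stationary f' A w"
proof -
  have "clarke_derivative f w = clarke_derivative f' w"
    by (rule ext) (rule clarke_derivative_cong[OF assms])
  then show ?thesis by (simp add: cm_stationary_def clarke_subdifferential_def)
qed

lemma norm_le_of_mem_cube:
  "u \<in> cube (ereal r) \<Longrightarrow> norm (u :: real ^ 'd::finite) \<le> sqrt (real CARD('d)) * r"
  by (rule norm_vec_le_componentwise) (auto simp: cube_def)

text \<open>A threshold \<open>M\<close> strictly above the Clarke derivative bounds the difference
  quotients of \<open>f\<close> for all base points near \<open>wbar\<close> and all small
  \<open>t\<close>. Averaging over the cube keeps the bound once the whole perturbed cube lies in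
  that neighbourhood. The range of \<open>t\<close> does not depend on \<open>j\<close>, so t can
  tend to 0 first and \<open>j\<close> to infinity afterwards.\<close>

lemma smoothed_gradient_limit_in_clarke_subdifferential:
  fixes f :: "real ^ 'd::finite \<Rightarrow> real"
  assumes \<alpha>: "\<And>j. 0 < \<alpha> j" "\<alpha> \<longlonglongrightarrow> 0"
    and lip: "\<And>w w'. \<bar>f w - f w'\<bar> \<le> l * norm (w - w')"
    and w: "w \<longlonglongrightarrow> wbar" and g: "(\<lambda>j. smoothed_gradient (\<alpha> j) f (w j)) \<longlonglongrightarrow> g"
  shows "g \<in> clarke_subdifferential f wbar"
  unfolding clarke_subdifferential_def
proof (intro CollectI allI, rule ccontr)
  fix v
  assume "\<not> ereal (g \<bullet> v) \<le> clarke_derivative f wbar v"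
  then obtain M where M: "clarke_derivative f wbar v < ereal M" "M < g \<bullet> v"
    using ereal_dense2[of "clarke_derivative f wbar v" "ereal (g \<bullet> v)"] by (auto simp: not_le)
  have "\<forall>\<^sub>F (y, t) in nhds wbar \<times>\<^sub>F at_right 0. (f (y + t *\<^sub>R v) - f y) / t < M"
    using Limsup_lessD[OF M(1)[unfolded clarke_derivative_def]]
    by eventually_elim auto
  then obtain P Q where P: "eventually P (nhds wbar)" and Q: "eventually Q (at_right (0::real))"
    and PQ: "\<And>y t. P y \<Longrightarrow> Q t \<Longrightarrow> (f (y + t *\<^sub>R v) - f y) / t < M"
    unfolding eventually_prod_filter by auto
  obtain \<delta> where \<delta>: "0 < \<delta>" "\<And>y. dist y wbar < \<delta> \<Longrightarrow> P y"
    using P unfolding eventually_nhds_metric by auto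
  \<comment> \<open>The second summand is the Euclidean radius of the smoothing cube.\<close>
  have "(\<lambda>j. dist (w j) wbar + sqrt (real CARD('d)) * (\<alpha> j / 2)) \<longlonglongrightarrow> dist wbar wbar + sqrt (real CARD('d)) * (0 / 2)"
    by (intro tendsto_intros w \<alpha>) simp
  then have "\<forall>\<^sub>F j in sequentially. dist (w j) wbar + sqrt (real CARD('d)) * (\<alpha> j / 2) < \<delta>"
    using \<delta>(1) by (intro order_tendstoD(2)[where a = \<delta>]) auto
  then have "\<forall>\<^sub>F j in sequentially. smoothed_gradient (\<alpha> j) f (w j) \<bullet> v \<le> M"
  proof eventually_elim
    case (elim j)
    interpret prob_space "smoothing_law (\<alpha> j) :: (real ^ 'd) measure"
      by (rule prob_space_smoothing_law[OF \<alpha>(1)])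
    note int = integrable_smoothing_shift[OF \<alpha>(1) lip]
    have le: "(smoothed (\<alpha> j) f (w j + t *\<^sub>R v) - smoothed (\<alpha> j) f (w j)) / t \<le> M" if t: "Q t" for t
    proof -
      have "(smoothed (\<alpha> j) f (w j + t *\<^sub>R v) - smoothed (\<alpha> j) f (w j)) / t =
          (\<integral>u. (f (w j + t *\<^sub>R v + u) - f (w j + u)) / t \<partial>smoothing_law (\<alpha> j))"
        unfolding smoothed_def by (simp add: int)
      also have "\<dots> \<le> (\<integral>u. M \<partial>(smoothing_law (\<alpha> j) :: (real ^ 'd) measure))"
      proof (rule integral_mono_AE)
        show "AE u in smoothing_law (\<alpha> j). (f (w j + t *\<^sub>R v + u) - f (w j + u)) / t \<le> M"
          using AE_smoothing_law_cube[of "\<alpha> j"]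
        proof eventually_elim
          case (elim u)
          have "dist (w j + u) wbar \<le> dist (w j) wbar + norm u"
            by (simp add: dist_norm) (metis add_diff_eq diff_add_eq norm_triangle_ineq)
          with norm_le_of_mem_cube[OF elim] \<open>dist (w j) wbar + _ < \<delta>\<close> have "P (w j + u)"
            by (intro \<delta>(2)) simp
          from PQ[OF this t] show ?case by (simp add: add.commute add.left_commute)
        qed
      qed (auto simp: int)
      finally show ?thesis by (simp add: prob_space[simplified])
    qed
    have "((\<lambda>t. smoothed (\<alpha> j) f (w j + t *\<^sub>R v)) has_derivative
        (\<lambda>h. (h *\<^sub>R v) \<bullet> smoothed_gradient (\<alpha> j) f (w j + 0 *\<^sub>R v))) (at 0)"
      by (rule has_derivative_compose[where f = "\<lambda>t. w j + t *\<^sub>R v" and g = "smoothed (\<alpha> j) f", simplified])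
         (use smoothed_GDERIV[OF \<alpha>(1) lip, of j "w j"] in \<open>auto intro!: derivative_eq_intros simp: gderiv_def\<close>)
    then have "((\<lambda>t. smoothed (\<alpha> j) f (w j + t *\<^sub>R v)) has_real_derivative v \<bullet> smoothed_gradient (\<alpha> j) f (w j)) (at 0)"
      by (simp add: has_field_derivative_def mult_commute_abs)
    then have "((\<lambda>t. (smoothed (\<alpha> j) f (w j + t *\<^sub>R v) - smoothed (\<alpha> j) f (w j)) / t) \<longlongrightarrow>
        v \<bullet> smoothed_gradient (\<alpha> j) f (w j)) (at 0)"
      by (simp add: has_field_derivative_iff)
    then have "((\<lambda>t. (smoothed (\<alpha> j) f (w j + t *\<^sub>R v) - smoothed (\<alpha> j) f (w j)) / t) \<longlongrightarrow>
        v \<bullet> smoothed_gradient (\<alpha> j) f (w j)) (at_right 0)"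
      by (rule tendsto_mono[rotated]) (auto intro: at_le)
    then have "v \<bullet> smoothed_gradient (\<alpha> j) f (w j) \<le> M"
      by (rule tendsto_upperbound) (use Q le in \<open>auto elim: eventually_mono\<close>)
    then show ?case by (simp add: inner_commute)
  qed
  moreover have "(\<lambda>j. smoothed_gradient (\<alpha> j) f (w j) \<bullet> v) \<longlonglongrightarrow> g \<bullet> v"
    by (intro tendsto_intros g)
  ultimately have "g \<bullet> v \<le> M"
    by (intro tendsto_upperbound) auto
  with M(2) show False by simp
qed

text \<open>The smoothed gradients are bounded by a constant free of \<alpha>, so a subsequence of
  them converges to some \<open>g\<close>. Along it the Frechet normals converge to
  \<open>- g\<close>, which is how Mordukhovich normals are defined.\<close>

lemma smoothed_stationarity_limit:
  fixes f :: "real ^ 'd::finite \<Rightarrow> real"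
  assumes \<alpha>: "\<And>j. 0 < \<alpha> j" "\<alpha> \<longlonglongrightarrow> 0"
    and lip: "\<And>w w'. \<bar>f w - f w'\<bar> \<le> l * norm (w - w')"
    and A: "closed A" "\<And>j. w j \<in> A"
    and w: "w \<longlonglongrightarrow> wbar"
    and normal: "\<forall>\<^sub>F j in sequentially. e j - smoothed_gradient (\<alpha> j) f (w j) \<in> frechet_normals (w j) A"
    and e: "e \<longlonglongrightarrow> 0"
  shows "cm_stationary f A wbar"
proof -
  have "bounded (range (\<lambda>j. smoothed_gradient (\<alpha> j) f (w j)))"
    unfolding bounded_iff using smoothed_gradient_bound[OF \<alpha>(1) lip] by blast
  then obtain g r where r: "strict_mono r" and g: "((\<lambda>j. smoothed_gradient (\<alpha> j) f (w j)) \<circ> r) \<longlonglongrightarrow> g"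
    using bounded_imp_convergent_subsequence by blast
  obtain N where N: "\<And>j. N \<le> j \<Longrightarrow> e j - smoothed_gradient (\<alpha> j) f (w j) \<in> frechet_normals (w j) A"
    using normal unfolding eventually_sequentially by blast
  have wr: "(\<lambda>j. w (r j)) \<longlonglongrightarrow> wbar" and \<alpha>r: "(\<lambda>j. \<alpha> (r j)) \<longlonglongrightarrow> 0" and er: "(\<lambda>j. e (r j)) \<longlonglongrightarrow> 0"
    using LIMSEQ_subseq_LIMSEQ[OF w r] LIMSEQ_subseq_LIMSEQ[OF \<alpha>(2) r] LIMSEQ_subseq_LIMSEQ[OF e r]
    by (simp_all add: comp_def)
  have gr: "(\<lambda>j. smoothed_gradient (\<alpha> (r j)) f (w (r j))) \<longlonglongrightarrow> g"
    using g by (simp add: comp_def)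
  have "wbar \<in> A"
    using closed_sequentially[OF A(1) _ w] A(2) by blast
  moreover have "g \<in> clarke_subdifferential f wbar"
    by (rule smoothed_gradient_limit_in_clarke_subdifferential[OF \<alpha>(1) \<alpha>r lip wr gr])
  moreover have "- g \<in> mordukhovich_normal_cone wbar A"
  proof -
    \<comment> \<open>The normals are available only eventually, but the normal cone asks for them
      at every index.\<close>
    define s where "s j = r (j + N)" for j
    have "(\<lambda>j. e (r j) - smoothed_gradient (\<alpha> (r j)) f (w (r j))) \<longlonglongrightarrow> 0 - g"
      by (intro tendsto_intros er gr)
    then have "(\<lambda>j. e (s j) - smoothed_gradient (\<alpha> (s j)) f (w (s j))) \<longlonglongrightarrow> - g"
      unfolding s_def by (simp add: LIMSEQ_ignore_initial_segment[where f = "\<lambda>j. e (r j) - smoothed_gradient (\<alpha> (r j)) f (w (r j))"])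
    moreover have "(\<lambda>j. w (s j)) \<longlonglongrightarrow> wbar"
      unfolding s_def by (rule LIMSEQ_ignore_initial_segment[OF wr])
    moreover have "N \<le> s j" for j
      unfolding s_def using seq_suble[OF r, of "j + N"] by simp
    then have "\<forall>j. w (s j) \<in> A \<and> e (s j) - smoothed_gradient (\<alpha> (s j)) f (w (s j)) \<in> frechet_normals (w (s j)) A"
      using N A(2) by blast
    ultimately show ?thesis
      unfolding mordukhovich_normal_cone_def mem_Collect_eq
      by (intro exI[of _ "\<lambda>j. w (s j)"] exI[of _ "\<lambda>j. e (s j) - smoothed_gradient (\<alpha> (s j)) f (w (s j))"] conjI)
  qed
  ultimately show ?thesis unfolding cm_stationary_def by (metis add.right_inverse)
qed

section \<open>The algorithm\<close>

text \<open>Transfers the bounds from the product law to the given probability space. The residual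
  \<open>e\<close> is asserted outcome by outcome, and measurability is recorded for its squared
  norm \<open>D\<close>. The last conclusion turns a null set for a single sample into one for the
  entire run.\<close>

lemma (in projected_sgd) sampled_run:
  assumes \<mu>_eq: "\<mu> = Pu \<Otimes>\<^sub>M P" and sampling: "spa_sampling \<Omega> Pu P K B R Z"
  obtains D where "D \<in> borel_measurable \<Omega>" and "\<And>\<omega>. 0 \<le> D \<omega>"
    and "(\<integral>\<^sup>+\<omega>. ennreal (D \<omega>) \<partial>\<Omega>) \<le>
      ennreal (descent_const \<rho> * (L * \<Delta> / real K) + (descent_const \<rho> + 2) * (V / real B))"
    and "AE \<omega> in \<Omega>. \<exists>e. (norm e)\<^sup>2 = D \<omega> \<and>
      e - \<Phi> (spa_iterate g \<eta> B \<pi> w1 (Z \<omega>) (R \<omega>)) \<in>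
        frechet_normals (spa_iterate g \<eta> B \<pi> w1 (Z \<omega>) (R \<omega>)) A"
    and "\<And>X. AE z in \<mu>. z \<in> X \<Longrightarrow>
      AE \<omega> in \<Omega>. R \<omega> \<in> {2..K+1} \<and> (\<forall>k\<in>{1..K}. \<forall>m\<in>{1..B}. Z \<omega> k m \<in> X)"
proof -
  interpret \<mu>: prob_space \<mu> by (rule \<mu>)
  interpret PS: prob_space samples by (intro prob_space_PiM) (rule \<mu>)
  define p where "p = pmf_of_set {2..K+1}"
  define N where "N = measure_pmf p \<Otimes>\<^sub>M samples"
  define T where "T \<omega> = (R \<omega>, \<lambda>(k, m)\<in>idx. Z \<omega> k m)" for \<omega>
  have T: "T \<in> measurable \<Omega> N" and distr: "distr \<Omega> N T = N"
    using sampling unfolding spa_sampling_def Let_def \<mu>_eq[symmetric] N_def p_def T_def[abs_def] by auto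
  have AE_T: "AE \<omega> in \<Omega>. Pr (T \<omega>)" if "AE y in N. Pr y" for Pr
    by (rule AE_distrD[OF T]) (simp only: distr that)
  have AE_fst: "AE y in N. fst y \<in> {2..K+1}"
  proof (rule AE_distrD[where f = fst and M' = "measure_pmf p"])
    show "fst \<in> measurable N (measure_pmf p)" by (simp add: N_def)
    have "set_pmf p = {2..K+1}" unfolding p_def using K by (intro set_pmf_of_set) auto
    then show "AE r in distr N (measure_pmf p) fst. r \<in> {2..K+1}"
      unfolding N_def PS.distr_pair_fst AE_measure_pmf_iff by simp
  qed
  have R: "AE \<omega> in \<Omega>. R \<omega> \<in> {2..K+1}"
    using AE_T[OF AE_fst] by (simp add: T_def)
  define D where "D \<omega> = output_residual_sq (T \<omega>)" for \<omega>
  have meas: "output_residual_sq \<in> borel_measurable N"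
    unfolding N_def p_def by (rule output_residual_sq_measurable)
  show thesis
  proof (rule that[of D])
    show "D \<in> borel_measurable \<Omega>"
      unfolding D_def by (rule measurable_compose[OF T meas])
    show "0 \<le> D \<omega>" for \<omega>
      by (simp add: D_def T_def output_residual_sq_def)
    have "(\<integral>\<^sup>+\<omega>. ennreal (D \<omega>) \<partial>\<Omega>) = (\<integral>\<^sup>+y. ennreal (output_residual_sq y) \<partial>distr \<Omega> N T)"
      unfolding D_def using meas by (subst nn_integral_distr[OF T]) auto
    also have "\<dots> = (\<integral>\<^sup>+y. ennreal (output_residual_sq y) \<partial>N)" by (simp only: distr)
    also have "\<dots> \<le> ennreal (descent_const \<rho> * (L * \<Delta> / real K) + (descent_const \<rho> + 2) * (V / real B))"
      unfolding N_def p_def by (rule output_residual_expectation)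
    finally show "(\<integral>\<^sup>+\<omega>. ennreal (D \<omega>) \<partial>\<Omega>) \<le> \<dots>" .
    show "AE \<omega> in \<Omega>. \<exists>e. (norm e)\<^sup>2 = D \<omega> \<and>
      e - \<Phi> (spa_iterate g \<eta> B \<pi> w1 (Z \<omega>) (R \<omega>)) \<in>
        frechet_normals (spa_iterate g \<eta> B \<pi> w1 (Z \<omega>) (R \<omega>)) A"
      using R
    proof eventually_elim
      case (elim \<omega>)
      define k where "k = R \<omega> - 1"
      have k: "0 < k" "R \<omega> = Suc k" "k \<le> K" using elim by (auto simp: k_def)
      define \<zeta> where "\<zeta> = (\<lambda>(k, m)\<in>idx. Z \<omega> k m)"
      \<comment> \<open>Restricting the samples to \<open>idx\<close> changes nothing, since iterate
        \<open>Suc k\<close> reads iterations up to \<open>k \<le> K\<close> only.\<close>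
      have "spa_iterate g \<eta> B \<pi> w1 (Z \<omega>) (R \<omega>) = iter (Suc k) \<zeta>"
        unfolding iter_def k(2) by (rule spa_iterate_cong[OF w1 \<pi>]) (use k(3) in \<open>auto simp: \<zeta>_def\<close>)
      moreover have "D \<omega> = (norm (residual k \<zeta>))\<^sup>2"
        using elim by (simp add: D_def T_def output_residual_sq_def \<zeta>_def k_def)
      ultimately show ?case using residual_normal[OF k(1)] by metis
    qed
  next
    fix X assume X: "AE z in \<mu>. z \<in> X"
    have "AE y in N. \<forall>i\<in>idx. snd y i \<in> X"
    proof (rule AE_distrD[where f = snd and M' = samples])
      show "snd \<in> measurable N samples" by (simp add: N_def)
      have "AE \<zeta> in samples. \<forall>i\<in>idx. \<zeta> i \<in> X"
        by (intro AE_finite_allI AE_PiM_component[where P = "\<lambda>z. z \<in> X"] \<mu> X) auto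
      then show "AE \<zeta> in distr N samples snd. \<forall>i\<in>idx. \<zeta> i \<in> X"
        unfolding N_def measure_pmf.distr_snd_pair[OF PS.sigma_finite_measure_axioms] .
    qed
    from AE_T[OF this] R show "AE \<omega> in \<Omega>. R \<omega> \<in> {2..K+1} \<and> (\<forall>k\<in>{1..K}. \<forall>m\<in>{1..B}. Z \<omega> k m \<in> X)"
      by eventually_elim (auto simp: T_def)
  qed
qed

text \<open>The two updates share the mean direction; their difference shows only in the second
  moment, through \<upsilon>.\<close>

lemma (in stochastic_loss) spa_projected_sgd:
  assumes \<alpha>: "0 < \<alpha>" and \<rho>: "1 < \<rho>"
    and G_meas: "upd = Gradient_Estimate \<Longrightarrow> (\<lambda>(w, x). G w x) \<in> borel_measurable borel"
    and G_AE: "\<And>w. upd = Gradient_Estimate \<Longrightarrow> w \<in> A \<Longrightarrow>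
      AE z in smoothing_law \<alpha> \<Otimes>\<^sub>M P. GDERIV (\<lambda>v. F v (snd z)) (w + fst z) :> G (w + fst z) (snd z)"
    and \<upsilon>: "\<upsilon> = (case upd of Finite_Difference \<Rightarrow> real CARD('d) | Gradient_Estimate \<Rightarrow> 1)"
    and \<eta>: "\<eta> = \<alpha> / (3 * \<rho> * sqrt (real CARD('d)) * L0)"
    and \<pi>: "\<And>k. \<pi> k \<in> borel_measurable borel" "\<And>k x. \<pi> k x \<in> proj_set A x"
    and w1: "w1 \<in> A" and \<Delta>: "\<And>w. w \<in> A \<Longrightarrow> smoothed \<alpha> f w1 - smoothed \<alpha> f w \<le> \<Delta>"
    and B: "0 < B" and K: "0 < K"
  shows "projected_sgd (smoothing_law \<alpha> \<Otimes>\<^sub>M P) (spa_direction upd \<alpha> F G) (smoothed \<alpha> f)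
    (smoothed_gradient \<alpha> f) A \<pi> w1 (2 * sqrt (real CARD('d)) * L0 / \<alpha>) \<rho> \<eta> (\<upsilon> * Q) \<Delta> K B"
proof (rule projected_sgd.intro)
  let ?g = "spa_direction upd \<alpha> F G"
  show "(\<lambda>(w, z). ?g w (fst z) (snd z)) \<in> borel_measurable (borel \<Otimes>\<^sub>M (smoothing_law \<alpha> \<Otimes>\<^sub>M P))"
    using finite_diff_measurable[OF \<alpha>] gradient_estimate_measurable[OF \<alpha> G_meas] by (cases upd) auto
  fix w assume w: "w \<in> A"
  show "(\<integral>z. ?g w (fst z) (snd z) \<partial>(smoothing_law \<alpha> \<Otimes>\<^sub>M P)) = smoothed_gradient \<alpha> f w"
    using finite_diff_mean[OF \<alpha>] gradient_estimate_mean[OF \<alpha> G_meas G_AE[OF _ w]] by (cases upd) auto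
  show "(\<integral>\<^sup>+z. ennreal ((norm (?g w (fst z) (snd z)))\<^sup>2) \<partial>(smoothing_law \<alpha> \<Otimes>\<^sub>M P)) \<le> ennreal (\<upsilon> * Q)"
  proof (rule second_moment_bound[OF \<alpha>])
    show "AE z in smoothing_law \<alpha> \<Otimes>\<^sub>M P. norm (?g w (fst z) (snd z)) \<le> sqrt \<upsilon> * Lip (snd z)"
      using finite_diff_norm_bound[OF \<alpha>, of w] gradient_estimate_norm_bound[OF \<alpha> G_meas G_AE[OF _ w]]
      by (cases upd) (auto simp: \<upsilon>)
    show "0 \<le> \<upsilon>" by (simp add: \<upsilon> split: spa_update.split)
  qed
next
  show "prob_space ((smoothing_law \<alpha> :: (real ^ 'd) measure) \<Otimes>\<^sub>M P)" by (rule prob_space_\<mu>[OF \<alpha>])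
  show "0 \<le> \<upsilon> * Q" using Q_pos by (auto simp: \<upsilon> split: spa_update.split)
  show "GDERIV (smoothed \<alpha> f) w :> smoothed_gradient \<alpha> f w" for w
    by (rule smoothed_GDERIV[OF \<alpha> f_Lipschitz])
  show "norm (smoothed_gradient \<alpha> f w - smoothed_gradient \<alpha> f w') \<le>
      2 * sqrt (real CARD('d)) * L0 / \<alpha> * norm (w - w')" for w w'
    by (rule smoothed_gradient_Lipschitz[OF \<alpha> f_Lipschitz])
  show "0 < 2 * sqrt (real CARD('d)) * L0 / \<alpha>" using \<alpha> L0 by simp
  show "1 / \<eta> = 3 * \<rho> / 2 * (2 * sqrt (real CARD('d)) * L0 / \<alpha>)" by (simp add: \<eta>)
qed (fact \<rho> \<pi> w1 \<Delta> B K)+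

text \<open>Convergence in L1 becomes almost sure along a subsequence \<open>r\<close> that is
  chosen before the outcome. One null set then serves all further subsequences \<open>q\<close> and
  limits, so both may depend on the outcome. Starting from a prescribed \<open>s\<close> covers
  accumulation points that are reached along that \<open>s\<close>.\<close>

lemma stationarity_along_L1_small_residuals:
  fixes f :: "real ^ 'd::finite \<Rightarrow> real" and W :: "nat \<Rightarrow> 'o \<Rightarrow> real ^ 'd"
  assumes \<alpha>: "\<And>i. 0 < \<alpha> i" "\<alpha> \<longlonglongrightarrow> 0"
    and lip: "\<And>w w'. \<bar>f w - f w'\<bar> \<le> l * norm (w - w')"
    and A: "closed A" "\<And>i \<omega>. W i \<omega> \<in> A"
    and D_meas: "\<And>i. D i \<in> borel_measurable \<Omega>" and D_nonneg: "\<And>i \<omega>. 0 \<le> D i \<omega>"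
    and D_bound: "\<And>i. (\<integral>\<^sup>+\<omega>. ennreal (D i \<omega>) \<partial>\<Omega>) \<le> ennreal (b i)" and b: "\<And>i. 0 \<le> b i" "b \<longlonglongrightarrow> 0"
    and D_normal: "\<And>i. AE \<omega> in \<Omega>. \<exists>e. (norm e)\<^sup>2 = D i \<omega> \<and>
      e - smoothed_gradient (\<alpha> i) f (W i \<omega>) \<in> frechet_normals (W i \<omega>) A"
    and s: "strict_mono (s :: nat \<Rightarrow> nat)"
  obtains r :: "nat \<Rightarrow> nat" where "strict_mono r"
    and "AE \<omega> in \<Omega>. \<forall>q wbar. strict_mono q \<longrightarrow> (\<lambda>j. W (s (r (q j))) \<omega>) \<longlonglongrightarrow> wbar \<longrightarrow> cm_stationary f A wbar"
proof -
  have int: "integrable \<Omega> (D i)" for i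
    using D_meas D_nonneg D_bound[of i] by (intro integrableI_bounded) (auto intro: le_less_trans)
  have le: "(\<integral>\<omega>. norm (D i \<omega>) \<partial>\<Omega>) \<le> b i" for i
    using nn_integral_eq_integral[OF int, of i] D_nonneg D_bound[of i] b(1)[of i] by simp
  have "(\<lambda>j. \<integral>\<omega>. norm (D (s j) \<omega>) \<partial>\<Omega>) \<longlonglongrightarrow> 0"
  proof (rule tendsto_sandwich[where f = "\<lambda>_. 0" and h = "\<lambda>j. b (s j)"])
    show "(\<lambda>j. b (s j)) \<longlonglongrightarrow> 0" using LIMSEQ_subseq_LIMSEQ[OF b(2) s] by (simp add: comp_def)
    show "\<forall>\<^sub>F j in sequentially. (\<integral>\<omega>. norm (D (s j) \<omega>) \<partial>\<Omega>) \<le> b (s j)"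
      by (intro always_eventually allI le)
  qed auto
  then obtain r where r: "strict_mono r" and lim: "AE \<omega> in \<Omega>. (\<lambda>j. D (s (r j)) \<omega>) \<longlonglongrightarrow> 0"
    using tendsto_L1_AE_subseq[of \<Omega> "\<lambda>j. D (s j)"] int by blast
  have "AE \<omega> in \<Omega>. \<forall>i. \<exists>e. (norm e)\<^sup>2 = D i \<omega> \<and>
      e - smoothed_gradient (\<alpha> i) f (W i \<omega>) \<in> frechet_normals (W i \<omega>) A"
    using D_normal by (simp add: AE_all_countable)
  with lim have "AE \<omega> in \<Omega>. \<forall>q wbar. strict_mono q \<longrightarrow> (\<lambda>j. W (s (r (q j))) \<omega>) \<longlonglongrightarrow> wbar \<longrightarrow> cm_stationary f A wbar"
  proof eventually_elim
    case (elim \<omega>)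
    then obtain e where e: "\<And>i. (norm (e i))\<^sup>2 = D i \<omega>"
        "\<And>i. e i - smoothed_gradient (\<alpha> i) f (W i \<omega>) \<in> frechet_normals (W i \<omega>) A"
      by metis
    show ?case
    proof (intro allI impI)
      fix q :: "nat \<Rightarrow> nat" and wbar assume q: "strict_mono q" and conv: "(\<lambda>j. W (s (r (q j))) \<omega>) \<longlonglongrightarrow> wbar"
      have "(\<lambda>j. sqrt ((norm (e (s (r j))))\<^sup>2)) \<longlonglongrightarrow> sqrt 0"
        unfolding e(1) by (intro tendsto_intros elim(1))
      then have "(\<lambda>j. e (s (r j))) \<longlonglongrightarrow> 0"
        by (simp add: tendsto_norm_zero_iff)
      then have e0: "(\<lambda>j. e (s (r (q j)))) \<longlonglongrightarrow> 0"
        using LIMSEQ_subseq_LIMSEQ[OF _ q, of "\<lambda>j. e (s (r j))"] by (simp add: comp_def)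
      have "strict_mono (\<lambda>j. s (r (q j)))"
        using s r q by (simp add: strict_mono_def)
      from LIMSEQ_subseq_LIMSEQ[OF \<alpha>(2) this] have \<alpha>0: "(\<lambda>j. \<alpha> (s (r (q j)))) \<longlonglongrightarrow> 0"
        by (simp add: comp_def)
      show "cm_stationary f A wbar"
        by (rule smoothed_stationarity_limit[OF \<alpha>(1) \<alpha>0 lip A(1) A(2) conv _ e0]) (simp add: e(2))
    qed
  qed
  with r show thesis by (rule that)
qed

section \<open>Extension of the loss from the cube to the whole space\<close>

lemma cube_infinity: "cube \<infinity> = UNIV"
  by (simp add: cube_def)

lemma closed_convex_cube:
  shows "closed (cube r :: (real ^ 'd::finite) set)" and "convex (cube r :: (real ^ 'd::finite) set)"
proof -
  have "closed (cube r :: (real ^ 'd) set) \<and> convex (cube r :: (real ^ 'd) set)"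
  proof (cases r)
    case MInf
    then have "cube r = ({} :: (real ^ 'd) set)" by (simp add: cube_def)
    then show ?thesis by simp
  qed (simp_all add: cube_eq_cbox cube_infinity closed_cbox)
  then show "closed (cube r :: (real ^ 'd) set)" "convex (cube r :: (real ^ 'd) set)" by auto
qed

lemma zero_in_cube: "0 < r \<Longrightarrow> 0 \<in> cube r"
  by (cases r) (auto simp: cube_def)

text \<open>The nearest-point map onto a closed convex set is continuous and nonexpansive, so it
  preserves measurability as well as the Lipschitz bound. For infinite \<kappa> it is the
  identity.\<close>

lemma stochastic_loss_extension:
  fixes F :: "real ^ 'd::finite \<Rightarrow> real ^ 'p::finite \<Rightarrow> real" and \<kappa> :: ereal
  defines "F' \<equiv> \<lambda>w. F (closest_point (cube \<kappa>) w)"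
  assumes \<kappa>: "0 < \<kappa>" and P: "prob_space P" "sets P = sets borel"
    and F_meas: "(\<lambda>(w, x). F w x) \<in> borel_measurable (restrict_space borel (cube \<kappa> \<times> UNIV))"
    and F_int: "\<And>w. w \<in> cube \<kappa> \<Longrightarrow> integrable P (F w)"
    and Lip_meas: "Lip \<in> borel_measurable borel"
    and F_Lip: "AE x in P. \<forall>w\<in>cube \<kappa>. \<forall>w'\<in>cube \<kappa>. \<bar>F w x - F w' x\<bar> \<le> Lip x * norm (w - w')"
    and Q: "integrable P (\<lambda>x. (Lip x)\<^sup>2)" "Q = (\<integral>x. (Lip x)\<^sup>2 \<partial>P)"
    and L0: "L0 = (\<integral>x. Lip x \<partial>P)" "0 < L0"
  shows "stochastic_loss P F' Lip (expected_loss P F') L0 Q"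
proof (rule stochastic_loss.intro)
  define c where "c = closest_point (cube \<kappa> :: (real ^ 'd) set)"
  have ne: "cube \<kappa> \<noteq> ({} :: (real ^ 'd) set)" using zero_in_cube[OF \<kappa>] by auto
  have c_in: "c w \<in> cube \<kappa>" for w
    unfolding c_def by (rule closest_point_in_set[OF closed_convex_cube(1) ne])
  have c_le: "norm (c w - c w') \<le> norm (w - w')" for w w'
    using closest_point_lipschitz[OF closed_convex_cube(2,1) ne, of w w'] by (simp add: dist_norm c_def)
  have [measurable]: "c \<in> borel_measurable borel"
    unfolding c_def
    by (intro borel_measurable_continuous_onI continuous_on_closest_point closed_convex_cube ne)
  have pair: "(\<lambda>(w, x). (c w, x :: real ^ 'p)) \<in> measurable borel (restrict_space borel (cube \<kappa> \<times> UNIV))"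
  proof (rule measurable_restrict_space2)
    show "(\<lambda>(w, x). (c w, x :: real ^ 'p)) \<in> measurable borel borel"
      unfolding borel_prod[symmetric] by measurable
  qed (auto simp: c_in)
  show "(\<lambda>(w, x). F' w x) \<in> borel_measurable borel"
    using measurable_compose[OF pair F_meas] by (simp add: F'_def c_def case_prod_beta')
  show "integrable P (F' w)" for w
    unfolding F'_def using F_int[OF c_in] by (simp add: c_def)
  \<comment> \<open>A point \<open>axis i a\<close> of the cube other than 0: comparing the two
    shows that the Lipschitz factor is nonnegative, which monotonicity needs below.\<close>
  obtain a where a: "0 < a" "ereal a < \<kappa>"
    using ereal_dense2[OF \<kappa>] by auto
  show "AE x in P. \<forall>w w'. \<bar>F' w x - F' w' x\<bar> \<le> Lip x * norm (w - w')"
    using F_Lip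
  proof eventually_elim
    case (elim x)
    have "axis i a \<in> cube \<kappa>" for i :: 'd
      using a less_imp_le[OF \<kappa>] by (auto simp: cube_def axis_def zero_ereal_def)
    then have "0 \<le> Lip x * norm (axis undefined a - 0 :: real ^ 'd)"
      using elim zero_in_cube[OF \<kappa>] abs_ge_zero order_trans by blast
    then have Lip: "0 \<le> Lip x"
      using a by (simp add: norm_axis_real zero_le_mult_iff)
    show ?case
    proof (intro allI)
      fix w w'
      have "\<bar>F' w x - F' w' x\<bar> \<le> Lip x * norm (c w - c w')"
        unfolding F'_def c_def[symmetric] using elim c_in by blast
      also have "\<dots> \<le> Lip x * norm (w - w')"
        by (rule mult_left_mono[OF c_le Lip])
      finally show "\<bar>F' w x - F' w' x\<bar> \<le> Lip x * norm (w - w')" .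
    qed
  qed
qed (use assms in auto)

text \<open>Bounds the possible decrease of the smoothed objective on a bounded cube by the diameter
  of that cube.\<close>

lemma smoothed_Lipschitz:
  fixes f :: "real ^ 'd::finite \<Rightarrow> real"
  assumes \<alpha>: "0 < \<alpha>" and lip: "\<And>w w'. \<bar>f w - f w'\<bar> \<le> l * norm (w - w')"
  shows "\<bar>smoothed \<alpha> f w - smoothed \<alpha> f w'\<bar> \<le> l * norm (w - w')"
proof -
  interpret prob_space "smoothing_law \<alpha> :: (real ^ 'd) measure" by (rule prob_space_smoothing_law[OF \<alpha>])
  note int = integrable_smoothing_shift[OF \<alpha> lip]
  have "\<bar>smoothed \<alpha> f w - smoothed \<alpha> f w'\<bar> = \<bar>\<integral>u. f (w + u) - f (w' + u) \<partial>smoothing_law \<alpha>\<bar>"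
    unfolding smoothed_def by (simp add: int)
  also have "\<dots> \<le> (\<integral>u. \<bar>f (w + u) - f (w' + u)\<bar> \<partial>smoothing_law \<alpha>)" by (rule integral_abs_bound)
  also have "\<dots> \<le> (\<integral>u. l * norm (w - w') \<partial>(smoothing_law \<alpha> :: (real ^ 'd) measure))"
  proof (rule integral_mono)
    show "\<bar>f (w + u) - f (w' + u)\<bar> \<le> l * norm (w - w')" for u
      using lip[of "w + u" "w' + u"] by simp
  qed (auto simp: int)
  finally show ?thesis by (simp add: prob_space[simplified])
qed

text \<open>For infinite \<beta> an accumulation point of the random sequence is formalised in two
  ways: as a random limit along a fixed subsequence, and as any accumulation point, reached along
  indices that may depend on the outcome, after a given subsequence has been thinned. Runs with
  different \<open>i\<close> may be coupled arbitrarily.\<close>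

theorem theorem17:
  fixes F :: "real ^ 'd::finite \<Rightarrow> real ^ 'p::finite \<Rightarrow> real"
    and P :: "(real ^ 'p) measure"
    and Lip :: "real ^ 'p \<Rightarrow> real"
    and f :: "real ^ 'd \<Rightarrow> real"
    and S :: "(real ^ 'd) set"
    and \<beta> \<kappa> :: ereal
    and \<epsilon>3 \<epsilon>4 :: "nat \<Rightarrow> real"
    and \<rho> L0 Q \<Delta> C1 C2 \<upsilon> :: real
    and upd :: spa_update
    and \<alpha> \<eta> :: "nat \<Rightarrow> real"
    and K B :: "nat \<Rightarrow> nat"
    and G :: "nat \<Rightarrow> real ^ 'd \<Rightarrow> real ^ 'p \<Rightarrow> real ^ 'd"
    and w_init :: "nat \<Rightarrow> real ^ 'd"
    and \<pi> :: "nat \<Rightarrow> nat \<Rightarrow> real ^ 'd \<Rightarrow> real ^ 'd"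
    and \<Omega> :: "'o measure"
    and R :: "nat \<Rightarrow> 'o \<Rightarrow> nat"
    and Z :: "nat \<Rightarrow> 'o \<Rightarrow> nat \<Rightarrow> nat \<Rightarrow> (real ^ 'd) \<times> (real ^ 'p)"
    and W :: "nat \<Rightarrow> 'o \<Rightarrow> real ^ 'd"
  assumes beta: "0 < \<beta>" "\<kappa> = \<infinity> \<longleftrightarrow> \<beta> = \<infinity>" "\<beta> \<noteq> \<infinity> \<Longrightarrow> \<beta> + ereal (\<epsilon>3 0) < \<kappa>"
    and P: "prob_space P" "sets P = sets borel"
    and F_meas: "(\<lambda>(w, x). F w x) \<in> borel_measurable (restrict_space borel (cube \<kappa> \<times> UNIV))"
    and F_int: "\<And>w. w \<in> cube \<kappa> \<Longrightarrow> integrable P (F w)"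
    and F_cont: "\<And>x. continuous_on (cube \<kappa>) (\<lambda>w. F w x)"
    and Lip_meas: "Lip \<in> borel_measurable borel"
    and F_Lip: "AE x in P. \<forall>w\<in>cube \<kappa>. \<forall>w'\<in>cube \<kappa>. \<bar>F w x - F w' x\<bar> \<le> Lip x * norm (w - w')"
    and Q: "integrable P (\<lambda>x. (Lip x)\<^sup>2)" "Q = (\<integral>x. (Lip x)\<^sup>2 \<partial>P)"
    and L0: "L0 = (\<integral>x. Lip x \<partial>P)" "0 < L0"
    and f: "f = expected_loss P F"
    and S: "closed S"
    and eps3: "\<And>i. 0 < \<epsilon>3 i" "\<And>i. \<epsilon>3 (Suc i) < \<epsilon>3 i" "\<epsilon>3 \<longlonglongrightarrow> 0"
    and eps4: "\<And>i. 0 < \<epsilon>4 i" "\<And>i. \<epsilon>4 (Suc i) < \<epsilon>4 i" "\<epsilon>4 \<longlonglongrightarrow> 0"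
    and rho: "1 < \<rho>"
    and C1: "C1 = 2 * (1 + 3 * \<rho>) / (\<rho> - 1) + 3 * \<rho>"
    and C2: "C2 = 2 * (1 + 3 * \<rho>) / (\<rho> - 1) + 3"
    and upsilon: "\<upsilon> = (case upd of Finite_Difference \<Rightarrow> real CARD('d) | Gradient_Estimate \<Rightarrow> 1)"
    and alpha: "\<And>i. \<alpha> i = 2 * \<epsilon>3 i / sqrt (real CARD('d))"
    and K: "\<And>i. K i = nat \<lceil>C1 * (2 * real CARD('d) * L0 * \<Delta> / (\<epsilon>3 i * (\<epsilon>4 i)\<^sup>2))\<rceil>"
    and B: "\<And>i. B i = nat \<lceil>C2 * (2 * \<upsilon> * Q / (\<epsilon>4 i)\<^sup>2)\<rceil>"
    and eta: "\<And>i. \<eta> i = \<alpha> i / (3 * \<rho> * sqrt (real CARD('d)) * L0)"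
    and w_init: "\<And>i. w_init i \<in> S \<inter> cube \<beta>"
    and Delta: "0 < \<Delta>"
      "\<And>i w. w \<in> S \<inter> cube \<beta> \<Longrightarrow> smoothed (\<alpha> i) f (w_init i) - smoothed (\<alpha> i) f w \<le> \<Delta>"
    and G: "\<And>i. upd = Gradient_Estimate \<Longrightarrow> gradient_estimator \<beta> (\<alpha> i) P F (G i)"
    and proj: "\<And>i k. \<pi> i k \<in> borel_measurable borel"
      "\<And>i k x. \<pi> i k x \<in> proj_set (S \<inter> cube \<beta>) x"
    and \<Omega>: "prob_space \<Omega>"
    and sampling: "\<And>i. spa_sampling \<Omega> (smoothing_law (\<alpha> i)) P (K i) (B i) (R i) (Z i)"
    and W: "\<And>i \<omega>. W i \<omega> =
      spa_iterate (spa_direction upd (\<alpha> i) F (G i)) (\<eta> i) (B i) (\<pi> i) (w_init i) (Z i \<omega>) (R i \<omega>)"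
  shows "(\<beta> \<noteq> \<infinity> \<longrightarrow>
            (AE \<omega> in \<Omega>. \<exists>wbar. accumulation_point (\<lambda>i. W i \<omega>) wbar \<and>
                               cm_stationary f (S \<inter> cube \<beta>) wbar)) \<and>
         (\<beta> = \<infinity> \<longrightarrow>
            (\<forall>(s :: nat \<Rightarrow> nat) wbar. strict_mono s \<longrightarrow> (AE \<omega> in \<Omega>. (\<lambda>j. W (s j) \<omega>) \<longlonglongrightarrow> wbar \<omega>) \<longrightarrow>
               (AE \<omega> in \<Omega>. cm_stationary f (S \<inter> cube \<beta>) (wbar \<omega>))) \<and>
            (\<forall>s :: nat \<Rightarrow> nat. strict_mono s \<longrightarrow> (\<exists>r :: nat \<Rightarrow> nat. strict_mono r \<and>
               (AE \<omega> in \<Omega>. \<forall>wbar. accumulation_point (\<lambda>j. W (s (r j)) \<omega>) wbar \<longrightarrow>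
                               cm_stationary f (S \<inter> cube \<beta>) wbar))))"
proof -
  let ?A = "S \<inter> cube \<beta>"
  define d where "d = real CARD('d)"
  have d: "1 \<le> d" by (simp add: d_def Suc_leI)
  have \<alpha>_pos: "0 < \<alpha> i" for i using eps3(1)[of i] by (simp add: alpha)
  have \<alpha>_lim: "\<alpha> \<longlonglongrightarrow> 0"
  proof -
    have "(\<lambda>i. 2 * \<epsilon>3 i / sqrt d) \<longlonglongrightarrow> 2 * 0 / sqrt d"
      using d by (intro tendsto_intros eps3) auto
    then show ?thesis by (simp add: alpha[abs_def] d_def)
  qed
  \<comment> \<open>Indices start at 0, so \<open>\<epsilon>3 0\<close> is the largest term. Half
    the smoothing width is \<open>\<epsilon>3 i\<close> / sqrt d, hence every perturbation fits into
    the gap between \<beta> and \<kappa>.\<close>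
  have \<alpha>_le: "\<alpha> i / 2 \<le> \<epsilon>3 0" for i
  proof -
    have "decseq \<epsilon>3" using eps3(2) by (intro decseq_SucI less_imp_le)
    then have "\<epsilon>3 i \<le> \<epsilon>3 0" by (simp add: decseqD)
    moreover have "\<alpha> i / 2 \<le> \<epsilon>3 i"
      using eps3(1)[of i] d by (simp add: alpha d_def[symmetric] field_simps)
    ultimately show ?thesis by simp
  qed
  have \<kappa>: "0 < \<kappa>"
  proof (cases "\<beta> = \<infinity>")
    case False
    have "0 < \<beta> + ereal (\<epsilon>3 0)" using beta(1) eps3(1)[of 0] by (simp add: add_pos_pos)
    then show ?thesis using beta(3)[OF False] by (rule less_trans)
  qed (use beta in simp)
  \<comment> \<open>The strict inequality makes this set open: gradients and Clarke derivatives are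
    local, so the loss and its extension must agree on a neighbourhood of every point that is
    evaluated.\<close>
  define U where "U = {z :: real ^ 'd. \<forall>i. ereal \<bar>z $ i\<bar> < \<kappa>}"
  have U_open: "open U"
  proof (cases \<kappa>)
    case (real k)
    then have "U = box (\<chi> i. - k) (\<chi> i. k)" by (auto simp: U_def mem_box_cart abs_less_iff minus_less_iff)
    then show ?thesis by (simp add: open_box)
  qed (use \<kappa> in \<open>auto simp: U_def\<close>)
  have U_cube: "U \<subseteq> cube \<kappa>" by (auto simp: U_def cube_def less_imp_le)
  have near_U: "z \<in> U" if w: "w \<in> cube \<beta>" and z: "\<And>j. \<bar>z $ j - w $ j\<bar> \<le> \<alpha> i / 2" for w z i
  proof (cases "\<beta> = \<infinity>")
    case False
    then obtain b where b: "\<beta> = ereal b" using beta(1) by (cases \<beta>) auto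
    have "ereal \<bar>z $ j\<bar> \<le> \<beta> + ereal (\<epsilon>3 0)" for j
    proof -
      have "\<bar>w $ j\<bar> \<le> b" using w by (simp add: cube_def b)
      then have "\<bar>z $ j\<bar> \<le> b + \<epsilon>3 0" using z[of j] \<alpha>_le[of i] by linarith
      then show ?thesis by (simp add: b)
    qed
    then show ?thesis using beta(3)[OF False] by (auto simp: U_def intro: le_less_trans)
  qed (use beta in \<open>simp add: U_def\<close>)
  have A_U: "?A \<subseteq> U"
    using near_U[where i = 0] \<alpha>_pos[of 0] by (auto intro: less_imp_le)
  define F' where "F' w = F (closest_point (cube \<kappa>) w)" for w
  have F'_eq: "F' w = F w" if "w \<in> U" for w
    using that U_cube by (auto simp: F'_def closest_point_self)
  define f' where "f' = expected_loss P F'"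
  have f'_eq: "f w = f' w" if "w \<in> U" for w
    using F'_eq[OF that] by (simp add: f f'_def expected_loss_def)
  interpret stochastic_loss P F' Lip f' L0 Q
    unfolding f'_def F'_def[abs_def]
    by (rule stochastic_loss_extension[OF \<kappa> P F_meas F_int Lip_meas F_Lip Q L0])
  \<comment> \<open>The value 0 off the enlarged cube makes the estimator Borel on the whole space;
    the algorithm almost surely never evaluates it there.\<close>
  define G' where "G' i w x = (if w \<in> cube (\<beta> + ereal (\<alpha> i / 2)) then G i w x else 0)" for i w x
  have G'_meas: "(\<lambda>(w, x). G' i w x) \<in> borel_measurable borel" if upd: "upd = Gradient_Estimate" for i
  proof -
    let ?C = "cube (\<beta> + ereal (\<alpha> i / 2)) \<times> UNIV :: ((real ^ 'd) \<times> (real ^ 'p)) set"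
    have C: "?C \<in> sets borel" by (intro borel_closed closed_Times closed_convex_cube) simp
    have "(\<lambda>(w, x). G i w x) \<in> borel_measurable (restrict_space borel ?C)"
      using G[OF upd, of i] unfolding gradient_estimator_def by blast
    then have "(\<lambda>y. if y \<in> ?C then (\<lambda>(w, x). G i w x) y else 0) \<in> borel_measurable borel"
      using C by (subst measurable_restrict_space_iff[symmetric]) auto
    also have "(\<lambda>y. if y \<in> ?C then (\<lambda>(w, x). G i w x) y else 0) = (\<lambda>(w, x). G' i w x)"
      by (auto simp: G'_def fun_eq_iff)
    finally show ?thesis .
  qed
  have shift_cube: "w + u \<in> cube (\<beta> + ereal (\<alpha> i / 2)) \<and> w + u \<in> U"
    if "w \<in> cube \<beta>" "u \<in> cube (ereal (\<alpha> i / 2))" for w u i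
  proof
    show "w + u \<in> U" using that(2) by (intro near_U[OF that(1), of _ i]) (simp add: cube_def)
    show "w + u \<in> cube (\<beta> + ereal (\<alpha> i / 2))"
      unfolding cube_def
    proof (intro CollectI allI)
      fix j
      have "ereal \<bar>(w + u) $ j\<bar> \<le> ereal \<bar>w $ j\<bar> + ereal \<bar>u $ j\<bar>" by simp
      also have "\<dots> \<le> \<beta> + ereal (\<alpha> i / 2)" using that unfolding cube_def by (intro add_mono) auto
      finally show "ereal \<bar>(w + u) $ j\<bar> \<le> \<beta> + ereal (\<alpha> i / 2)" .
    qed
  qed
  have AE_u: "AE z in smoothing_law (\<alpha> i) \<Otimes>\<^sub>M P. fst z \<in> cube (ereal (\<alpha> i / 2))" for i
  proof (rule AE_distrD[where f = fst and M' = "smoothing_law (\<alpha> i)"])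
    show "AE u in distr (smoothing_law (\<alpha> i) \<Otimes>\<^sub>M P) (smoothing_law (\<alpha> i)) fst. u \<in> cube (ereal (\<alpha> i / 2))"
      unfolding data.distr_pair_fst by (rule AE_smoothing_law_cube)
  qed simp
  have G'_AE: "AE z in smoothing_law (\<alpha> i) \<Otimes>\<^sub>M P. GDERIV (\<lambda>v. F' v (snd z)) (w + fst z) :> G' i (w + fst z) (snd z)"
    if upd: "upd = Gradient_Estimate" and w: "w \<in> ?A" for i w
  proof -
    have "AE z in smoothing_law (\<alpha> i) \<Otimes>\<^sub>M P. GDERIV (\<lambda>v. F v (snd z)) (w + fst z) :> G i (w + fst z) (snd z)"
      using G[OF upd, of i] w unfolding gradient_estimator_def by (auto simp: case_prod_beta')
    with AE_u show ?thesis
    proof eventually_elim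
      case (elim z)
      note U = shift_cube[OF _ elim(1), of w]
      have "((\<lambda>v. F' v (snd z)) has_derivative (\<lambda>h. h \<bullet> G i (w + fst z) (snd z))) (at (w + fst z))"
        by (rule has_derivative_transform_within_open[OF elim(2)[unfolded gderiv_def] U_open])
           (use U w F'_eq in auto)
      then show ?case using U w by (simp add: gderiv_def G'_def)
    qed
  qed
  have dir_eq: "spa_direction upd (\<alpha> i) F (G i) w u x = spa_direction upd (\<alpha> i) F' (G' i) w u x"
    if "w \<in> ?A" "u \<in> cube (ereal (\<alpha> i / 2))" for i w u x
  proof (cases upd)
    case Finite_Difference
    have "(\<chi> j. if j = k then w $ k + s else w $ j + u $ j) \<in> U" if "\<bar>s\<bar> \<le> \<alpha> i / 2" for k s
      using that \<open>w \<in> ?A\<close> \<open>u \<in> _\<close> by (intro near_U[of w _ i]) (auto simp: cube_def)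
    from this[of "\<alpha> i / 2"] this[of "- (\<alpha> i / 2)"] show ?thesis
      using \<alpha>_pos[of i] by (simp add: Finite_Difference finite_diff_def F'_eq cong: if_cong)
  next
    case Gradient_Estimate
    then show ?thesis using shift_cube[of w u i] that by (simp add: G'_def)
  qed
  \<comment> \<open>Outside \<open>cube \<kappa>\<close> the function \<open>f\<close> need not be measurable, and then \<open>smoothed (\<alpha> i) f\<close> is the junk
    value 0 of the Bochner integral, so the bound by \<open>\<Delta>\<close> does not transfer to \<open>f'\<close>. For finite \<open>\<beta>\<close> the
    diameter of the cube gives another bound; any bound that is uniform in \<open>i\<close> suffices for convergence.\<close>
  obtain \<Delta>' where \<Delta>': "0 \<le> \<Delta>'" "\<And>i w. w \<in> ?A \<Longrightarrow> smoothed (\<alpha> i) f' (w_init i) - smoothed (\<alpha> i) f' w \<le> \<Delta>'"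
  proof (cases "\<beta> = \<infinity>")
    case True
    then have "U = UNIV" using beta(2) by (simp add: U_def)
    then have "f' = f" using f'_eq by auto
    then show thesis using that[of \<Delta>] Delta by simp
  next
    case False
    then obtain b where b: "\<beta> = ereal b" using beta(1) by (cases \<beta>) auto
    show thesis
    proof (rule that[of "L0 * (2 * (sqrt d * b))"])
      show "0 \<le> L0 * (2 * (sqrt d * b))" using L0 d b beta(1) by simp
      fix i w assume w: "w \<in> ?A"
      have "smoothed (\<alpha> i) f' (w_init i) - smoothed (\<alpha> i) f' w \<le> L0 * norm (w_init i - w)"
        using smoothed_Lipschitz[OF \<alpha>_pos f_Lipschitz, of i "w_init i" w] by simp
      also have "norm (w_init i - w) \<le> norm (w_init i) + norm w" by (rule norm_triangle_ineq4)
      also have "\<dots> \<le> 2 * (sqrt d * b)"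
        using norm_le_of_mem_cube[of w b] norm_le_of_mem_cube[of "w_init i" b] w w_init[of i] by (simp add: b d_def)
      finally show "smoothed (\<alpha> i) f' (w_init i) - smoothed (\<alpha> i) f' w \<le> L0 * (2 * (sqrt d * b))"
        using L0 by simp
    qed
  qed
  have C_pos: "0 < C1" "0 < C2" using rho by (auto simp: C1 C2 intro!: add_nonneg_pos)
  have \<upsilon>: "0 < \<upsilon>" by (simp add: upsilon split: spa_update.split)
  have K_le: "C1 * (2 * d * L0 * \<Delta> / (\<epsilon>3 i * (\<epsilon>4 i)\<^sup>2)) \<le> real (K i)" for i
    unfolding K d_def by (rule of_nat_ceiling)
  have B_le: "C2 * (2 * \<upsilon> * Q / (\<epsilon>4 i)\<^sup>2) \<le> real (B i)" for i
    unfolding B by (rule of_nat_ceiling)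
  have K_pos': "0 < C1 * (2 * d * L0 * \<Delta> / (\<epsilon>3 i * (\<epsilon>4 i)\<^sup>2))" for i
    using C_pos d L0 Delta eps3(1)[of i] eps4(1)[of i] by simp
  have B_pos': "0 < C2 * (2 * \<upsilon> * Q / (\<epsilon>4 i)\<^sup>2)" for i
    using C_pos \<upsilon> Q_pos eps4(1)[of i] by simp
  have K_pos: "0 < real (K i)" and B_pos: "0 < real (B i)" for i
    using K_le[of i] K_pos'[of i] B_le[of i] B_pos'[of i] by linarith+
  define L where "L i = 2 * sqrt (real CARD('d)) * L0 / \<alpha> i" for i
  \<comment> \<open>Rounding up only enlarges \<open>K i\<close> and \<open>B i\<close>, so each
    error term is at most its value at the unrounded size. \<open>K i\<close> is built from \<Delta>
    while the descent is bounded by \<Delta>', hence the ratio of the two.\<close>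
  define c where "c = descent_const \<rho> * (\<Delta>' / \<Delta> / (2 * C1)) + (descent_const \<rho> + 2) * (1 / (2 * C2))"
  have c_bound: "descent_const \<rho> * (L i * \<Delta>' / real (K i)) + (descent_const \<rho> + 2) * (\<upsilon> * Q / real (B i))
      \<le> c * (\<epsilon>4 i)\<^sup>2" for i
  proof -
    \<comment> \<open>One factor sqrt d stems from the gradient and another from \<alpha>; together
      they are the d in \<open>K i\<close>.\<close>
    have L: "L i = d * L0 / \<epsilon>3 i"
      using d eps3(1)[of i] by (simp add: L_def alpha d_def[symmetric] field_simps)
    have "L i * \<Delta>' / real (K i) \<le> L i * \<Delta>' / (C1 * (2 * d * L0 * \<Delta> / (\<epsilon>3 i * (\<epsilon>4 i)\<^sup>2)))"
    proof (rule divide_left_mono[OF K_le])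
      show "0 \<le> L i * \<Delta>'" using \<Delta>'(1) d L0(2) eps3(1)[of i] unfolding L by simp
    qed (rule mult_pos_pos[OF K_pos K_pos'])
    also have "\<dots> = \<Delta>' / \<Delta> / (2 * C1) * (\<epsilon>4 i)\<^sup>2"
      using C_pos d L0 Delta(1) eps3(1)[of i] eps4(1)[of i] unfolding L by (simp add: field_simps)
    finally have 1: "L i * \<Delta>' / real (K i) \<le> \<Delta>' / \<Delta> / (2 * C1) * (\<epsilon>4 i)\<^sup>2" .
    have "\<upsilon> * Q / real (B i) \<le> \<upsilon> * Q / (C2 * (2 * \<upsilon> * Q / (\<epsilon>4 i)\<^sup>2))"
    proof (rule divide_left_mono[OF B_le])
      show "0 \<le> \<upsilon> * Q" using \<upsilon> Q_pos by simp
    qed (rule mult_pos_pos[OF B_pos B_pos'])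
    also have "\<dots> = 1 / (2 * C2) * (\<epsilon>4 i)\<^sup>2"
      using C_pos \<upsilon> Q_pos eps4(1)[of i] by (simp add: field_simps)
    finally have 2: "\<upsilon> * Q / real (B i) \<le> 1 / (2 * C2) * (\<epsilon>4 i)\<^sup>2" .
    have "descent_const \<rho> * (L i * \<Delta>' / real (K i)) + (descent_const \<rho> + 2) * (\<upsilon> * Q / real (B i)) \<le>
      descent_const \<rho> * (\<Delta>' / \<Delta> / (2 * C1) * (\<epsilon>4 i)\<^sup>2) + (descent_const \<rho> + 2) * (1 / (2 * C2) * (\<epsilon>4 i)\<^sup>2)"
      using 1 2 descent_const_nonneg[OF rho] by (intro add_mono mult_left_mono) auto
    then show ?thesis by (simp add: c_def algebra_simps)
  qed
  have c: "0 \<le> c" using C_pos \<Delta>' Delta(1) descent_const_nonneg[OF rho] by (simp add: c_def)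
  have W_in: "W i \<omega> \<in> ?A" for i \<omega>
    unfolding W by (rule spa_iterate_in[OF w_init proj(2)])
  define good where "good i D \<longleftrightarrow> D \<in> borel_measurable \<Omega> \<and> (\<forall>\<omega>. 0 \<le> D \<omega>) \<and>
      (\<integral>\<^sup>+\<omega>. ennreal (D \<omega>) \<partial>\<Omega>) \<le> ennreal (c * (\<epsilon>4 i)\<^sup>2) \<and>
      (AE \<omega> in \<Omega>. \<exists>e. (norm e)\<^sup>2 = D \<omega> \<and>
        e - smoothed_gradient (\<alpha> i) f' (W i \<omega>) \<in> frechet_normals (W i \<omega>) ?A)" for i and D :: "'o \<Rightarrow> real"
  have "\<exists>D. good i D" for i
  proof -
    interpret sgd: projected_sgd "smoothing_law (\<alpha> i) \<Otimes>\<^sub>M P" "spa_direction upd (\<alpha> i) F' (G' i)"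
      "smoothed (\<alpha> i) f'" "smoothed_gradient (\<alpha> i) f'" ?A "\<pi> i" "w_init i" "L i" \<rho> "\<eta> i" "\<upsilon> * Q" \<Delta>' "K i" "B i"
      unfolding L_def
      by (rule spa_projected_sgd[OF \<alpha>_pos rho G'_meas G'_AE upsilon eta proj w_init \<Delta>'(2)])
         (use B_pos[of i] K_pos[of i] in auto)
    obtain D where D: "D \<in> borel_measurable \<Omega>" "\<And>\<omega>. 0 \<le> D \<omega>"
      "(\<integral>\<^sup>+\<omega>. ennreal (D \<omega>) \<partial>\<Omega>) \<le>
        ennreal (descent_const \<rho> * (L i * \<Delta>' / real (K i)) + (descent_const \<rho> + 2) * (\<upsilon> * Q / real (B i)))"
      and normal: "AE \<omega> in \<Omega>. \<exists>e. (norm e)\<^sup>2 = D \<omega> \<and>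
        e - smoothed_gradient (\<alpha> i) f' (spa_iterate (spa_direction upd (\<alpha> i) F' (G' i)) (\<eta> i) (B i) (\<pi> i) (w_init i) (Z i \<omega>) (R i \<omega>))
        \<in> frechet_normals (spa_iterate (spa_direction upd (\<alpha> i) F' (G' i)) (\<eta> i) (B i) (\<pi> i) (w_init i) (Z i \<omega>) (R i \<omega>)) ?A"
      and samples: "\<And>X. AE z in smoothing_law (\<alpha> i) \<Otimes>\<^sub>M P. z \<in> X \<Longrightarrow>
        AE \<omega> in \<Omega>. R i \<omega> \<in> {2..K i+1} \<and> (\<forall>k\<in>{1..K i}. \<forall>m\<in>{1..B i}. Z i \<omega> k m \<in> X)"
      by (rule sgd.sampled_run[OF refl sampling[of i]]) blast
    \<comment> \<open>Off this null set every perturbation lies in the smoothing cube, where the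
      original and extended directions coincide, so both produce the same output.\<close>
    have good_u: "AE \<omega> in \<Omega>. R i \<omega> \<in> {2..K i+1} \<and> (\<forall>k\<in>{1..K i}. \<forall>m\<in>{1..B i}. fst (Z i \<omega> k m) \<in> cube (ereal (\<alpha> i / 2)))"
      using samples[of "{z. fst z \<in> cube (ereal (\<alpha> i / 2))}"] AE_u[of i] by simp
    have "AE \<omega> in \<Omega>. \<exists>e. (norm e)\<^sup>2 = D \<omega> \<and>
        e - smoothed_gradient (\<alpha> i) f' (W i \<omega>) \<in> frechet_normals (W i \<omega>) ?A"
      using normal good_u
    proof eventually_elim
      case (elim \<omega>)
      have "W i \<omega> = spa_iterate (spa_direction upd (\<alpha> i) F' (G' i)) (\<eta> i) (B i) (\<pi> i) (w_init i) (Z i \<omega>) (R i \<omega>)"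
        unfolding W by (rule spa_iterate_cong[OF w_init proj(2)]) (use elim(2) in \<open>auto intro!: dir_eq\<close>)
      with elim(1) show ?case by simp
    qed
    moreover have "(\<integral>\<^sup>+\<omega>. ennreal (D \<omega>) \<partial>\<Omega>) \<le> ennreal (c * (\<epsilon>4 i)\<^sup>2)"
      using D(3) ennreal_leI[OF c_bound[of i]] by (rule order_trans)
    ultimately show ?thesis using D(1,2) unfolding good_def by blast
  qed
  then obtain D where good: "\<And>i. good i (D i)" by metis
  then have D: "\<And>i. D i \<in> borel_measurable \<Omega>" "\<And>i \<omega>. 0 \<le> D i \<omega>"
    "\<And>i. (\<integral>\<^sup>+\<omega>. ennreal (D i \<omega>) \<partial>\<Omega>) \<le> ennreal (c * (\<epsilon>4 i)\<^sup>2)"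
    "\<And>i. AE \<omega> in \<Omega>. \<exists>e. (norm e)\<^sup>2 = D i \<omega> \<and>
        e - smoothed_gradient (\<alpha> i) f' (W i \<omega>) \<in> frechet_normals (W i \<omega>) ?A"
    unfolding good_def by blast+
  have A: "closed ?A" using S by (intro closed_Int closed_convex_cube)
  have "(\<lambda>i. c * (\<epsilon>4 i)\<^sup>2) \<longlonglongrightarrow> c * 0\<^sup>2"
    by (intro tendsto_intros eps4)
  then have b: "0 \<le> c * (\<epsilon>4 i)\<^sup>2" "(\<lambda>i. c * (\<epsilon>4 i)\<^sup>2) \<longlonglongrightarrow> 0" for i
    using c by simp_all
  have subsequence: "\<exists>r :: nat \<Rightarrow> nat. strict_mono r \<and>
      (AE \<omega> in \<Omega>. \<forall>q wbar. strict_mono q \<longrightarrow> (\<lambda>j. W (s (r (q j))) \<omega>) \<longlonglongrightarrow> wbar \<longrightarrow> cm_stationary f ?A wbar)"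
    if s: "strict_mono s" for s
  proof -
    obtain r :: "nat \<Rightarrow> nat" where r: "strict_mono r"
      "AE \<omega> in \<Omega>. \<forall>q wbar. strict_mono q \<longrightarrow> (\<lambda>j. W (s (r (q j))) \<omega>) \<longlonglongrightarrow> wbar \<longrightarrow> cm_stationary f' ?A wbar"
      by (rule stationarity_along_L1_small_residuals[OF \<alpha>_pos \<alpha>_lim f_Lipschitz A W_in D(1,2,3) b(1,2) D(4) s])
         blast
    \<comment> \<open>Stationary points lie in \<open>?A\<close>, hence in the open set
      \<open>U\<close> on which \<open>f\<close> and \<open>f'\<close> agree.\<close>
    have "cm_stationary f ?A wbar" if "cm_stationary f' ?A wbar" for wbar
    proof -
      have "wbar \<in> U" using that A_U by (auto simp: cm_stationary_def)
      then show ?thesis using that cm_stationary_cong[of U wbar f f' ?A] U_open f'_eq by blast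
    qed
    then have "AE \<omega> in \<Omega>. \<forall>q wbar. strict_mono q \<longrightarrow> (\<lambda>j. W (s (r (q j))) \<omega>) \<longlonglongrightarrow> wbar \<longrightarrow> cm_stationary f ?A wbar"
      using r(2) by (auto elim: eventually_mono)
    with r(1) show ?thesis by blast
  qed
  show ?thesis
  proof (intro conjI impI allI)
    assume fin: "\<beta> \<noteq> \<infinity>"
    then obtain b where "\<beta> = ereal b" using beta(1) by (cases \<beta>) auto
    then have "compact ?A" using S by (simp add: cube_eq_cbox closed_Int_compact)
    obtain r :: "nat \<Rightarrow> nat" where r: "strict_mono r"
      "AE \<omega> in \<Omega>. \<forall>q wbar. strict_mono q \<longrightarrow> (\<lambda>j. W (r (q j)) \<omega>) \<longlonglongrightarrow> wbar \<longrightarrow> cm_stationary f ?A wbar"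
      using subsequence[OF strict_mono_id] by auto
    show "AE \<omega> in \<Omega>. \<exists>wbar. accumulation_point (\<lambda>i. W i \<omega>) wbar \<and> cm_stationary f ?A wbar"
      using r(2)
    proof eventually_elim
      case (elim \<omega>)
      \<comment> \<open>\<open>q\<close> and \<open>wbar\<close> depend on the outcome, while
        \<open>r\<close> does not.\<close>
      obtain wbar q where q: "strict_mono q" "((\<lambda>j. W (r j) \<omega>) \<circ> q) \<longlonglongrightarrow> wbar"
        using \<open>compact ?A\<close> W_in unfolding compact_def by (metis (no_types, lifting))
      have "accumulation_point (\<lambda>i. W i \<omega>) wbar"
        unfolding accumulation_point_def using strict_mono_o[OF r(1) q(1)] q(2)
        by (intro exI[of _ "r \<circ> q"]) (simp add: comp_def)
      then show ?case using elim q by (auto simp: comp_def)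
    qed
  next
    fix s :: "nat \<Rightarrow> nat" and wbar
    assume s: "strict_mono s" and conv: "AE \<omega> in \<Omega>. (\<lambda>j. W (s j) \<omega>) \<longlonglongrightarrow> wbar \<omega>"
    obtain r :: "nat \<Rightarrow> nat" where r: "strict_mono r"
      "AE \<omega> in \<Omega>. \<forall>q wbar. strict_mono q \<longrightarrow> (\<lambda>j. W (s (r (q j))) \<omega>) \<longlonglongrightarrow> wbar \<longrightarrow> cm_stationary f ?A wbar"
      using subsequence[OF s] by auto
    show "AE \<omega> in \<Omega>. cm_stationary f ?A (wbar \<omega>)"
      using conv r(2)
    proof eventually_elim
      case (elim \<omega>)
      \<comment> \<open>Thinning by \<open>r\<close> keeps the limit, so the further subsequence can
        be the identity.\<close>
      from LIMSEQ_subseq_LIMSEQ[OF elim(1) r(1)] have "(\<lambda>j. W (s (r (id j))) \<omega>) \<longlonglongrightarrow> wbar \<omega>"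
        by (simp add: comp_def)
      then show ?case using elim(2) strict_mono_id by blast
    qed
  next
    fix s :: "nat \<Rightarrow> nat"
    assume s: "strict_mono s"
    obtain r :: "nat \<Rightarrow> nat" where r: "strict_mono r"
      "AE \<omega> in \<Omega>. \<forall>q wbar. strict_mono q \<longrightarrow> (\<lambda>j. W (s (r (q j))) \<omega>) \<longlonglongrightarrow> wbar \<longrightarrow> cm_stationary f ?A wbar"
      using subsequence[OF s] by auto
    show "\<exists>r :: nat \<Rightarrow> nat. strict_mono r \<and> (AE \<omega> in \<Omega>. \<forall>wbar. accumulation_point (\<lambda>j. W (s (r j)) \<omega>) wbar \<longrightarrow>
        cm_stationary f ?A wbar)"
      using r by (intro exI[of _ r]) (auto simp: accumulation_point_def comp_def elim!: eventually_mono)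
  qed
qed

end
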